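(* Let $k$ be a modulus, let $\gamma_e,\gamma_o,z_0$ be constant complex parameters with $\gamma_e+\gamma_o\neq0$ (the non-autonomous case), put $z_j=(\gamma_e+\gamma_o)j+z_0$, fix $n\in\mathbb{Z}$, and let $\varphi_a:(f,g)\mapsto(\bar f,\bar g)$ be the mapping of $\mathbb{P}^1\times\mathbb{P}^1$ to itself given (first $\bar g$, then $\bar f$) by $$\bar g=\frac{(1-k^2 s^4)\,c_e d_e\, fg-(c_e^2-c^2)\,c\,d-(1-k^2s_e^2s^2)\,c\,d\,f^2}{k^2(c_e^2-c^2)\,c\,d\,f^2g-(1-k^2s^4)\,c_ed_e\,f+(1-k^2s_e^2s^2)\,c\,d\,g},$$ $$\bar f=\frac{(1-k^2\hat s^4)\,c_od_o\,\bar g f-(c_o^2-\hat c^2)\,\hat c\,\hat d-(1-k^2s_o^2\hat s^2)\,\hat c\,\hat d\,\bar g^2}{k^2(c_o^2-\hat c^2)\,\hat c\,\hat d\,\bar g^2f-(1-k^2\hat s^4)\,c_od_o\,\bar g+(1-k^2s_o^2\hat s^2)\,\hat c\,\hat d\,f},$$ where $(s,c,d)=(\mathrm{sn},\mathrm{cn},\mathrm{dn})(z_{2n})$, $(\hat s,\hat c,\hat d)=(\mathrm{sn},\mathrm{cn},\mathrm{dn})(z_{2n+1})$, $(s_e,c_e,d_e)=(\mathrm{sn},\mathrm{cn},\mathrm{dn})(\gamma_e)$, $(s_o,c_o,d_o)=(\mathrm{sn},\mathrm{cn},\mathrm{dn})(\gamma_o)$. Then the base points of $\varphi_a$ are the eight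 points $$p_{1},p_2=\pm\big(\mathrm{sn}(z_{2n}+K),\mathrm{sn}(\gamma_e+K)\big),\qquad p_3,p_4=\pm\big(\mathrm{sn}(\gamma_o+K),\mathrm{sn}(z_{2n-1}+K)\big),$$ $$p_5,p_6=\pm\big(\mathrm{sn}(z_{2n}+K+iK'),\mathrm{sn}(\gamma_e+K+iK')\big),\qquad p_7,p_8=\pm\big(\mathrm{sn}(\gamma_o+K+iK'),\mathrm{sn}(z_{2n-1}+K+iK')\big),$$ where in each pair the first point has the sign $+$ and the second the sign $-$. They are resolved by blowing up each of them once (there is no further base point on the exceptional lines), so this list of base points is complete. These points lie on the biquadratic curve $$A_1(1+k^2f^2g^2)+A_2fg+A_3(f^2+g^2)=0,$$ where, with $P=\mathrm{sn}(\gamma_e+K)\,\mathrm{sn}(z_{2n}+K)$, $S=\mathrm{sn}(\gamma_e+K)^2+\mathrm{sn}(z_{2n}+K)^2$, $P'=\mathrm{sn}(\gamma_o+K)\,\mathrm{sn}(z_{2n-1}+K)$, $S'=\mathrm{sn}(\gamma_o+K)^2+\mathrm{sn}(z_{2n-1}+K)^2$, $$A_1=P'S-PS',\qquad A_2=(1+k^2P^2)S'-(1+k^2P'^2)S,\qquad A_3=P(1+k^2P'^2)-P'(1+k^2P^2).$$ In this configuration no three base points are collinear, which is equivalent to this curve being an elliptic curve. The initial value space (the blow-up of $\mathbb{P}^1\times\mathbb{P}^1$ at $p_1,\dots,p_8$) can be identified with the elliptic surface of type $A_0^{(1)}$ (the ell-$A_0^{(1)}$ surface) in Sakai's classification.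
   Context: $\mathrm{sn},\mathrm{cn},\mathrm{dn}$ are the Jacobi elliptic functions of modulus $k$, and $K=K(k)$, $K'=K'(k)$ the complete elliptic integrals (quarter-periods). A base point of the map is a point where the map is ill defined (takes the form $0/0$). The map $\varphi_a$ is the second-order equation $$\mathrm{cn}(\gamma_j)\mathrm{dn}(\gamma_j)(1-k^2\mathrm{sn}^4(z_j))u_j(u_{j+1}+u_{j-1})-\mathrm{cn}(z_j)\mathrm{dn}(z_j)(1-k^2\mathrm{sn}^2(z_j)\mathrm{sn}^2(\gamma_j))(u_{j+1}u_{j-1}+u_j^2)+(\mathrm{cn}^2(z_j)-\mathrm{cn}^2(\gamma_j))\mathrm{cn}(z_j)\mathrm{dn}(z_j)(1+k^2u_j^2u_{j+1}u_{j-1})=0$$ ($\gamma_j=\gamma_e$ for $j$ even, $\gamma_o$ for $j$ odd) written with $f=u_{2n}$, $g=u_{2n-1}$, $\bar g=u_{2n+1}$, $\bar f=u_{2n+2}$. In Sakai's classification of rational surfaces obtained by blowing up eight points of $\mathbb{P}^1\times\mathbb{P}^1$, type ell-$A_0^{(1)}$ is the case in which the eight points lie on a smooth biquadratic (elliptic) curve, whose strict transform represents the anti-canonical class $2H_f+2H_g-\sum_{i=1}^8e_i$ ($H_f,H_g$ being the classes of $f=$ const and $g=$ const, and $e_i$ the exceptional classes).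
   Formalization: Added: all sn, cn, dn values in the map and A_i are finite; c, d, 1-k²s⁴, c_e²-c², 1-k²s_e²s² nonzero, likewise for the second step; z_{2n} not ±γ_o and γ_e+γ_o not 0 modulo 2K, iK'. Else the claim fails or is undefined. Collinear means on a line f=const or g=const. *)

theory Defs
  imports "HOL-Complex_Analysis.Complex_Analysis"
begin

section \<open>Jacobi elliptic functions and quarter periods\<close>

text \<open>
  The modulus is complex; the two cuts are those of the principal branches of \<open>K(k)\<close> and \<open>K'(k)\<close>.
  Every real \<open>k\<close> with \<open>0 < k < 1\<close> is a modulus.
\<close>

definition elliptic_modulus :: "complex \<Rightarrow> bool" where
  "elliptic_modulus k \<longleftrightarrow> \<not> (k\<^sup>2 \<in> \<real> \<and> (Re (k\<^sup>2) \<le> 0 \<or> Re (k\<^sup>2) \<ge> 1))"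

definition complete_elliptic_integral :: "complex \<Rightarrow> complex" where
  "complete_elliptic_integral m =
     integral {0..pi/2} (\<lambda>\<theta>. 1 / csqrt (1 - m * of_real ((sin \<theta>)\<^sup>2)))"

definition quarter_period :: "complex \<Rightarrow> complex" where
  "quarter_period k = complete_elliptic_integral (k\<^sup>2)"

definition quarter_period' :: "complex \<Rightarrow> complex" where
  "quarter_period' k = complete_elliptic_integral (1 - k\<^sup>2)"

text \<open>
  \<open>(sn, cn, dn)\<close> is the unique meromorphic solution on the whole plane of the Jacobi system.
  The three functions have the same poles. At a pole \<open>nicely_meromorphic_on\<close>
  prescribes the value 0.
\<close>

definition jacobi_elliptic ::
  "complex \<Rightarrow> (complex \<Rightarrow> complex) \<Rightarrow> (complex \<Rightarrow> complex) \<Rightarrow> (complex \<Rightarrow> complex) \<Rightarrow> bool" where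
  "jacobi_elliptic k sn cn dn \<longleftrightarrow>
     sn nicely_meromorphic_on UNIV \<and> cn nicely_meromorphic_on UNIV \<and>
     dn nicely_meromorphic_on UNIV \<and>
     \<not> is_pole sn 0 \<and> sn 0 = 0 \<and> cn 0 = 1 \<and> dn 0 = 1 \<and>
     (\<forall>u. \<not> is_pole sn u \<longrightarrow>
        (sn has_field_derivative cn u * dn u) (at u) \<and>
        (cn has_field_derivative - (sn u * dn u)) (at u) \<and>
        (dn has_field_derivative - (k\<^sup>2 * sn u * cn u)) (at u))"


section \<open>The projective line\<close>

datatype P1 = Aff complex | Infty

fun hom_coords :: "P1 \<Rightarrow> complex \<times> complex" where
  "hom_coords (Aff x) = (x, 1)"
| "hom_coords Infty = (1, 0)"

definition P1_of_ratio :: "complex \<Rightarrow> complex \<Rightarrow> P1" where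
  "P1_of_ratio a b = (if b = 0 then Infty else Aff (a / b))"

definition P1_quotient :: "complex \<Rightarrow> complex \<Rightarrow> P1 option" where
  "P1_quotient a b = (if a = 0 \<and> b = 0 then None else Some (P1_of_ratio a b))"

fun P1_minus :: "P1 \<Rightarrow> P1" where
  "P1_minus (Aff x) = Aff (- x)"
| "P1_minus Infty = Infty"

definition P1_value :: "(complex \<Rightarrow> complex) \<Rightarrow> complex \<Rightarrow> P1" where
  "P1_value F u = (if is_pole F u then Infty else Aff (F u))"

type_synonym P1xP1 = "P1 \<times> P1"

definition point_minus :: "P1xP1 \<Rightarrow> P1xP1" where
  "point_minus p = (P1_minus (fst p), P1_minus (snd p))"


section \<open>The mapping\<close>

text \<open>
  One half-step: \<open>u\<^sub>j\<^sub>+\<^sub>1\<close> as a function of \<open>X = u\<^sub>j\<close> and \<open>Y = u\<^sub>j\<^sub>-\<^sub>1\<close>. Numerator and denominator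
  are homogenised to bidegree \<open>(2,1)\<close>, so that the quotient makes sense on all of
  \<open>P1 \<times> P1\<close>; \<open>None\<close> is the form 0/0. Arguments: \<open>(s, c, d)\<close> at \<open>z\<^sub>j\<close> and \<open>(S, C, D)\<close> at \<open>\<gamma>\<^sub>j\<close>.
\<close>

definition half_step_num ::
  "complex \<Rightarrow> complex \<times> complex \<times> complex \<Rightarrow> complex \<times> complex \<times> complex \<Rightarrow>
   complex \<times> complex \<Rightarrow> complex \<times> complex \<Rightarrow> complex" where
  "half_step_num k = (\<lambda>(s, c, d) (S, C, D) (X0, X1) (Y0, Y1).
     (1 - k\<^sup>2 * s^4) * C * D * X0 * X1 * Y0
     - (C\<^sup>2 - c\<^sup>2) * c * d * X1\<^sup>2 * Y1
     - (1 - k\<^sup>2 * S\<^sup>2 * s\<^sup>2) * c * d * X0\<^sup>2 * Y1)"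

definition half_step_den ::
  "complex \<Rightarrow> complex \<times> complex \<times> complex \<Rightarrow> complex \<times> complex \<times> complex \<Rightarrow>
   complex \<times> complex \<Rightarrow> complex \<times> complex \<Rightarrow> complex" where
  "half_step_den k = (\<lambda>(s, c, d) (S, C, D) (X0, X1) (Y0, Y1).
     k\<^sup>2 * (C\<^sup>2 - c\<^sup>2) * c * d * X0\<^sup>2 * Y0
     - (1 - k\<^sup>2 * s^4) * C * D * X0 * X1 * Y1
     + (1 - k\<^sup>2 * S\<^sup>2 * s\<^sup>2) * c * d * X1\<^sup>2 * Y0)"

definition half_step ::
  "complex \<Rightarrow> complex \<times> complex \<times> complex \<Rightarrow> complex \<times> complex \<times> complex \<Rightarrow>
   P1 \<Rightarrow> P1 \<Rightarrow> P1 option" where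
  "half_step k v w X Y =
     P1_quotient (half_step_num k v w (hom_coords X) (hom_coords Y))
                 (half_step_den k v w (hom_coords X) (hom_coords Y))"

lemma half_step_Aff:
  assumes "k\<^sup>2 * (C\<^sup>2 - c\<^sup>2) * c * d * f\<^sup>2 * g - (1 - k\<^sup>2 * s^4) * C * D * f
             + (1 - k\<^sup>2 * S\<^sup>2 * s\<^sup>2) * c * d * g \<noteq> 0"
  shows "half_step k (s, c, d) (S, C, D) (Aff f) (Aff g) =
     Some (Aff (((1 - k\<^sup>2 * s^4) * C * D * f * g - (C\<^sup>2 - c\<^sup>2) * c * d
                  - (1 - k\<^sup>2 * S\<^sup>2 * s\<^sup>2) * c * d * f\<^sup>2)
              / (k\<^sup>2 * (C\<^sup>2 - c\<^sup>2) * c * d * f\<^sup>2 * g - (1 - k\<^sup>2 * s^4) * C * D * f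
                  + (1 - k\<^sup>2 * S\<^sup>2 * s\<^sup>2) * c * d * g)))"
  using assms
  by (simp add: half_step_def half_step_num_def half_step_den_def P1_quotient_def P1_of_ratio_def)

text \<open>\<open>ze\<close> and \<open>zo\<close> stand for \<open>z\<^sub>2\<^sub>n\<close> and \<open>z\<^sub>2\<^sub>n\<^sub>+\<^sub>1\<close>.\<close>

definition phi_a ::
  "complex \<Rightarrow> (complex \<Rightarrow> complex) \<Rightarrow> (complex \<Rightarrow> complex) \<Rightarrow> (complex \<Rightarrow> complex) \<Rightarrow>
   complex \<Rightarrow> complex \<Rightarrow> complex \<Rightarrow> complex \<Rightarrow> P1xP1 \<Rightarrow> P1xP1 option" where
  "phi_a k sn cn dn \<gamma>e \<gamma>o ze zo = (\<lambda>(f, g).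
     case half_step k (sn ze, cn ze, dn ze) (sn \<gamma>e, cn \<gamma>e, dn \<gamma>e) f g of
       None \<Rightarrow> None
     | Some g' \<Rightarrow>
         (case half_step k (sn zo, cn zo, dn zo) (sn \<gamma>o, cn \<gamma>o, dn \<gamma>o) g' f of
            None \<Rightarrow> None
          | Some f' \<Rightarrow> Some (f', g')))"

definition base_points :: "(P1xP1 \<Rightarrow> P1xP1 option) \<Rightarrow> P1xP1 set" where
  "base_points \<Phi> = {p. \<Phi> p = None}"

text \<open>
  Genericity of a half-step: apart from \<open>cn \<gamma> dn \<gamma>\<close>, no factor of a coefficient of the second-order
  equation vanishes. If one of them does, numerator and denominator of the half-step have a
  common factor, so that the form 0/0 occurs along a whole curve.
\<close>

definition generic_half_step ::
  "complex \<Rightarrow> (complex \<Rightarrow> complex) \<Rightarrow> (complex \<Rightarrow> complex) \<Rightarrow> (complex \<Rightarrow> complex) \<Rightarrow>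
   complex \<Rightarrow> complex \<Rightarrow> bool" where
  "generic_half_step k sn cn dn z \<gamma> \<longleftrightarrow>
     cn z \<noteq> 0 \<and> dn z \<noteq> 0 \<and> 1 - k\<^sup>2 * sn z ^ 4 \<noteq> 0 \<and>
     (cn z)\<^sup>2 - (cn \<gamma>)\<^sup>2 \<noteq> 0 \<and> 1 - k\<^sup>2 * (sn z)\<^sup>2 * (sn \<gamma>)\<^sup>2 \<noteq> 0"


section \<open>Blowing up a finite set of points, and the lifted map\<close>

text \<open>
  The exceptional line over \<open>p\<close> consists of the tangent directions at \<open>p\<close>, recorded by their slope
  (increment of the second local coordinate over increment of the first).
\<close>

datatype blowup_point = Ordinary P1xP1 | Exceptional P1xP1 P1

definition blowup :: "P1xP1 set \<Rightarrow> blowup_point set" where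
  "blowup B = {Ordinary p | p. p \<notin> B} \<union> {Exceptional p v | p v. p \<in> B}"

fun P1_chart :: "P1 \<Rightarrow> complex \<Rightarrow> P1" where
  "P1_chart (Aff x) t = Aff (x + t)"
| "P1_chart Infty t = P1_of_ratio 1 t"

text \<open>
  The two standard charts of the blow-up near the exceptional line over \<open>p\<close>, composed with the
  blow-down; \<open>{s = 0}\<close> is the exceptional line. The first chart covers the directions of finite
  slope \<open>t\<close>, the second is used for the vertical direction \<open>t = 0\<close>.
\<close>

fun blowup_chart :: "P1xP1 \<Rightarrow> P1 \<Rightarrow> complex \<times> complex \<Rightarrow> P1xP1" where
  "blowup_chart (P, Q) (Aff m) (s, t) = (P1_chart P s, P1_chart Q (s * t))"
| "blowup_chart (P, Q) Infty (s, t) = (P1_chart P (s * t), P1_chart Q s)"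

fun blowup_chart_center :: "P1 \<Rightarrow> complex \<times> complex" where
  "blowup_chart_center (Aff m) = (0, m)"
| "blowup_chart_center Infty = (0, 0)"

definition poly2 :: "complex poly poly \<Rightarrow> complex \<times> complex \<Rightarrow> complex" where
  "poly2 A w = poly (poly A [:snd w:]) (fst w)"

text \<open>
  The lift of \<open>\<Phi>\<close> is regular at the point \<open>v\<close> of the exceptional line over \<open>p\<close>: near that point and
  off the exceptional line, both components are quotients of polynomials in the chart coordinates
  that are not of the form 0/0 at the point.
\<close>

definition regular_on_exceptional :: "(P1xP1 \<Rightarrow> P1xP1 option) \<Rightarrow> P1xP1 \<Rightarrow> P1 \<Rightarrow> bool" where
  "regular_on_exceptional \<Phi> p v \<longleftrightarrow>
     (\<exists>A B C D :: complex poly poly.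
        (poly2 A (blowup_chart_center v), poly2 B (blowup_chart_center v)) \<noteq> (0, 0) \<and>
        (poly2 C (blowup_chart_center v), poly2 D (blowup_chart_center v)) \<noteq> (0, 0) \<and>
        (\<forall>\<^sub>F w in at (blowup_chart_center v) within {w. fst w \<noteq> 0}.
           \<Phi> (blowup_chart p v w) =
             Some (P1_of_ratio (poly2 A w) (poly2 B w), P1_of_ratio (poly2 C w) (poly2 D w))))"

fun lift_base_point :: "(P1xP1 \<Rightarrow> P1xP1 option) \<Rightarrow> blowup_point \<Rightarrow> bool" where
  "lift_base_point \<Phi> (Ordinary p) \<longleftrightarrow> \<Phi> p = None"
| "lift_base_point \<Phi> (Exceptional p v) \<longleftrightarrow> \<not> regular_on_exceptional \<Phi> p v"


section \<open>Curves on P1 x P1\<close>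

text \<open>
  A curve of bidegree \<open>(m, n)\<close> is given by the coefficients \<open>c i j\<close> (\<open>i \<le> m\<close>, \<open>j \<le> n\<close>) of
  \<open>\<Sum> c i j f^i g^j\<close>, homogenised to \<open>\<Sum> c i j X0^i X1^(m-i) Y0^j Y1^(n-j)\<close>.
  \<open>local_monomial m P i\<close> is \<open>X0^i X1^(m-i)\<close> in the local coordinate of \<open>P1_chart P\<close>, and
  \<open>local_coeff\<close> gives the Taylor coefficients of the local equation of the curve.
\<close>

fun local_monomial :: "nat \<Rightarrow> P1 \<Rightarrow> nat \<Rightarrow> complex poly" where
  "local_monomial m (Aff x) i = [:x, 1:] ^ i"
| "local_monomial m Infty i = [:0, 1:] ^ (m - i)"

definition local_coeff ::
  "nat \<Rightarrow> nat \<Rightarrow> (nat \<Rightarrow> nat \<Rightarrow> complex) \<Rightarrow> P1xP1 \<Rightarrow> nat \<Rightarrow> nat \<Rightarrow> complex" where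
  "local_coeff m n c p a b =
     (\<Sum>i\<le>m. \<Sum>j\<le>n. c i j * coeff (local_monomial m (fst p) i) a
                         * coeff (local_monomial n (snd p) j) b)"

definition on_curve :: "nat \<Rightarrow> nat \<Rightarrow> (nat \<Rightarrow> nat \<Rightarrow> complex) \<Rightarrow> P1xP1 \<Rightarrow> bool" where
  "on_curve m n c p \<longleftrightarrow> local_coeff m n c p 0 0 = 0"

definition multiplicity_at :: "nat \<Rightarrow> nat \<Rightarrow> (nat \<Rightarrow> nat \<Rightarrow> complex) \<Rightarrow> P1xP1 \<Rightarrow> nat" where
  "multiplicity_at m n c p = (LEAST r. \<exists>a b. a + b = r \<and> local_coeff m n c p a b \<noteq> 0)"

definition smooth_curve :: "nat \<Rightarrow> nat \<Rightarrow> (nat \<Rightarrow> nat \<Rightarrow> complex) \<Rightarrow> bool" where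
  "smooth_curve m n c \<longleftrightarrow>
     (\<forall>p. on_curve m n c p \<longrightarrow> local_coeff m n c p 1 0 \<noteq> 0 \<or> local_coeff m n c p 0 1 \<noteq> 0)"

text \<open>A smooth biquadratic curve is irreducible and has genus 1.\<close>

abbreviation elliptic_biquadratic :: "(nat \<Rightarrow> nat \<Rightarrow> complex) \<Rightarrow> bool" where
  "elliptic_biquadratic c \<equiv> smooth_curve 2 2 c"

definition symmetric_biquadratic ::
  "complex \<Rightarrow> complex \<Rightarrow> complex \<Rightarrow> complex \<Rightarrow> nat \<Rightarrow> nat \<Rightarrow> complex" where
  "symmetric_biquadratic k A1 A2 A3 i j =
     (if (i, j) = (0, 0) then A1
      else if (i, j) = (2, 2) then A1 * k\<^sup>2
      else if (i, j) = (1, 1) then A2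
      else if (i, j) = (2, 0) \<or> (i, j) = (0, 2) then A3
      else 0)"

lemma on_curve_symmetric_biquadratic_Aff:
  "on_curve 2 2 (symmetric_biquadratic k A1 A2 A3) (Aff f, Aff g) \<longleftrightarrow>
     A1 * (1 + k\<^sup>2 * f\<^sup>2 * g\<^sup>2) + A2 * f * g + A3 * (f\<^sup>2 + g\<^sup>2) = 0"
proof -
  have "local_coeff 2 2 (symmetric_biquadratic k A1 A2 A3) (Aff f, Aff g) 0 0 =
        A1 * (1 + k\<^sup>2 * f\<^sup>2 * g\<^sup>2) + A2 * f * g + A3 * (f\<^sup>2 + g\<^sup>2)"
    by (simp add: local_coeff_def symmetric_biquadratic_def numeral_2_eq_2 algebra_simps)
  then show ?thesis
    by (simp add: on_curve_def)
qed

text \<open>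
  The lines of \<open>P1 \<times> P1\<close> are the curves \<open>f = const\<close> and \<open>g = const\<close> (classes \<open>H\<^sub>f\<close> and \<open>H\<^sub>g\<close>). For
  distinct points this is collinearity in \<open>P3\<close> under the Segre embedding: a line of \<open>P3\<close> meeting
  the quadric in three points lies in it and belongs to a ruling.
\<close>

definition collinear3 :: "P1xP1 \<Rightarrow> P1xP1 \<Rightarrow> P1xP1 \<Rightarrow> bool" where
  "collinear3 p q r \<longleftrightarrow>
     (fst p = fst q \<and> fst q = fst r) \<or> (snd p = snd q \<and> snd q = snd r)"

definition no_three_collinear :: "P1xP1 set \<Rightarrow> bool" where
  "no_three_collinear B \<longleftrightarrow>
     (\<forall>p\<in>B. \<forall>q\<in>B. \<forall>r\<in>B. p \<noteq> q \<and> q \<noteq> r \<and> p \<noteq> r \<longrightarrow> \<not> collinear3 p q r)"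


section \<open>Surfaces of type ell-A0\<close>

text \<open>
  Divisor classes on the blow-up of \<open>P1 \<times> P1\<close> at \<open>p 1, \<dots>, p 8\<close>: the triple \<open>(a, b, \<mu>)\<close> is
  \<open>a H\<^sub>f + b H\<^sub>g + \<Sum> \<mu> i e\<^sub>i\<close>, with \<open>\<mu> i = 0\<close> for \<open>i \<notin> {1..8}\<close>.
\<close>

type_synonym divisor_class = "int \<times> int \<times> (nat \<Rightarrow> int)"

definition anticanonical_class :: divisor_class where
  "anticanonical_class = (2, 2, \<lambda>i. if i \<in> {1..8} then - 1 else 0)"

definition strict_transform_class ::
  "nat \<Rightarrow> nat \<Rightarrow> (nat \<Rightarrow> nat \<Rightarrow> complex) \<Rightarrow> (nat \<Rightarrow> P1xP1) \<Rightarrow> divisor_class" where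
  "strict_transform_class m n c p =
     (int m, int n, \<lambda>i. if i \<in> {1..8} then - int (multiplicity_at m n c (p i)) else 0)"

definition ell_A0_surface :: "(nat \<Rightarrow> P1xP1) \<Rightarrow> bool" where
  "ell_A0_surface p \<longleftrightarrow>
     inj_on p {1..8} \<and>
     (\<exists>c. smooth_curve 2 2 c \<and> (\<forall>i\<in>{1..8}. on_curve 2 2 c (p i)) \<and>
          strict_transform_class 2 2 c p = anticanonical_class)"

end

(*
  Everything is reduced to rational identities in x = cd z_{2n}, y = cd gamma_e, t = cd gamma_o and
  q = cd z_{2n-1}. For fixed X a half-step is a Moebius involution in Y whose determinant
  vanishes exactly at X = +-x, +-1/(kx), which gives four base points; the other four are the
  preimages of the base points of the second half-step, because (t, q) is sent to
  cd z_{2n+1}. The determinant has simple zeros, so the numerators are transversal at each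
  base point and one blow-up resolves it. Both orbits of points lie on the curve
  {(cd u, cd v) : u - v = +-eta} with eta = z_{2n} - gamma_e, whose discriminant
  is a multiple of (1 - f^2) (1 - k^2 f^2); hence the curve is smooth.

  The elliptic functions are only known through their differential equations. The
  addition theorems say that suitable quotients have derivative zero; along the
  path of the Legendre integral the same quotients identify (sn, cn, dn) with (sin, cos,
  sqrt(1 - k^2 sin^2)), which locates K. Jacobi's imaginary transformation locates the pole iK'.
*)
theory Submission
  imports Defs
begin

section \<open>Uniqueness for the Jacobi flow\<close>

text \<open>The obstacle is that every addition formula has a denominator such as 1 - k^2 sn^2 u
  sn^2 v, which may vanish, and that sums of arguments may be poles. So the identities are stated
  multiplied out, proved near 0, where the denominators are close to 1, and continued analytically:
  the poles are countable, hence the set where all arguments are regular is connected. Conversely, a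
  point is shown not to be a pole by a finite limit of sn there. Genericity enters at three places.
  Within one half-step, x \<noteq> 0 and 1 - k^2 x^4 \<noteq> 0 keep the four zeros of the
  determinant distinct. Between the half-steps, x^2 \<noteq> t^2 and k^2 x^2 t^2 \<noteq> 1 keep the
  critical values of f apart, so that only one half-step degenerates at each base point and no
  infinitely near point arises. Finally, sn(\<gamma>e + \<gamma>o) \<noteq> 0 and sn(z_{2n} -
  \<gamma>e) \<noteq> 0 help to give A3 = (P - P')(1 - k^2 P P') \<noteq> 0; otherwise A1, A2, A3
  would all vanish and define no curve.\<close>

lemma jacobi_flow_identities:
  fixes s1 c1 d1 s2 c2 d2 m :: complex
  assumes "s1^2 + c1^2 = 1" "d1^2 + m * s1^2 = 1" "s2^2 + c2^2 = 1" "d2^2 + m * s2^2 = 1"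
  defines "D \<equiv> 1 - m * s1^2 * s2^2"
    and "D' \<equiv> - 2 * m * s1 * s2 * (c1 * d1 * s2 + s1 * c2 * d2)"
  shows "(s1 * s2 * (d1^2 + m * c1^2 - d2^2 - m * c2^2)) * D = (s1 * c2 * d2 - s2 * c1 * d1) * D'"
    and "(c1 * s2 * d2 * d1^2 + s1 * c2 * d1 * d2^2 - s1 * d1 * c2 - c1 * s2 * d2
           - m * s1^2 * s2 * c1 * d2 - m * s1 * s2^2 * d1 * c2) * D
         = (c1 * c2 + s1 * s2 * d1 * d2) * D'"
    and "(m * (c1^2 * d1 * s2 * c2 + s1 * c1 * c2^2 * d2 - s1 * c1 * d2 - d1 * s2 * c2
           - s1^2 * s2 * d1 * c2 - s1 * s2^2 * c1 * d2)) * D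
         = (d1 * d2 + m * s1 * s2 * c1 * c2) * D'"
proof -
  \<comment> \<open>Each identity reads f' D = f D', where ' differentiates along the flow (s, c,
    d)' = (c d, -s d, -m s c) and f / D is the addition formula for sn, cn or dn of the difference
    of the two arguments. The first factor on the left is f' after cancellation.\<close>
  have r: "c1^2 = 1 - s1^2" "d1^2 = 1 - m * s1^2" "c2^2 = 1 - s2^2" "d2^2 = 1 - m * s2^2"
    using assms(1-4) by (auto simp: algebra_simps)
  show "(s1 * s2 * (d1^2 + m * c1^2 - d2^2 - m * c2^2)) * D = (s1 * c2 * d2 - s2 * c1 * d1) * D'"
    unfolding D_def D'_def using r by algebra
  show "(c1 * s2 * d2 * d1^2 + s1 * c2 * d1 * d2^2 - s1 * d1 * c2 - c1 * s2 * d2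
           - m * s1^2 * s2 * c1 * d2 - m * s1 * s2^2 * d1 * c2) * D
         = (c1 * c2 + s1 * s2 * d1 * d2) * D'"
    unfolding D_def D'_def using r by algebra
  show "(m * (c1^2 * d1 * s2 * c2 + s1 * c1 * c2^2 * d2 - s1 * c1 * d2 - d1 * s2 * c2
           - s1^2 * s2 * d1 * c2 - s1 * s2^2 * c1 * d2)) * D
         = (d1 * d2 + m * s1 * s2 * c1 * c2) * D'"
    unfolding D_def D'_def using r by algebra
qed

text \<open>The quotient f / g has derivative zero on a convex set. Both differentials carry the
  common factor \<open>L t h\<close>, so the parameter may be any reparametrisation of the flow,
  over a real or a complex domain.\<close>

lemma quotient_const_of_wronskian:
  fixes f g :: "'a::real_normed_vector \<Rightarrow> complex"
  assumes "convex S"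
    and "\<And>t. t \<in> S \<Longrightarrow> (f has_derivative (\<lambda>h. f' t * L t h)) (at t within S)"
    and "\<And>t. t \<in> S \<Longrightarrow> (g has_derivative (\<lambda>h. g' t * L t h)) (at t within S)"
    and "\<And>t. t \<in> S \<Longrightarrow> f' t * g t = f t * g' t"
    and "\<And>t. t \<in> S \<Longrightarrow> g t \<noteq> 0"
    and "a \<in> S" "b \<in> S"
  shows "f b * g a = f a * g b"
proof -
  have "((\<lambda>t. f t / g t) has_derivative (\<lambda>h. 0)) (at t within S)" if "t \<in> S" for t
  proof -
    have "((\<lambda>t. f t / g t) has_derivative
        (\<lambda>h. (f' t * L t h * g t - f t * (g' t * L t h)) / (g t * g t))) (at t within S)"
      using assms that by (intro has_derivative_divide') auto
    moreover have "f' t * L t h * g t - f t * (g' t * L t h) = 0" for h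
      using assms(4)[OF that] by (auto simp: algebra_simps)
    ultimately show ?thesis by (simp del: has_derivative_divide)
  qed
  then have "f b / g b = f a / g a"
    by (rule has_derivative_zero_unique[OF \<open>convex S\<close>]) (use assms in auto)
  then show ?thesis using assms by (simp add: field_simps)
qed

text \<open>\<open>L t h\<close> is the differential of the elliptic argument. It is h or -h on
  complex balls and h / \<Delta> on intervals of the amplitude, so one notion serves the addition
  theorem and the Legendre integral. The quadratic relations are carried along because the addition
  identities hold modulo them.\<close>

definition jacobi_flow_on ::
  "complex \<Rightarrow> 'a::real_normed_vector set \<Rightarrow> ('a \<Rightarrow> 'a \<Rightarrow> complex) \<Rightarrow>
   ('a \<Rightarrow> complex) \<Rightarrow> ('a \<Rightarrow> complex) \<Rightarrow> ('a \<Rightarrow> complex) \<Rightarrow> bool" where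
  "jacobi_flow_on m S L s c d \<longleftrightarrow>
     (\<forall>t\<in>S. (s has_derivative (\<lambda>h. c t * d t * L t h)) (at t within S) \<and>
            (c has_derivative (\<lambda>h. - (s t * d t) * L t h)) (at t within S) \<and>
            (d has_derivative (\<lambda>h. - (m * s t * c t) * L t h)) (at t within S) \<and>
            (s t)^2 + (c t)^2 = 1 \<and> (d t)^2 + m * (s t)^2 = 1)"

text \<open>Two solutions driven by the same \<open>L\<close> have arguments u1, u2 with constant
  difference; the three quotients are sn, cn and dn of u1 - u2.\<close>

lemma jacobi_flow_difference:
  fixes S :: "'a::real_normed_vector set"
  assumes S: "convex S" and 1: "jacobi_flow_on m S L s1 c1 d1" and 2: "jacobi_flow_on m S L s2 c2 d2"
    and D: "\<And>t. t \<in> S \<Longrightarrow> 1 - m * (s1 t)^2 * (s2 t)^2 \<noteq> 0" and ab: "a \<in> S" "b \<in> S"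
  shows "(s1 b * c2 b * d2 b - s2 b * c1 b * d1 b) * (1 - m * (s1 a)^2 * (s2 a)^2) =
         (s1 a * c2 a * d2 a - s2 a * c1 a * d1 a) * (1 - m * (s1 b)^2 * (s2 b)^2)"
    and "(c1 b * c2 b + s1 b * s2 b * d1 b * d2 b) * (1 - m * (s1 a)^2 * (s2 a)^2) =
         (c1 a * c2 a + s1 a * s2 a * d1 a * d2 a) * (1 - m * (s1 b)^2 * (s2 b)^2)"
    and "(d1 b * d2 b + m * s1 b * s2 b * c1 b * c2 b) * (1 - m * (s1 a)^2 * (s2 a)^2) =
         (d1 a * d2 a + m * s1 a * s2 a * c1 a * c2 a) * (1 - m * (s1 b)^2 * (s2 b)^2)"
proof -
  have r: "(s1 t)^2 + (c1 t)^2 = 1" "(d1 t)^2 + m * (s1 t)^2 = 1"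
    "(s2 t)^2 + (c2 t)^2 = 1" "(d2 t)^2 + m * (s2 t)^2 = 1" if "t \<in> S" for t
    using 1 2 that by (auto simp: jacobi_flow_on_def)
  have d: "(s1 has_derivative (\<lambda>h. c1 t * d1 t * L t h)) (at t within S)"
    "(c1 has_derivative (\<lambda>h. - (s1 t * d1 t) * L t h)) (at t within S)"
    "(d1 has_derivative (\<lambda>h. - (m * s1 t * c1 t) * L t h)) (at t within S)"
    "(s2 has_derivative (\<lambda>h. c2 t * d2 t * L t h)) (at t within S)"
    "(c2 has_derivative (\<lambda>h. - (s2 t * d2 t) * L t h)) (at t within S)"
    "(d2 has_derivative (\<lambda>h. - (m * s2 t * c2 t) * L t h)) (at t within S)" if "t \<in> S" for t
    using 1 2 that unfolding jacobi_flow_on_def by blast+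
  have dD: "((\<lambda>t. 1 - m * (s1 t)^2 * (s2 t)^2) has_derivative (\<lambda>h.
       (- 2 * m * s1 t * s2 t * (c1 t * d1 t * s2 t + s1 t * c2 t * d2 t)) * L t h)) (at t within S)"
    if "t \<in> S" for t
    by (rule has_derivative_eq_rhs, (rule derivative_intros d[OF that])+)
       (simp add: fun_eq_iff algebra_simps power2_eq_square)
  show "(s1 b * c2 b * d2 b - s2 b * c1 b * d1 b) * (1 - m * (s1 a)^2 * (s2 a)^2) =
         (s1 a * c2 a * d2 a - s2 a * c1 a * d1 a) * (1 - m * (s1 b)^2 * (s2 b)^2)"
    by (rule quotient_const_of_wronskian[OF S _ dD jacobi_flow_identities(1)[OF r] D ab],
        rule has_derivative_eq_rhs, (rule derivative_intros d | assumption)+)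
       (simp_all add: fun_eq_iff algebra_simps power2_eq_square)
  show "(c1 b * c2 b + s1 b * s2 b * d1 b * d2 b) * (1 - m * (s1 a)^2 * (s2 a)^2) =
         (c1 a * c2 a + s1 a * s2 a * d1 a * d2 a) * (1 - m * (s1 b)^2 * (s2 b)^2)"
    by (rule quotient_const_of_wronskian[OF S _ dD jacobi_flow_identities(2)[OF r] D ab],
        rule has_derivative_eq_rhs, (rule derivative_intros d | assumption)+)
       (simp_all add: fun_eq_iff algebra_simps power2_eq_square)
  show "(d1 b * d2 b + m * s1 b * s2 b * c1 b * c2 b) * (1 - m * (s1 a)^2 * (s2 a)^2) =
         (d1 a * d2 a + m * s1 a * s2 a * c1 a * c2 a) * (1 - m * (s1 b)^2 * (s2 b)^2)"
    by (rule quotient_const_of_wronskian[OF S _ dD jacobi_flow_identities(3)[OF r] D ab],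
        rule has_derivative_eq_rhs, (rule derivative_intros d | assumption)+)
       (simp_all add: fun_eq_iff algebra_simps power2_eq_square)
qed

text \<open>The hypotheses say that the difference of the two arguments has (sn, cn, dn) = (0, 1,
  1), as the argument 0 has. Adding 0 back gives equality, multiplied by the nonzero
  denominator.\<close>

lemma jacobi_difference_zero_eq:
  fixes s1 c1 d1 s2 c2 d2 m :: complex
  assumes r: "s1^2 + c1^2 = 1" "d1^2 + m * s1^2 = 1" "s2^2 + c2^2 = 1" "d2^2 + m * s2^2 = 1"
    and D: "1 - m * s1^2 * s2^2 \<noteq> 0"
    and s: "s1 * c2 * d2 - s2 * c1 * d1 = 0"
    and c: "c1 * c2 + s1 * s2 * d1 * d2 = 1 - m * s1^2 * s2^2"
    and d: "d1 * d2 + m * s1 * s2 * c1 * c2 = 1 - m * s1^2 * s2^2"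
  shows "s1 = s2" "c1 = c2" "d1 = d2"
proof -
  have "(c1 - c2) * (1 - m * s1^2 * s2^2) = 0" using r s c by algebra
  then show cc: "c1 = c2" using D by simp
  have "(d1 - d2) * (1 - m * s1^2 * s2^2) = 0" using r s d by algebra
  then show dd: "d1 = d2" using D by simp
  have "(s1 - s2) * (1 - m * s1^2 * s2^2) = 0" using r s c d cc dd by algebra
  then show "s1 = s2" using D by simp
qed

lemma jacobi_flow_unique:
  fixes S :: "'a::real_normed_vector set"
  assumes S: "convex S" and 1: "jacobi_flow_on m S L s1 c1 d1" and 2: "jacobi_flow_on m S L s2 c2 d2"
    and D: "\<And>t. t \<in> S \<Longrightarrow> 1 - m * (s1 t)^2 * (s2 t)^2 \<noteq> 0" and ab: "a \<in> S" "b \<in> S"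
    and init: "s1 a = s2 a" "c1 a = c2 a" "d1 a = d2 a"
  shows "s1 b = s2 b" "c1 b = c2 b" "d1 b = d2 b"
proof -
  have r: "(s1 t)^2 + (c1 t)^2 = 1" "(d1 t)^2 + m * (s1 t)^2 = 1"
    "(s2 t)^2 + (c2 t)^2 = 1" "(d2 t)^2 + m * (s2 t)^2 = 1" if "t \<in> S" for t
    using 1 2 that by (auto simp: jacobi_flow_on_def)
  note eq = jacobi_flow_difference[OF S 1 2 D ab]
  have Da: "1 - m * (s1 a)^2 * (s2 a)^2 \<noteq> 0" using D ab by blast
  \<comment> \<open>For equal triples the numerators collapse to the denominator: c^2 + s^2 d^2 = 1
    - m s^4, and likewise d^2 + m s^2 c^2 = 1 - m s^4.\<close>
  have ca: "c1 a * c2 a + s1 a * s2 a * d1 a * d2 a = 1 - m * (s1 a)^2 * (s2 a)^2"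
    using r[OF ab(1)] init by algebra
  have da: "d1 a * d2 a + m * s1 a * s2 a * c1 a * c2 a = 1 - m * (s1 a)^2 * (s2 a)^2"
    using r[OF ab(1)] init by algebra
  have "s1 b * c2 b * d2 b - s2 b * c1 b * d1 b = 0" using eq(1) init Da by simp
  moreover have "c1 b * c2 b + s1 b * s2 b * d1 b * d2 b = 1 - m * (s1 b)^2 * (s2 b)^2"
    using eq(2) Da unfolding ca by (metis mult.commute mult_right_cancel)
  moreover have "d1 b * d2 b + m * s1 b * s2 b * c1 b * c2 b = 1 - m * (s1 b)^2 * (s2 b)^2"
    using eq(3) Da unfolding da by (metis mult.commute mult_right_cancel)
  ultimately show "s1 b = s2 b" "c1 b = c2 b" "d1 b = d2 b"
    using jacobi_difference_zero_eq[OF r[OF ab(2)] D[OF ab(2)]] by auto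
qed

section \<open>Addition theorems\<close>

lemma jacobi_flow_on_uminus:
  assumes "jacobi_flow_on m S L s c d"
  shows "jacobi_flow_on m S (\<lambda>t h. - L t h) (\<lambda>t. - s t) c d"
  unfolding jacobi_flow_on_def
proof (intro ballI conjI)
  fix t assume "t \<in> S"
  then have 1: "(s has_derivative (\<lambda>h. c t * d t * L t h)) (at t within S)"
    "(c has_derivative (\<lambda>h. - (s t * d t) * L t h)) (at t within S)"
    "(d has_derivative (\<lambda>h. - (m * s t * c t) * L t h)) (at t within S)"
    "(s t)^2 + (c t)^2 = 1" "(d t)^2 + m * (s t)^2 = 1"
    using assms by (auto simp: jacobi_flow_on_def)
  show "((\<lambda>t. - s t) has_derivative (\<lambda>h. c t * d t * - L t h)) (at t within S)"
    using has_derivative_minus[OF 1(1)] by simp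
qed (use assms in \<open>auto simp: jacobi_flow_on_def\<close>)

lemma isCont_eventually_ne:
  fixes f :: "'a::t2_space \<Rightarrow> 'b::t2_space"
  assumes "isCont f a" "f a \<noteq> b"
  shows "\<forall>\<^sub>F t in nhds a. f t \<noteq> b"
  using assms tendsto_imp_eventually_ne[of f "f a" "at a" b]
  by (auto simp: eventually_nhds_conv_at isCont_def)

text \<open>Euler's form of the addition theorem, with s = sn u, \<sigma> = sn v, w = sn(u + v), and
  T, \<tau> the products cn dn at u and v. Eliminating T leaves a relation symmetric in s and
  w.\<close>

lemma biquadratic_of_addition:
  fixes s T \<sigma> \<tau> w m :: complex
  assumes T: "T^2 = (1 - s^2) * (1 - m * s^2)" and t: "\<tau>^2 = (1 - \<sigma>^2) * (1 - m * \<sigma>^2)"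
    and w: "w * (1 - m * s^2 * \<sigma>^2) = s * \<tau> + \<sigma> * T" and D: "1 - m * s^2 * \<sigma>^2 \<noteq> 0"
  shows "s^2 + w^2 - 2 * \<tau> * s * w - \<sigma>^2 * (1 + m * s^2 * w^2) = 0"
proof -
  define d N where "d = 1 - m * s^2 * \<sigma>^2" and "N = s * \<tau> + \<sigma> * T"
  have wN: "w * d = N" using w by (simp add: d_def N_def)
  have "(s^2 + w^2 - 2 * \<tau> * s * w - \<sigma>^2 * (1 + m * s^2 * w^2)) * d^2
     = s^2 * d^2 + N^2 - 2 * \<tau> * s * N * d - \<sigma>^2 * (d^2 + m * s^2 * N^2)"
    unfolding wN[symmetric] by (simp add: algebra_simps power2_eq_square)
  also have "N^2 = s^2 * \<tau>^2 + 2 * s * \<sigma> * \<tau> * T + \<sigma>^2 * T^2"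
    unfolding N_def by (simp add: algebra_simps power2_eq_square)
  also have "s^2 * d^2 + (s^2 * \<tau>^2 + 2 * s * \<sigma> * \<tau> * T + \<sigma>^2 * T^2) - 2 * \<tau> * s * N * d
      - \<sigma>^2 * (d^2 + m * s^2 * (s^2 * \<tau>^2 + 2 * s * \<sigma> * \<tau> * T + \<sigma>^2 * T^2)) =
      s^2 * d^2 - \<sigma>^2 * d^2 + (\<sigma>^2 * T^2 - s^2 * \<tau>^2) * d"
    unfolding d_def N_def by (simp add: algebra_simps power2_eq_square)
  also have "\<dots> = 0" unfolding d_def T t by (simp add: algebra_simps power2_eq_square)
  finally show ?thesis using D by (simp add: d_def)
qed

section \<open>Regular points of sn, cn, dn and analytic continuation\<close>

locale jacobi_functions =
  fixes k :: complex and sn cn dn :: "complex \<Rightarrow> complex"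
  assumes jacobi: "jacobi_elliptic k sn cn dn"
begin

definition regular_points :: "complex set" where
  "regular_points = {u. \<not> is_pole sn u}"

lemma at_0: "0 \<in> regular_points" "sn 0 = 0" "cn 0 = 1" "dn 0 = 1"
  using jacobi by (auto simp: jacobi_elliptic_def regular_points_def)

lemma derivs:
  assumes "u \<in> regular_points"
  shows "(sn has_field_derivative cn u * dn u) (at u)"
    and "(cn has_field_derivative - (sn u * dn u)) (at u)"
    and "(dn has_field_derivative - (k^2 * sn u * cn u)) (at u)"
  using jacobi assms by (auto simp: jacobi_elliptic_def regular_points_def)

lemma poles_sparse: "{u. is_pole sn u} sparse_in UNIV"
proof -
  have "sn meromorphic_on UNIV"
    using jacobi by (auto simp: jacobi_elliptic_def nicely_meromorphic_on_def)
  then show ?thesis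
    by (meson open_UNIV meromorphic_on_isolated_singularity meromorphic_on_meromorphic_at
        not_islimpt_poles sparse_in_open)
qed

lemma regular_points_eq: "regular_points = UNIV - {u. is_pole sn u}"
  by (auto simp: regular_points_def)

lemma open_regular_points: "open regular_points"
  unfolding regular_points_eq using poles_sparse by (intro open_diff_sparse_pts) auto

lemma countable_poles: "countable (- regular_points)"
  using sparse_imp_countable[OF open_UNIV poles_sparse] by (simp add: regular_points_eq Compl_Diff_eq)

lemma eventually_regular: "\<forall>\<^sub>F w in at u. w \<in> regular_points"
  using poles_sparse by (simp add: sparse_in_eventually_iff regular_points_def)

lemma filterlim_affine_at:
  assumes "e \<noteq> 0"
  shows "filterlim (\<lambda>w. e * w + c) (at (e * u + c)) (at (u::complex))"
proof (rule filterlim_atI)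
  show "((\<lambda>w. e * w + c) \<longlongrightarrow> e * u + c) (at u)" by (intro tendsto_intros)
  show "\<forall>\<^sub>F w in at u. e * w + c \<noteq> e * u + c"
    using assms by (auto simp: eventually_at intro!: exI[of _ 1])
qed

lemma eventually_regular_affine:
  assumes "e \<noteq> 0"
  shows "\<forall>\<^sub>F w in at u. e * w + c \<in> regular_points"
  using eventually_compose_filterlim[OF eventually_regular filterlim_affine_at[OF assms]] .

text \<open>At a pole sn tends to infinity, which the finite limit of \<open>F\<close> excludes. The
  affine argument covers translations (e = 1) and reflections (e = -1).\<close>

lemma regularI:
  assumes "e \<noteq> 0" "\<forall>\<^sub>F w in at u. sn (e * w + c) = F w" "(F \<longlongrightarrow> l) (at u)"
  shows "e * u + c \<in> regular_points"
proof (rule ccontr)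
  assume "e * u + c \<notin> regular_points"
  then have "filterlim sn at_infinity (at (e * u + c))"
    by (simp add: regular_points_def is_pole_def)
  then have "filterlim (\<lambda>w. sn (e * w + c)) at_infinity (at u)"
    by (rule filterlim_compose[OF _ filterlim_affine_at[OF assms(1)]])
  then have "filterlim F at_infinity (at u)"
    using filterlim_cong[OF refl refl assms(2)] by blast
  then show False
    using not_tendsto_and_filterlim_at_infinity[OF _ assms(3)] by simp
qed

lemma countable_not_regular_affine:
  assumes "e \<noteq> 0"
  shows "countable {u. e * u + c \<notin> regular_points}"
proof -
  have "{u. e * u + c \<notin> regular_points} = (\<lambda>v. (v - c) / e) ` (- regular_points)"
    using assms by (auto simp: image_iff field_simps intro!: bexI[of _ "e * _ + c"])
  then show ?thesis using countable_poles by simp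
qed

lemma holomorphic_comp:
  assumes "g holomorphic_on A" "\<And>u. u \<in> A \<Longrightarrow> g u \<in> regular_points"
  shows "(\<lambda>u. sn (g u)) holomorphic_on A" "(\<lambda>u. cn (g u)) holomorphic_on A"
    "(\<lambda>u. dn (g u)) holomorphic_on A"
proof -
  have 1: "sn holomorphic_on regular_points" "cn holomorphic_on regular_points"
    "dn holomorphic_on regular_points"
    using derivs by (auto simp: holomorphic_on_open[OF open_regular_points])
  have 2: "g ` A \<subseteq> regular_points" using assms(2) by auto
  show "(\<lambda>u. sn (g u)) holomorphic_on A" "(\<lambda>u. cn (g u)) holomorphic_on A"
    "(\<lambda>u. dn (g u)) holomorphic_on A"
    using 1[THEN holomorphic_on_compose_gen[OF assms(1)], OF 2] by (simp_all add: o_def)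
qed

text \<open>Removing a countable set from the plane leaves it connected, and the affine preimages of
  the poles are countable.\<close>

lemma open_connected_affine:
  assumes "finite I" "\<And>e c. (e, c) \<in> I \<Longrightarrow> e \<noteq> 0"
    and M: "M = {u. \<forall>(e, c)\<in>I. e * u + c \<in> regular_points}"
  shows "open M" "connected M"
proof -
  have "M = (\<Inter>(e, c)\<in>I. (\<lambda>u. e * u + c) -` regular_points)"
    unfolding M by auto
  also have "open \<dots>"
    using assms(1) by (intro open_INT ballI, simp, clarsimp)
      (intro continuous_open_vimage open_regular_points continuous_intros)
  finally show "open M" .
  have "countable (\<Union>(e, c)\<in>I. {u. e * u + c \<notin> regular_points})"
    by (intro countable_UN countable_finite[OF assms(1)]) (auto intro: countable_not_regular_affine dest: assms(2))
  then have "connected (UNIV - (\<Union>(e, c)\<in>I. {u. e * u + c \<notin> regular_points}))"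
    by (intro connected_open_diff_countable) auto
  also have "UNIV - (\<Union>(e, c)\<in>I. {u. e * u + c \<notin> regular_points}) = M"
    unfolding M by auto
  finally show "connected M" .
qed

lemma open_connected_two:
  assumes "e1 \<noteq> 0" "e2 \<noteq> 0"
    and M: "M = {u. e1 * u + c1 \<in> regular_points \<and> e2 * u + c2 \<in> regular_points}"
  shows "open M" "connected M"
  by (rule open_connected_affine[of "{(e1, c1), (e2, c2)}"]; use assms in auto)+

text \<open>The base point is always 0: there sn vanishes, so that the denominators of the addition
  formulas are 1 and the identities can first be proved in a neighbourhood.\<close>

lemma identity_continuation_affine:
  assumes I: "finite I" "\<And>e c. (e, c) \<in> I \<Longrightarrow> e \<noteq> 0"
    and M: "M = {u. \<forall>(e, c)\<in>I. e * u + c \<in> regular_points}"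
    and F: "F holomorphic_on M"
    and ev: "\<forall>\<^sub>F u in nhds 0. F u = 0" and 0: "0 \<in> M" and u: "u \<in> M"
  shows "F u = 0"
proof -
  have oc: "open M" "connected M" using open_connected_affine[OF I(1) _ M] I(2) by blast+
  have "\<forall>\<^sub>F u in nhds 0. F u = 0 \<and> u \<in> M"
    using ev eventually_nhds_in_open[OF oc(1) 0] by eventually_elim auto
  then obtain U where "open U" "0 \<in> U" "\<forall>u\<in>U. F u = 0 \<and> u \<in> M"
    unfolding eventually_nhds by blast
  then show ?thesis
    using analytic_continuation_open[OF \<open>open U\<close> oc(1) _ oc(2) _ F, of "\<lambda>_. 0" u] u
    by (auto simp: subset_iff)
qed

lemma identity_continuation:
  assumes "e1 \<noteq> 0" "e2 \<noteq> 0"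
    and M: "M = {u. e1 * u + c1 \<in> regular_points \<and> e2 * u + c2 \<in> regular_points}"
    and "F holomorphic_on M" "\<forall>\<^sub>F u in nhds 0. F u = 0" "0 \<in> M" "u \<in> M"
  shows "F u = 0"
  by (rule identity_continuation_affine[of "{(e1, c1), (e2, c2)}" M]) (use assms in auto)

lemma pythagoras:
  assumes "u \<in> regular_points"
  shows "(sn u)^2 + (cn u)^2 = 1" "(dn u)^2 + k^2 * (sn u)^2 = 1"
proof -
  have conn: "connected regular_points"
    using open_connected_two(2)[of 1 1 regular_points 0 0] by simp
  have const: "f u = f 0" if d: "\<And>v. v \<in> regular_points \<Longrightarrow> (f has_field_derivative 0) (at v)" for f :: "complex \<Rightarrow> complex"
  proof -
    have cont: "continuous_on regular_points f"
      using d by (intro continuous_at_imp_continuous_on) (auto intro: DERIV_isCont)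
    then obtain c where c: "\<And>x. x \<in> regular_points \<Longrightarrow> f x = c"
      by (rule DERIV_zero_connected_constant[OF conn open_regular_points finite.emptyI]) (use cont d in auto)
    show ?thesis using c[OF assms] c[OF at_0(1)] by simp
  qed
  have "((\<lambda>u. (sn u)^2 + (cn u)^2) has_field_derivative 0) (at v)" if "v \<in> regular_points" for v
    using derivs[OF that] by (auto intro!: derivative_eq_intros simp: algebra_simps)
  from const[OF this] show "(sn u)^2 + (cn u)^2 = 1" by (simp add: at_0)
  have "((\<lambda>u. (dn u)^2 + k^2 * (sn u)^2) has_field_derivative 0) (at v)" if "v \<in> regular_points" for v
    using derivs[OF that] by (auto intro!: derivative_eq_intros simp: algebra_simps)
  from const[OF this] show "(dn u)^2 + k^2 * (sn u)^2 = 1" by (simp add: at_0)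
qed

lemma cn_dn_sq:
  assumes "u \<in> regular_points"
  shows "(cn u * dn u)^2 = (1 - (sn u)^2) * (1 - k^2 * (sn u)^2)"
proof -
  have "(cn u)^2 = 1 - (sn u)^2" "(dn u)^2 = 1 - k^2 * (sn u)^2"
    using pythagoras[OF assms] by (auto simp: algebra_simps)
  then show ?thesis by (simp add: power_mult_distrib)
qed

lemma flow_comp:
  assumes "\<And>t. t \<in> S \<Longrightarrow> (g has_derivative L t) (at t within S)"
    and "\<And>t. t \<in> S \<Longrightarrow> g t \<in> regular_points"
  shows "jacobi_flow_on (k^2) S L (\<lambda>t. sn (g t)) (\<lambda>t. cn (g t)) (\<lambda>t. dn (g t))"
  unfolding jacobi_flow_on_def
proof (intro ballI conjI)
  fix t assume t: "t \<in> S"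
  note d = has_derivative_compose[OF assms(1)[OF t]]
  note r = derivs[OF assms(2)[OF t], unfolded has_field_derivative_def]
  show "((\<lambda>t. sn (g t)) has_derivative (\<lambda>h. cn (g t) * dn (g t) * L t h)) (at t within S)"
    using d[OF r(1)] by (simp add: mult_ac)
  show "((\<lambda>t. cn (g t)) has_derivative (\<lambda>h. - (sn (g t) * dn (g t)) * L t h)) (at t within S)"
    using d[OF r(2)] by (simp add: mult_ac)
  show "((\<lambda>t. dn (g t)) has_derivative (\<lambda>h. - (k^2 * sn (g t) * cn (g t)) * L t h)) (at t within S)"
    using d[OF r(3)] by (simp add: mult_ac)
qed (use pythagoras assms(2) in auto)

text \<open>This is the solution with argument t - c. Oddness of sn is not yet available, so the
  sign stands outside and the flow is reversed instead.\<close>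

lemma flow_reflect:
  assumes "\<And>t. t \<in> S \<Longrightarrow> c - t \<in> regular_points"
  shows "jacobi_flow_on (k^2) S (\<lambda>t h. h) (\<lambda>t. - sn (c - t)) (\<lambda>t. cn (c - t)) (\<lambda>t. dn (c - t))"
proof -
  have "jacobi_flow_on (k^2) S (\<lambda>t h. - h) (\<lambda>t. sn (c - t)) (\<lambda>t. cn (c - t)) (\<lambda>t. dn (c - t))"
    using assms by (intro flow_comp) (auto intro!: derivative_eq_intros)
  from jacobi_flow_on_uminus[OF this] show ?thesis by simp
qed

lemma isCont_comp:
  assumes "isCont g u" "g u \<in> regular_points"
  shows "isCont (\<lambda>w. sn (g w)) u" "isCont (\<lambda>w. cn (g w)) u" "isCont (\<lambda>w. dn (g w)) u"
  using derivs[OF assms(2), THEN DERIV_isCont, THEN isCont_o2[OF assms(1)]] by simp_all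

lemma reflect_ball:
  assumes c: "c \<in> regular_points"
  obtains r where "r > 0" "\<And>t. t \<in> ball 0 r \<Longrightarrow> t \<in> regular_points \<and> c - t \<in> regular_points \<and>
     1 - k^2 * (sn t)^2 * (sn (c - t))^2 \<noteq> 0"
proof -
  have c0: "c - 0 \<in> regular_points" using c by simp
  have "isCont (\<lambda>t. 1 - k^2 * (sn t)^2 * (sn (c - t))^2) 0"
    by (intro continuous_intros isCont_comp c0 at_0)
  then have "\<forall>\<^sub>F t in nhds 0. 1 - k^2 * (sn t)^2 * (sn (c - t))^2 \<noteq> 0"
    by (rule isCont_eventually_ne) (simp add: at_0)
  moreover have "\<forall>\<^sub>F t in nhds 0. t \<in> {t. 1 * t + 0 \<in> regular_points \<and> (-1) * t + c \<in> regular_points}"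
    using open_connected_two(1)[of 1 "-1" _ 0 c, OF _ _ refl] c at_0
    by (intro eventually_nhds_in_open) auto
  ultimately have "\<forall>\<^sub>F t in nhds 0. t \<in> regular_points \<and> c - t \<in> regular_points \<and>
     1 - k^2 * (sn t)^2 * (sn (c - t))^2 \<noteq> 0"
    by eventually_elim auto
  then obtain r where "r > 0" "\<forall>t. dist t 0 < r \<longrightarrow> t \<in> regular_points \<and> c - t \<in> regular_points \<and>
     1 - k^2 * (sn t)^2 * (sn (c - t))^2 \<noteq> 0"
    unfolding eventually_nhds_metric by blast
  then show thesis by (intro that[of r]) (auto simp: dist_commute)
qed

text \<open>For fixed c = u + v the arguments t and t - c follow the same flow with constant
  difference c, so the quotients of \<open>jacobi_flow_difference\<close> keep their values at t =
  0, namely sn c, cn c, dn c. Multiplied out, the identities continue from a ball around 0 to t = u,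
  even across zeros of the denominator.\<close>

lemma addition:
  assumes u: "u \<in> regular_points" and v: "v \<in> regular_points" and uv: "u + v \<in> regular_points"
  shows "sn (u + v) * (1 - k^2 * (sn u)^2 * (sn v)^2) = sn u * cn v * dn v + sn v * cn u * dn u"
    and "cn (u + v) * (1 - k^2 * (sn u)^2 * (sn v)^2) = cn u * cn v - sn u * sn v * dn u * dn v"
    and "dn (u + v) * (1 - k^2 * (sn u)^2 * (sn v)^2) = dn u * dn v - k^2 * sn u * sn v * cn u * cn v"
proof -
  define c where "c = u + v"
  define M where "M = {u. 1 * u + 0 \<in> regular_points \<and> (-1) * u + c \<in> regular_points}"
  have c: "c \<in> regular_points" using uv by (simp add: c_def)
  have MM: "t \<in> M \<longleftrightarrow> t \<in> regular_points \<and> c - t \<in> regular_points" for t by (auto simp: M_def)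
  have 0: "0 \<in> M" and uM: "u \<in> M" using u v c at_0 by (auto simp: MM c_def)
  obtain r where r: "r > 0" "\<And>t. t \<in> ball 0 r \<Longrightarrow> t \<in> regular_points \<and> c - t \<in> regular_points \<and>
     1 - k^2 * (sn t)^2 * (sn (c - t))^2 \<noteq> 0"
    using reflect_ball[OF c] by blast
  have f1: "jacobi_flow_on (k^2) (ball 0 r) (\<lambda>t h. h) sn cn dn"
    using flow_comp[of "ball 0 r" "\<lambda>t. t" "\<lambda>t h. h"] r by simp
  have f2: "jacobi_flow_on (k^2) (ball 0 r) (\<lambda>t h. h) (\<lambda>t. - sn (c - t)) (\<lambda>t. cn (c - t)) (\<lambda>t. dn (c - t))"
    using r by (intro flow_reflect) auto
  have D: "1 - k^2 * (sn t)^2 * (- sn (c - t))^2 \<noteq> 0" if "t \<in> ball 0 r" for t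
    using r(2)[OF that] by simp
  have 00: "0 \<in> ball 0 r" using r(1) by simp
  note fd = jacobi_flow_difference[OF convex_ball f1 f2 D 00]
  have ev: "\<forall>\<^sub>F t in nhds (0::complex). t \<in> ball 0 r" using r by (intro eventually_nhds_in_open) auto
  note ic = identity_continuation[of 1 "-1" M 0 c, OF _ _ M_def _ _ 0 uM]
  have hol: "(\<lambda>t. sn t) holomorphic_on M" "(\<lambda>t. cn t) holomorphic_on M" "(\<lambda>t. dn t) holomorphic_on M"
    "(\<lambda>t. sn (c - t)) holomorphic_on M" "(\<lambda>t. cn (c - t)) holomorphic_on M" "(\<lambda>t. dn (c - t)) holomorphic_on M"
    by (rule holomorphic_comp; auto simp: MM intro!: holomorphic_intros)+
  have "sn u * cn (c - u) * dn (c - u) + sn (c - u) * cn u * dn u - sn c * (1 - k^2 * (sn u)^2 * (sn (c - u))^2) = 0" (is "?F1 u = 0")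
  proof (rule ic)
    show "\<forall>\<^sub>F t in nhds 0. ?F1 t = 0"
      by (rule eventually_mono[OF ev]) (use fd(1) in \<open>simp add: at_0\<close>)
  qed (auto intro!: holomorphic_intros hol)
  then show "sn (u + v) * (1 - k^2 * (sn u)^2 * (sn v)^2) = sn u * cn v * dn v + sn v * cn u * dn u"
    by (simp add: c_def)
  have "cn u * cn (c - u) - sn u * sn (c - u) * dn u * dn (c - u) - cn c * (1 - k^2 * (sn u)^2 * (sn (c - u))^2) = 0" (is "?F2 u = 0")
  proof (rule ic)
    show "\<forall>\<^sub>F t in nhds 0. ?F2 t = 0"
      by (rule eventually_mono[OF ev]) (use fd(2) in \<open>simp add: at_0\<close>)
  qed (auto intro!: holomorphic_intros hol)
  then show "cn (u + v) * (1 - k^2 * (sn u)^2 * (sn v)^2) = cn u * cn v - sn u * sn v * dn u * dn v"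
    by (simp add: c_def)
  have "dn u * dn (c - u) - k^2 * sn u * sn (c - u) * cn u * cn (c - u) - dn c * (1 - k^2 * (sn u)^2 * (sn (c - u))^2) = 0" (is "?F3 u = 0")
  proof (rule ic)
    show "\<forall>\<^sub>F t in nhds 0. ?F3 t = 0"
      by (rule eventually_mono[OF ev]) (use fd(3) in \<open>simp add: at_0\<close>)
  qed (auto intro!: holomorphic_intros hol)
  then show "dn (u + v) * (1 - k^2 * (sn u)^2 * (sn v)^2) = dn u * dn v - k^2 * sn u * sn v * cn u * cn v"
    by (simp add: c_def)
qed

text \<open>For w near u the addition formula writes sn(w + v) as a quotient whose denominator stays
  away from 0, hence with a finite limit.\<close>

lemma regular_add:
  assumes u: "u \<in> regular_points" and v: "v \<in> regular_points"
    and D: "1 - k^2 * (sn u)^2 * (sn v)^2 \<noteq> 0"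
  shows "u + v \<in> regular_points"
proof -
  define Dt where "Dt = (\<lambda>w. 1 - k^2 * (sn w)^2 * (sn v)^2)"
  define Nt where "Nt = (\<lambda>w. sn w * cn v * dn v + sn v * cn w * dn w)"
  have "isCont Dt u" "isCont Nt u"
    unfolding Dt_def Nt_def by (intro continuous_intros derivs[OF u, THEN DERIV_isCont])+
  then have lim: "Dt \<midarrow>u\<rightarrow> Dt u" "Nt \<midarrow>u\<rightarrow> Nt u" by (auto simp: isCont_def)
  have Du: "Dt u \<noteq> 0" using D by (simp add: Dt_def)
  have "\<forall>\<^sub>F w in at u. sn (1 * w + v) = Nt w / Dt w"
    using tendsto_imp_eventually_ne[OF lim(1) Du] eventually_regular[of u] eventually_regular_affine[OF one_neq_zero, of v u]
    by eventually_elim (use addition(1) v in \<open>auto simp: Dt_def Nt_def field_simps\<close>)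
  then show ?thesis
    using regularI[where e = 1 and c = v and u = u and F = "\<lambda>w. Nt w / Dt w"] tendsto_divide[OF lim(2,1) Du] by auto
qed

text \<open>sn t and -sn(-t) start at the same value and belong to solutions of the same flow, so
  uniqueness gives the parities near 0. That -u is not a pole is part of the claim and follows from
  the finite limit of -sn w at u.\<close>

lemma reflection:
  assumes "u \<in> regular_points"
  shows "- u \<in> regular_points" "sn (- u) = - sn u" "cn (- u) = cn u" "dn (- u) = dn u"
proof -
  define M where "M = {u. 1 * u + 0 \<in> regular_points \<and> (-1) * u + 0 \<in> regular_points}"
  have MM: "t \<in> M \<longleftrightarrow> t \<in> regular_points \<and> - t \<in> regular_points" for t by (auto simp: M_def)
  have 0: "0 \<in> M" using at_0 by (auto simp: MM)
  obtain r where r: "r > 0" "\<And>t. t \<in> ball 0 r \<Longrightarrow> t \<in> regular_points \<and> - t \<in> regular_points \<and>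
     1 - k^2 * (sn t)^2 * (sn (- t))^2 \<noteq> 0"
    using reflect_ball[OF at_0(1)] by auto
  have f1: "jacobi_flow_on (k^2) (ball 0 r) (\<lambda>t h. h) sn cn dn"
    using flow_comp[of "ball 0 r" "\<lambda>t. t" "\<lambda>t h. h"] r by simp
  have f2: "jacobi_flow_on (k^2) (ball 0 r) (\<lambda>t h. h) (\<lambda>t. - sn (- t)) (\<lambda>t. cn (- t)) (\<lambda>t. dn (- t))"
    using r flow_reflect[of "ball 0 r" 0] by auto
  have D: "1 - k^2 * (sn t)^2 * (- sn (- t))^2 \<noteq> 0" if "t \<in> ball 0 r" for t
    using r(2)[OF that] by simp
  have 00: "0 \<in> ball 0 r" using r(1) by simp
  have fu: "sn t + sn (- t) = 0" "cn t - cn (- t) = 0" "dn t - dn (- t) = 0" if "t \<in> ball 0 r" for t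
    using jacobi_flow_unique[OF convex_ball f1 f2 D 00 that] by (simp_all add: at_0)
  have ev: "\<forall>\<^sub>F t in nhds (0::complex). t \<in> ball 0 r" using r by (intro eventually_nhds_in_open) auto
  note ic = identity_continuation[of 1 "-1" M 0 0, OF _ _ M_def _ _ 0]
  have hol: "(\<lambda>t. sn t) holomorphic_on M" "(\<lambda>t. cn t) holomorphic_on M" "(\<lambda>t. dn t) holomorphic_on M"
    "(\<lambda>t. sn (- t)) holomorphic_on M" "(\<lambda>t. cn (- t)) holomorphic_on M" "(\<lambda>t. dn (- t)) holomorphic_on M"
    by (rule holomorphic_comp; auto simp: MM intro!: holomorphic_intros)+
  have s: "sn w + sn (- w) = 0" (is "?F1 w = 0") if "w \<in> M" for w
  proof (rule ic[OF _ _ _ _ that])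
    show "\<forall>\<^sub>F w in nhds 0. ?F1 w = 0"
      by (rule eventually_mono[OF ev]) (rule fu(1))
  qed (auto intro!: holomorphic_intros hol)
  have c: "cn w - cn (- w) = 0" (is "?F2 w = 0") if "w \<in> M" for w
  proof (rule ic[OF _ _ _ _ that])
    show "\<forall>\<^sub>F w in nhds 0. ?F2 w = 0"
      by (rule eventually_mono[OF ev]) (rule fu(2))
  qed (auto intro!: holomorphic_intros hol)
  have d: "dn w - dn (- w) = 0" (is "?F3 w = 0") if "w \<in> M" for w
  proof (rule ic[OF _ _ _ _ that])
    show "\<forall>\<^sub>F w in nhds 0. ?F3 w = 0"
      by (rule eventually_mono[OF ev]) (rule fu(3))
  qed (auto intro!: holomorphic_intros hol)
  have m0: "(-1::complex) \<noteq> 0" by simp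
  have "\<forall>\<^sub>F w in at u. sn ((-1) * w + 0) = - sn w"
    using eventually_regular[of u] eventually_regular_affine[OF m0, of 0 u]
  proof eventually_elim
    case (elim w)
    then have "sn w + sn (- w) = 0" using s[of w] by (simp add: MM)
    then show ?case by (simp add: add_eq_0_iff)
  qed
  moreover have "((\<lambda>w. - sn w) \<longlongrightarrow> - sn u) (at u)"
    using DERIV_isCont[OF derivs(1)[OF assms]] by (auto simp: isCont_def intro: tendsto_minus)
  ultimately have "(-1) * u + 0 \<in> regular_points" by (rule regularI[OF m0])
  then show reg: "- u \<in> regular_points" by simp
  then have "u \<in> M" using assms by (simp add: MM)
  show "sn (- u) = - sn u" "cn (- u) = cn u" "dn (- u) = dn u"
    using s[OF \<open>u \<in> M\<close>] c[OF \<open>u \<in> M\<close>] d[OF \<open>u \<in> M\<close>]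
    by (metis add_eq_0_iff, metis right_minus_eq, metis right_minus_eq)
qed

lemma subtraction:
  assumes u: "u \<in> regular_points" and v: "v \<in> regular_points" and uv: "u - v \<in> regular_points"
  shows "sn (u - v) * (1 - k^2 * (sn u)^2 * (sn v)^2) = sn u * cn v * dn v - sn v * cn u * dn u"
    and "cn (u - v) * (1 - k^2 * (sn u)^2 * (sn v)^2) = cn u * cn v + sn u * sn v * dn u * dn v"
    and "dn (u - v) * (1 - k^2 * (sn u)^2 * (sn v)^2) = dn u * dn v + k^2 * sn u * sn v * cn u * cn v"
  using addition[OF u reflection(1)[OF v]] uv by (simp_all add: reflection(2-)[OF v])

lemma regular_diff:
  assumes "u \<in> regular_points" "v \<in> regular_points" "1 - k^2 * (sn u)^2 * (sn v)^2 \<noteq> 0"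
  shows "u - v \<in> regular_points"
  using regular_add[OF assms(1) reflection(1)[OF assms(2)]] assms(3) by (simp add: reflection(2)[OF assms(2)])

text \<open>Euler's relation is obtained by dividing by 1 - k^2 sn^2 u sn^2 v, which is possible for
  u near 0. The relation itself contains no denominator, so continuation removes the
  restriction.\<close>

lemma biquadratic_relation:
  assumes u: "u \<in> regular_points" and v: "v \<in> regular_points" and uv: "u + v \<in> regular_points"
  shows "(sn u)^2 + (sn (u + v))^2 - 2 * (cn v * dn v) * sn u * sn (u + v)
      - (sn v)^2 * (1 + k^2 * (sn u)^2 * (sn (u + v))^2) = 0"
proof -
  define M where "M = {u. 1 * u + 0 \<in> regular_points \<and> 1 * u + v \<in> regular_points}"
  have MM: "t \<in> M \<longleftrightarrow> t \<in> regular_points \<and> t + v \<in> regular_points" for t by (auto simp: M_def)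
  have 0: "0 \<in> M" and uM: "u \<in> M" using u v uv at_0 by (auto simp: MM)
  have hol: "(\<lambda>t. sn t) holomorphic_on M" "(\<lambda>t. sn (t + v)) holomorphic_on M"
    by (rule holomorphic_comp; auto simp: MM intro!: holomorphic_intros)+
  have "isCont (\<lambda>t. 1 - k^2 * (sn t)^2 * (sn v)^2) 0"
    by (intro continuous_intros isCont_comp at_0)
  then have "\<forall>\<^sub>F t in nhds 0. 1 - k^2 * (sn t)^2 * (sn v)^2 \<noteq> 0"
    by (rule isCont_eventually_ne) (simp add: at_0)
  moreover have "\<forall>\<^sub>F t in nhds 0. t \<in> M"
    using open_connected_two(1)[of 1 1 M 0 v, OF _ _ M_def] 0 by (intro eventually_nhds_in_open) auto
  ultimately have ev: "\<forall>\<^sub>F t in nhds 0. (sn t)^2 + (sn (t + v))^2 - 2 * (cn v * dn v) * sn t * sn (t + v)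
      - (sn v)^2 * (1 + k^2 * (sn t)^2 * (sn (t + v))^2) = 0" (is "eventually (\<lambda>t. ?E t = 0) _")
  proof eventually_elim
    case (elim t)
    then have t: "t \<in> regular_points" "t + v \<in> regular_points" by (auto simp: MM)
    show ?case
      by (rule biquadratic_of_addition[OF cn_dn_sq[OF t(1)] cn_dn_sq[OF v]])
         (use addition(1)[OF t(1) v t(2)] elim(1) in \<open>simp_all only: mult.assoc not_False_eq_True\<close>)
  qed
  show ?thesis
  proof (rule identity_continuation[OF _ _ M_def _ ev 0 uM])
    show "?E holomorphic_on M" by (intro holomorphic_intros hol)
  qed simp_all
qed

end

section \<open>Quarter periods\<close>

lemma jacobi_flow_on_subset:
  "jacobi_flow_on m S L s c d \<Longrightarrow> T \<subseteq> S \<Longrightarrow> jacobi_flow_on m T L s c d"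
  unfolding jacobi_flow_on_def by (meson has_derivative_subset subsetD)

lemma jacobi_flow_on_continuous:
  assumes "jacobi_flow_on m S L s c d" "t \<in> S"
  shows "continuous (at t within S) s" "continuous (at t within S) c" "continuous (at t within S) d"
  using assms unfolding jacobi_flow_on_def by (meson has_derivative_continuous)+

text \<open>An open-closed argument on the convex, hence connected, set T. \<open>R\<close> records
  that the first argument stays off the poles, and \<open>closing\<close> supplies it at limit
  points of the set of agreement. \<open>D\<close> speaks of the second flow alone: at a point of
  agreement s1 = s2, and continuity keeps 1 - m s1^2 s2^2 nonzero nearby.\<close>

lemma jacobi_flow_continuation:
  fixes T :: "'a::real_normed_vector set"
  assumes T: "convex T" and 2: "jacobi_flow_on m T L s2 c2 d2"
    and D: "\<And>t. t \<in> T \<Longrightarrow> 1 - m * (s2 t)^2 * (s2 t)^2 \<noteq> 0"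
    and reg: "\<And>t. t \<in> T \<Longrightarrow> R t \<Longrightarrow>
       \<exists>r>0. (\<forall>t'\<in>ball t r \<inter> T. R t') \<and> jacobi_flow_on m (ball t r \<inter> T) L s1 c1 d1"
    and closing: "\<And>A t. A \<subseteq> T \<Longrightarrow> (\<And>t. t \<in> A \<Longrightarrow> R t \<and> s1 t = s2 t \<and> c1 t = c2 t \<and> d1 t = d2 t) \<Longrightarrow>
       t \<in> T \<Longrightarrow> t islimpt A \<Longrightarrow> R t"
    and init: "a \<in> T" "R a" "s1 a = s2 a" "c1 a = c2 a" "d1 a = d2 a"
    and b: "b \<in> T"
  shows "R b \<and> s1 b = s2 b \<and> c1 b = c2 b \<and> d1 b = d2 b"
proof -
  define A where "A = {t \<in> T. R t \<and> s1 t = s2 t \<and> c1 t = c2 t \<and> d1 t = d2 t}"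
  have "A \<subseteq> T" by (auto simp: A_def)
  have cont: "continuous (at t within T) s1" "continuous (at t within T) c1" "continuous (at t within T) d1"
    if tR: "t \<in> T" "R t" for t
  proof -
    obtain r where "r > 0" "jacobi_flow_on m (ball t r \<inter> T) L s1 c1 d1"
      using reg[OF tR] by blast
    then have "continuous (at t within ball t r \<inter> T) s1" "continuous (at t within ball t r \<inter> T) c1"
       "continuous (at t within ball t r \<inter> T) d1"
      using jacobi_flow_on_continuous tR by fastforce+
    moreover have "at t within (ball t r \<inter> T) = at t within T"
      using \<open>r > 0\<close> by (intro at_within_nhd[of t "ball t r"]) auto
    ultimately show "continuous (at t within T) s1" "continuous (at t within T) c1" "continuous (at t within T) d1"
      by simp_all
  qed
  note cont2 = jacobi_flow_on_continuous[OF 2]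
  have op: "openin (top_of_set T) A"
    unfolding openin_contains_ball
  proof (intro conjI ballI)
    fix t assume t: "t \<in> A"
    then have tT: "t \<in> T" "R t" "s1 t = s2 t" "c1 t = c2 t" "d1 t = d2 t" by (auto simp: A_def)
    obtain r where r: "r > 0" "\<forall>t'\<in>ball t r \<inter> T. R t'" "jacobi_flow_on m (ball t r \<inter> T) L s1 c1 d1"
      using reg[OF tT(1,2)] by blast
    have "continuous (at t within T) (\<lambda>t. 1 - m * (s1 t)^2 * (s2 t)^2)"
      by (intro continuous_intros cont cont2 tT)
    then have "((\<lambda>t. 1 - m * (s1 t)^2 * (s2 t)^2) \<longlongrightarrow> 1 - m * (s1 t)^2 * (s2 t)^2) (at t within T)"
      by (simp add: continuous_within)
    then have "\<forall>\<^sub>F x in at t within T. 1 - m * (s1 x)^2 * (s2 x)^2 \<noteq> 0"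
      by (rule tendsto_imp_eventually_ne) (use D[OF tT(1)] tT in simp)
    then obtain r' where r': "r' > 0" "\<And>x. x \<in> T \<Longrightarrow> x \<noteq> t \<Longrightarrow> dist x t < r' \<Longrightarrow> 1 - m * (s1 x)^2 * (s2 x)^2 \<noteq> 0"
      unfolding eventually_at by blast
    define e where "e = min r r'"
    have e: "e > 0" "ball t e \<inter> T \<subseteq> ball t r \<inter> T" using r r' by (auto simp: e_def)
    have "x \<in> A" if x: "x \<in> ball t e \<inter> T" for x
    proof -
      have D': "1 - m * (s1 y)^2 * (s2 y)^2 \<noteq> 0" if "y \<in> ball t e \<inter> T" for y
        using r'(2)[of y] D[OF tT(1)] tT that by (cases "y = t") (auto simp: e_def dist_commute)
      have "t \<in> ball t e \<inter> T" using e tT by auto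
      from jacobi_flow_unique[OF convex_Int[OF convex_ball T] jacobi_flow_on_subset[OF r(3) e(2)]
          jacobi_flow_on_subset[OF 2] D' this x tT(3-5)] r(2) e(2) x
      show ?thesis by (auto simp: A_def)
    qed
    then show "\<exists>e>0. ball t e \<inter> T \<subseteq> A" using e by blast
  qed (use \<open>A \<subseteq> T\<close> in auto)
  have cl: "closedin (top_of_set T) A"
    unfolding closedin_limpt
  proof (intro conjI allI impI)
    fix t assume t: "t islimpt A \<and> t \<in> T"
    then have R: "R t" using closing[OF \<open>A \<subseteq> T\<close>, of t] by (auto simp: A_def)
    have ne: "at t within A \<noteq> bot" using t by (simp add: trivial_limit_within)
    have eq: "f t = g t" if "continuous (at t within T) f" "continuous (at t within T) g"
      "\<And>x. x \<in> A \<Longrightarrow> f x = g x" for f g :: "'a \<Rightarrow> complex"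
    proof (rule tendsto_unique[OF ne])
      show "(g \<longlongrightarrow> g t) (at t within A)"
        using that(2) \<open>A \<subseteq> T\<close> by (auto simp: continuous_within intro: tendsto_within_subset)
      have "(f \<longlongrightarrow> f t) (at t within A)"
        using that(1) \<open>A \<subseteq> T\<close> by (auto simp: continuous_within intro: tendsto_within_subset)
      then show "(g \<longlongrightarrow> f t) (at t within A)"
        by (rule Lim_transform_within[OF _ zero_less_one]) (use that(3) in auto)
    qed
    show "t \<in> A"
      using R t eq[OF cont(1) cont2(1)] eq[OF cont(2) cont2(2)] eq[OF cont(3) cont2(3)]
      by (auto simp: A_def)
  qed (use \<open>A \<subseteq> T\<close> in auto)
  have "A = {} \<or> A = T"
    using convex_connected[OF T] op cl by (auto simp: connected_clopen)
  then show ?thesis using init b by (auto simp: A_def)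
qed

text \<open>Jacobi's imaginary transformation sn(\<i> v, k) = \<i> sn(v, k') / cn(v, k'), solved for
  the functions of the complementary modulus. The factor \<i> of the differential is absorbed by the
  factor -\<i> in the first component.\<close>

lemma jacobi_imaginary_flow:
  assumes "jacobi_flow_on m S (\<lambda>t h. \<i> * L t h) s c d" "\<And>t. t \<in> S \<Longrightarrow> c t \<noteq> 0"
  shows "jacobi_flow_on (1 - m) S L (\<lambda>t. - \<i> * s t / c t) (\<lambda>t. 1 / c t) (\<lambda>t. d t / c t)"
  unfolding jacobi_flow_on_def
proof (intro ballI conjI)
  fix t assume "t \<in> S"
  then have 1: "(s has_derivative (\<lambda>h. c t * d t * (\<i> * L t h))) (at t within S)"
    "(c has_derivative (\<lambda>h. - (s t * d t) * (\<i> * L t h))) (at t within S)"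
    "(d has_derivative (\<lambda>h. - (m * s t * c t) * (\<i> * L t h))) (at t within S)"
    and r: "(s t)^2 + (c t)^2 = 1" "(d t)^2 + m * (s t)^2 = 1" and c: "c t \<noteq> 0"
    using assms by (auto simp: jacobi_flow_on_def)
  have r': "(s t)^2 = 1 - (c t)^2" "(d t)^2 = 1 - m + m * (c t)^2" using r by algebra+
  show "((\<lambda>t. - \<i> * s t / c t) has_derivative (\<lambda>h. 1 / c t * (d t / c t) * L t h)) (at t within S)"
  proof (rule has_derivative_eq_rhs[OF has_derivative_divide'[OF has_derivative_mult_right[OF 1(1)] 1(2) c]], rule ext)
    fix h
    have "- \<i> * (c t * d t * (\<i> * L t h)) * c t - - \<i> * s t * (- (s t * d t) * (\<i> * L t h)) =
       ((s t)^2 + (c t)^2) * (d t * L t h)" by (simp add: algebra_simps power2_eq_square)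
    then show "(- \<i> * (c t * d t * (\<i> * L t h)) * c t - - \<i> * s t * (- (s t * d t) * (\<i> * L t h))) / (c t * c t)
       = 1 / c t * (d t / c t) * L t h" unfolding r by simp
  qed
  show "((\<lambda>t. 1 / c t) has_derivative (\<lambda>h. - (- \<i> * s t / c t * (d t / c t)) * L t h)) (at t within S)"
    by (rule has_derivative_eq_rhs[OF has_derivative_divide'[OF has_derivative_const 1(2) c]])
       (simp add: fun_eq_iff mult_ac)
  show "((\<lambda>t. d t / c t) has_derivative (\<lambda>h. - ((1 - m) * (- \<i> * s t / c t) * (1 / c t)) * L t h)) (at t within S)"
  proof (rule has_derivative_eq_rhs[OF has_derivative_divide'[OF 1(3) 1(2) c]], rule ext)
    fix h
    have "- (m * s t * c t) * (\<i> * L t h) * c t - d t * (- (s t * d t) * (\<i> * L t h)) =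
      ((d t)^2 - m * (c t)^2) * (\<i> * s t * L t h)" by (simp add: algebra_simps power2_eq_square)
    also have "(d t)^2 - m * (c t)^2 = 1 - m" using r' by simp
    finally show "(- (m * s t * c t) * (\<i> * L t h) * c t - d t * (- (s t * d t) * (\<i> * L t h))) / (c t * c t) =
       - ((1 - m) * (- \<i> * s t / c t) * (1 / c t)) * L t h" by simp
  qed
  show "(- \<i> * s t / c t)^2 + (1 / c t)^2 = 1"
    using c by (simp add: power_divide power_mult_distrib r' field_simps)
  show "(d t / c t)^2 + (1 - m) * (- \<i> * s t / c t)^2 = 1"
    using c by (simp add: power_divide power_mult_distrib r' field_simps)
qed

section \<open>The Legendre integral as a path of the Jacobi flow\<close>

lemma legendre_radicand:
  assumes "\<not> (m \<in> \<real> \<and> Re m \<ge> 1)"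
  shows "1 - m * of_real ((sin \<theta>)^2) \<notin> \<real>\<^sub>\<le>\<^sub>0"
proof
  assume "1 - m * of_real ((sin \<theta>)^2) \<in> \<real>\<^sub>\<le>\<^sub>0"
  then obtain r where r: "r \<le> 0" "1 - m * of_real ((sin \<theta>)^2) = of_real r"
    by (auto elim: nonpos_Reals_cases)
  \<comment> \<open>A real radicand r \<le> 0 would make m = (1 - r) / q with 0 < q \<le> 1, so m
    would lie on the excluded cut. This keeps \<open>csqrt\<close> differentiable along the whole
    path.\<close>
  define q where "q = (sin \<theta>)^2"
  have q: "0 \<le> q" "q \<le> 1" by (auto simp: q_def abs_square_le_1)
  have mq: "m * of_real q = of_real (1 - r)" using r by (simp add: q_def algebra_simps)
  then have "q \<noteq> 0" using r by (auto simp del: of_real_diff)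
  then have "m = of_real ((1 - r) / q)" using mq by (simp add: field_simps)
  moreover have "(1 - r) / q \<ge> 1" using q r \<open>q \<noteq> 0\<close> by (simp add: field_simps)
  ultimately show False using assms by auto
qed

text \<open>Choosing du = d\<theta> / \<Delta> turns the elementary derivatives of sin, cos and
  \<Delta> into the Jacobi system for u.\<close>

lemma legendre_flow:
  assumes m: "\<not> (m \<in> \<real> \<and> Re m \<ge> 1)"
  defines "\<Delta> \<equiv> \<lambda>\<theta>. csqrt (1 - m * of_real ((sin \<theta>)^2))"
  shows "jacobi_flow_on m S (\<lambda>\<theta> h. h *\<^sub>R (1 / \<Delta> \<theta>)) (\<lambda>\<theta>. of_real (sin \<theta>)) (\<lambda>\<theta>. of_real (cos \<theta>)) \<Delta>"
  unfolding jacobi_flow_on_def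
proof (intro ballI conjI)
  fix \<theta> :: real
  note nz = legendre_radicand[OF m, of \<theta>]
  have \<Delta>0: "\<Delta> \<theta> \<noteq> 0" using nz by (auto simp: \<Delta>_def)
  show "((\<lambda>\<theta>. complex_of_real (sin \<theta>)) has_derivative (\<lambda>h. of_real (cos \<theta>) * \<Delta> \<theta> * h *\<^sub>R (1 / \<Delta> \<theta>))) (at \<theta> within S)"
    using \<Delta>0 by (auto intro!: derivative_eq_intros simp: fun_eq_iff scaleR_conv_of_real)
  show "((\<lambda>\<theta>. complex_of_real (cos \<theta>)) has_derivative (\<lambda>h. - (of_real (sin \<theta>) * \<Delta> \<theta>) * h *\<^sub>R (1 / \<Delta> \<theta>))) (at \<theta> within S)"
    using \<Delta>0 by (auto intro!: derivative_eq_intros simp: fun_eq_iff scaleR_conv_of_real)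
  have "((\<lambda>\<theta>. 1 - m * of_real ((sin \<theta>)^2)) has_derivative (\<lambda>h. - (2 * m * of_real (sin \<theta> * cos \<theta> * h)))) (at \<theta> within S)"
    by (auto intro!: derivative_eq_intros simp: fun_eq_iff)
  from has_derivative_compose[OF this has_field_derivative_csqrt[OF nz, THEN has_field_derivative_imp_has_derivative]]
  show "(\<Delta> has_derivative (\<lambda>h. - (m * of_real (sin \<theta>) * of_real (cos \<theta>)) * h *\<^sub>R (1 / \<Delta> \<theta>))) (at \<theta> within S)"
    by (auto simp: \<Delta>_def scaleR_conv_of_real field_simps elim!: has_derivative_eq_rhs)
  show "(complex_of_real (sin \<theta>))^2 + (complex_of_real (cos \<theta>))^2 = 1"
    by (metis of_real_1 of_real_add of_real_power sin_cos_squared_add)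
  show "(\<Delta> \<theta>)^2 + m * (complex_of_real (sin \<theta>))^2 = 1" by (simp add: \<Delta>_def)
qed

lemma legendre_integral:
  assumes m: "\<not> (m \<in> \<real> \<and> Re m \<ge> 1)"
  defines "\<Delta> \<equiv> \<lambda>\<theta>. csqrt (1 - m * of_real ((sin \<theta>)^2))"
  obtains u where "u 0 = 0" "u (pi / 2) = complete_elliptic_integral m"
    "\<And>\<theta>. \<theta> \<in> {0..pi/2} \<Longrightarrow> (u has_derivative (\<lambda>h. h *\<^sub>R (1 / \<Delta> \<theta>))) (at \<theta> within {0..pi/2})"
proof (rule that[of "\<lambda>\<theta>. integral {0..\<theta>} (\<lambda>\<theta>. 1 / \<Delta> \<theta>)"])
  let ?u = "\<lambda>\<theta>. integral {0..\<theta>} (\<lambda>\<theta>. 1 / \<Delta> \<theta>)"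
  show "?u 0 = 0" by simp
  show "?u (pi / 2) = complete_elliptic_integral m"
    by (simp add: \<Delta>_def complete_elliptic_integral_def)
  have "continuous_on {0..pi/2} \<Delta>"
    using jacobi_flow_on_continuous(3)[OF legendre_flow[OF m]]
    by (auto simp: continuous_on_eq_continuous_within \<Delta>_def)
  moreover have "\<Delta> \<theta> \<noteq> 0" for \<theta> using legendre_radicand[OF m, of \<theta>] by (auto simp: \<Delta>_def)
  ultimately have "continuous_on {0..pi/2} (\<lambda>\<theta>. 1 / \<Delta> \<theta>)" by (intro continuous_intros) auto
  then show "(?u has_derivative (\<lambda>h. h *\<^sub>R (1 / \<Delta> \<theta>))) (at \<theta> within {0..pi/2})" if th: "\<theta> \<in> {0..pi/2}" for \<theta>
    using integral_has_vector_derivative[OF _ th] by (simp add: has_vector_derivative_def)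
qed

text \<open>sin^4 \<theta> lies in [0, 1], so m sin^4 \<theta> = 1 would put m on the cut. It is the
  denominator that arises when a solution agreeing with (sin, cos, \<Delta>) is compared with
  it.\<close>

lemma legendre_denominator:
  assumes m: "\<not> (m \<in> \<real> \<and> Re m \<ge> 1)"
  shows "1 - m * (complex_of_real (sin \<theta>))^2 * (complex_of_real (sin \<theta>))^2 \<noteq> 0"
proof
  assume 0: "1 - m * (complex_of_real (sin \<theta>))^2 * (complex_of_real (sin \<theta>))^2 = 0"
  define q where "q = ((sin \<theta>)^2)^2"
  have "(sin \<theta>)^2 \<le> 1" by (simp add: abs_square_le_1)
  then have q: "0 \<le> q" "q \<le> 1" by (simp_all only: q_def power_le_one zero_le_power2)
  have mq: "m * of_real q = 1" using 0 by (simp add: q_def algebra_simps power2_eq_square)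
  then have "q \<noteq> 0" by auto
  then have "m = of_real (1 / q)" using mq by (simp add: field_simps)
  moreover have "1 / q \<ge> 1" using q \<open>q \<noteq> 0\<close> by (simp add: field_simps)
  ultimately show False using m by auto
qed

context jacobi_functions
begin

text \<open>If g v were a pole, then g t \<noteq> g v on A, and sn(g t) would tend to infinity along
  A instead of to l.\<close>

lemma not_regular_limit:
  assumes "v islimpt A" "(g \<longlongrightarrow> g v) (at v within A)" "\<And>t. t \<in> A \<Longrightarrow> g t \<in> regular_points"
    and "((\<lambda>t. sn (g t)) \<longlongrightarrow> l) (at v within A)"
  shows "g v \<in> regular_points"
proof (rule ccontr)
  assume n: "g v \<notin> regular_points"
  have "\<forall>\<^sub>F t in at v within A. g t \<noteq> g v"
  proof -
    have "g x \<noteq> g v" if "x \<in> A" for x using assms(3)[OF that] n by metis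
    then show ?thesis by (auto simp: eventually_at_filter intro!: always_eventually)
  qed
  then have "filterlim g (at (g v)) (at v within A)"
    using assms(2) by (auto simp: filterlim_at)
  moreover have "filterlim sn at_infinity (at (g v))"
    using n by (simp add: regular_points_def is_pole_def)
  ultimately have "filterlim (\<lambda>t. sn (g t)) at_infinity (at v within A)"
    by (rule filterlim_compose[rotated])
  then show False
    using not_tendsto_and_filterlim_at_infinity[OF _ assms(4)] assms(1) by (simp add: trivial_limit_within)
qed

lemma regular_nhd:
  assumes "continuous (at t within T) g" "g t \<in> regular_points" "t \<in> T"
  obtains r where "r > 0" "\<And>x. x \<in> ball t r \<inter> T \<Longrightarrow> g x \<in> regular_points"
proof -
  have "\<forall>\<^sub>F x in at t within T. g x \<in> regular_points"
    using topological_tendstoD[OF _ open_regular_points assms(2)] assms(1) by (simp add: continuous_within)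
  then obtain r where "r > 0" "\<forall>x\<in>T. x \<noteq> t \<and> dist x t < r \<longrightarrow> g x \<in> regular_points"
    unfolding eventually_at by blast
  then show thesis using assms by (intro that[of r]) (auto simp: dist_commute)
qed

text \<open>The cut k^2 \<ge> 1 belongs to the integral K, the cut k^2 \<le> 0 to K' with parameter
  1 - k^2. Their end points give k \<noteq> 0 and k^2 \<noteq> 1.\<close>

lemma legendre_modulus:
  assumes "elliptic_modulus k"
  shows "\<not> (k^2 \<in> \<real> \<and> Re (k^2) \<ge> 1)" "\<not> (1 - k^2 \<in> \<real> \<and> Re (1 - k^2) \<ge> 1)" "k \<noteq> 0" "k^2 \<noteq> 1"
proof -
  have "1 - k^2 \<in> \<real> \<Longrightarrow> k^2 \<in> \<real>" using Reals_diff[of 1 "1 - k^2"] by simp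
  then show "\<not> (1 - k^2 \<in> \<real> \<and> Re (1 - k^2) \<ge> 1)"
    using assms by (auto simp: elliptic_modulus_def)
qed (use assms in \<open>auto simp: elliptic_modulus_def\<close>)

text \<open>Along the Legendre path the triple (sn, cn, dn) equals (sin \<theta>, cos \<theta>,
  \<Delta>), and \<theta> = pi/2 is the point K. The path meets no pole because sin stays
  finite.\<close>

lemma quarter_period_values:
  assumes mod: "elliptic_modulus k"
  shows "quarter_period k \<in> regular_points" "sn (quarter_period k) = 1" "cn (quarter_period k) = 0"
proof -
  note m = legendre_modulus(1)[OF mod]
  define \<Delta> where "\<Delta> = (\<lambda>\<theta>. csqrt (1 - k^2 * of_real ((sin \<theta>)^2)))"
  obtain u where u: "u 0 = 0" "u (pi / 2) = quarter_period k"
    and du: "\<And>\<theta>. \<theta> \<in> {0..pi/2} \<Longrightarrow> (u has_derivative (\<lambda>h. h *\<^sub>R (1 / \<Delta> \<theta>))) (at \<theta> within {0..pi/2})"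
    using legendre_integral[OF m] unfolding \<Delta>_def quarter_period_def by metis
  have fl: "jacobi_flow_on (k^2) {0..pi/2} (\<lambda>\<theta> h. h *\<^sub>R (1 / \<Delta> \<theta>)) (\<lambda>\<theta>. of_real (sin \<theta>)) (\<lambda>\<theta>. of_real (cos \<theta>)) \<Delta>"
    unfolding \<Delta>_def by (rule legendre_flow[OF m])
  have cu: "continuous (at t within {0..pi/2}) u" if "t \<in> {0..pi/2}" for t
    using has_derivative_continuous[OF du[OF that]] .
  have "u (pi/2) \<in> regular_points \<and> sn (u (pi/2)) = of_real (sin (pi/2)) \<and>
      cn (u (pi/2)) = of_real (cos (pi/2)) \<and> dn (u (pi/2)) = \<Delta> (pi/2)"
  proof (rule jacobi_flow_continuation[where T = "{0..pi/2}" and a = 0 and b = "pi/2" and R = "\<lambda>t. u t \<in> regular_points"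
      and ?s1.0 = "\<lambda>t. sn (u t)" and ?c1.0 = "\<lambda>t. cn (u t)" and ?d1.0 = "\<lambda>t. dn (u t)", OF _ fl legendre_denominator[OF m]])
    fix t :: real assume t: "t \<in> {0..pi/2}" "u t \<in> regular_points"
    obtain r where r: "r > 0" "\<And>x. x \<in> ball t r \<inter> {0..pi/2} \<Longrightarrow> u x \<in> regular_points"
      using regular_nhd[OF cu t(2)] t by blast
    moreover have "jacobi_flow_on (k^2) (ball t r \<inter> {0..pi/2}) (\<lambda>\<theta> h. h *\<^sub>R (1 / \<Delta> \<theta>))
        (\<lambda>\<theta>. sn (u \<theta>)) (\<lambda>\<theta>. cn (u \<theta>)) (\<lambda>\<theta>. dn (u \<theta>))"
      using r(2) du by (intro flow_comp) (auto intro: has_derivative_subset)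
    ultimately show "\<exists>r>0. (\<forall>t'\<in>ball t r \<inter> {0..pi/2}. u t' \<in> regular_points) \<and>
      jacobi_flow_on (k^2) (ball t r \<inter> {0..pi/2}) (\<lambda>\<theta> h. h *\<^sub>R (1 / \<Delta> \<theta>))
        (\<lambda>\<theta>. sn (u \<theta>)) (\<lambda>\<theta>. cn (u \<theta>)) (\<lambda>\<theta>. dn (u \<theta>))" by blast
  next
    fix A and t :: real assume A: "A \<subseteq> {0..pi/2}" "t \<in> {0..pi/2}" "t islimpt A"
      and eq: "\<And>t. t \<in> A \<Longrightarrow> u t \<in> regular_points \<and> sn (u t) = of_real (sin t) \<and>
        cn (u t) = of_real (cos t) \<and> dn (u t) = \<Delta> t"
    show "u t \<in> regular_points"
    proof (rule not_regular_limit[OF A(3)])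
      show "(u \<longlongrightarrow> u t) (at t within A)"
        using cu[OF A(2)] A(1) by (auto simp: continuous_within intro: tendsto_within_subset)
      have "((\<lambda>t. complex_of_real (sin t)) \<longlongrightarrow> of_real (sin t)) (at t within A)" by (intro tendsto_intros)
      then show "((\<lambda>t. sn (u t)) \<longlongrightarrow> of_real (sin t)) (at t within A)"
        by (rule Lim_transform_within[OF _ zero_less_one]) (use eq in auto)
    qed (use eq in auto)
  qed (auto simp: u at_0 \<Delta>_def)
  then show "quarter_period k \<in> regular_points" "sn (quarter_period k) = 1" "cn (quarter_period k) = 0"
    by (auto simp: u)
qed

text \<open>Along \<i> u(\<theta>) the imaginary transformation gives cn cos \<theta> = 1 for
  \<theta> < pi/2. If the end point were regular, the limit at pi/2 would read 0 = 1.\<close>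

lemma quarter_period'_pole:
  assumes mod: "elliptic_modulus k"
  shows "\<i> * quarter_period' k \<notin> regular_points"
proof
  assume reg: "\<i> * quarter_period' k \<in> regular_points"
  note m = legendre_modulus(2)[OF mod]
  define \<Delta> where "\<Delta> = (\<lambda>\<theta>. csqrt (1 - (1 - k^2) * of_real ((sin \<theta>)^2)))"
  obtain u where u: "u 0 = 0" "u (pi / 2) = quarter_period' k"
    and du: "\<And>\<theta>. \<theta> \<in> {0..pi/2} \<Longrightarrow> (u has_derivative (\<lambda>h. h *\<^sub>R (1 / \<Delta> \<theta>))) (at \<theta> within {0..pi/2})"
    using legendre_integral[OF m] unfolding \<Delta>_def quarter_period'_def by metis
  define v where "v = (\<lambda>\<theta>. \<i> * u \<theta>)"
  have dv: "(v has_derivative (\<lambda>h. \<i> * h *\<^sub>R (1 / \<Delta> \<theta>))) (at \<theta> within {0..pi/2})" if "\<theta> \<in> {0..pi/2}" for \<theta>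
    unfolding v_def using has_derivative_mult_right[OF du[OF that]] .
  \<comment> \<open>The interval is half-open: 1 / cn equals cos \<theta>, which vanishes at pi/2,
    where the transformed triple stops making sense.\<close>
  have fl: "jacobi_flow_on (1 - k^2) {0..<pi/2} (\<lambda>\<theta> h. h *\<^sub>R (1 / \<Delta> \<theta>)) (\<lambda>\<theta>. of_real (sin \<theta>)) (\<lambda>\<theta>. of_real (cos \<theta>)) \<Delta>"
    unfolding \<Delta>_def by (rule legendre_flow[OF m])
  have cv': "continuous (at t within {0..pi/2}) v" if "t \<in> {0..pi/2}" for t
    using has_derivative_continuous[OF dv[OF that]] .
  have cv: "continuous (at t within {0..<pi/2}) v" if "t \<in> {0..<pi/2}" for t
    using cv'[of t] that by (auto intro: continuous_within_subset)
  have cos0: "cos t \<noteq> 0" if "t \<in> {0..<pi/2}" for t :: real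
    using cos_gt_zero_pi[of t] that pi_gt_zero by auto
  have eq: "(v b \<in> regular_points \<and> cn (v b) \<noteq> 0) \<and> - \<i> * sn (v b) / cn (v b) = of_real (sin b) \<and>
      1 / cn (v b) = of_real (cos b) \<and> dn (v b) / cn (v b) = \<Delta> b" if b: "b \<in> {0..<pi/2}" for b
  proof (rule jacobi_flow_continuation[where T = "{0..<pi/2}" and a = 0 and R = "\<lambda>t. v t \<in> regular_points \<and> cn (v t) \<noteq> 0"
      and ?s1.0 = "\<lambda>t. - \<i> * sn (v t) / cn (v t)" and ?c1.0 = "\<lambda>t. 1 / cn (v t)" and ?d1.0 = "\<lambda>t. dn (v t) / cn (v t)", OF _ fl legendre_denominator[OF m] _ _ _ _ _ _ _ b])
    fix t :: real assume t: "t \<in> {0..<pi/2}" "v t \<in> regular_points \<and> cn (v t) \<noteq> 0"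
    obtain r where r: "r > 0" "\<And>x. x \<in> ball t r \<inter> {0..<pi/2} \<Longrightarrow> v x \<in> regular_points"
      using regular_nhd[OF cv _ t(1)] t by blast
    have "((\<lambda>x. cn (v x)) \<longlongrightarrow> cn (v t)) (at t within {0..<pi/2})"
      using cv[OF t(1)] DERIV_isCont[OF derivs(2)] t
      by (auto simp: continuous_within intro: isCont_tendsto_compose)
    then have "\<forall>\<^sub>F x in at t within {0..<pi/2}. cn (v x) \<noteq> 0"
      using tendsto_imp_eventually_ne t by blast
    then obtain r' where r': "r' > 0" "\<And>x. x \<in> {0..<pi/2} \<Longrightarrow> x \<noteq> t \<Longrightarrow> dist x t < r' \<Longrightarrow> cn (v x) \<noteq> 0"
      unfolding eventually_at by blast
    define e where "e = min r r'"
    have e: "e > 0" and ee: "\<And>x. x \<in> ball t e \<inter> {0..<pi/2} \<Longrightarrow> v x \<in> regular_points \<and> cn (v x) \<noteq> 0"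
      using r r' t by (auto simp: e_def dist_commute)
    have "jacobi_flow_on (k^2) (ball t e \<inter> {0..<pi/2}) (\<lambda>\<theta> h. \<i> * h *\<^sub>R (1 / \<Delta> \<theta>))
        (\<lambda>\<theta>. sn (v \<theta>)) (\<lambda>\<theta>. cn (v \<theta>)) (\<lambda>\<theta>. dn (v \<theta>))"
      using ee by (intro flow_comp has_derivative_subset[OF dv]) auto
    from jacobi_imaginary_flow[OF this] ee e
    show "\<exists>r>0. (\<forall>t'\<in>ball t r \<inter> {0..<pi/2}. v t' \<in> regular_points \<and> cn (v t') \<noteq> 0) \<and>
      jacobi_flow_on (1 - k^2) (ball t r \<inter> {0..<pi/2}) (\<lambda>\<theta> h. h *\<^sub>R (1 / \<Delta> \<theta>))
        (\<lambda>\<theta>. - \<i> * sn (v \<theta>) / cn (v \<theta>)) (\<lambda>\<theta>. 1 / cn (v \<theta>)) (\<lambda>\<theta>. dn (v \<theta>) / cn (v \<theta>))" by blast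
  next
    fix A and t :: real assume A: "A \<subseteq> {0..<pi/2}" "t \<in> {0..<pi/2}" "t islimpt A"
      and eq: "\<And>t. t \<in> A \<Longrightarrow> (v t \<in> regular_points \<and> cn (v t) \<noteq> 0) \<and>
        - \<i> * sn (v t) / cn (v t) = of_real (sin t) \<and>
        1 / cn (v t) = of_real (cos t) \<and> dn (v t) / cn (v t) = \<Delta> t"
    have lim: "(v \<longlongrightarrow> v t) (at t within A)"
      using cv[OF A(2)] A(1) by (auto simp: continuous_within intro: tendsto_within_subset)
    have snA: "sn (v x) = \<i> * of_real (sin x) / of_real (cos x)" and cnA: "cn (v x) * of_real (cos x) = 1" if "x \<in> A" for x
    proof -
      from eq[OF that] have 1: "cn (v x) \<noteq> 0" "- \<i> * sn (v x) = of_real (sin x) * cn (v x)"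
        "cn (v x) * of_real (cos x) = 1" by (auto simp: field_simps)
      show "cn (v x) * of_real (cos x) = 1" by fact
      have "sn (v x) = \<i> * (- \<i> * sn (v x))" by simp
      also have "\<dots> = \<i> * of_real (sin x) * cn (v x)" unfolding 1(2) by simp
      also have "cn (v x) = 1 / of_real (cos x)"
        using 1(3) by (metis mult_zero_right nonzero_eq_divide_eq zero_neq_one)
      finally show "sn (v x) = \<i> * of_real (sin x) / of_real (cos x)" by simp
    qed
    \<comment> \<open>On the path sn = \<i> tan \<theta>, which stays finite for \<theta> < pi/2.
      Afterwards cn cos \<theta> = 1 passes to the limit and shows cn \<noteq> 0.\<close>
    have regt: "v t \<in> regular_points"
    proof (rule not_regular_limit[OF A(3) lim])
      have "((\<lambda>t. \<i> * complex_of_real (sin t) / of_real (cos t)) \<longlongrightarrow> \<i> * of_real (sin t) / of_real (cos t)) (at t within A)"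
        using cos0[OF A(2)] by (intro tendsto_intros) auto
      then show "((\<lambda>t. sn (v t)) \<longlongrightarrow> \<i> * of_real (sin t) / of_real (cos t)) (at t within A)"
        by (rule Lim_transform_within[OF _ zero_less_one]) (use snA in auto)
    qed (use eq in auto)
    have "((\<lambda>x. cn (v x) * of_real (cos x)) \<longlongrightarrow> cn (v t) * of_real (cos t)) (at t within A)"
      by (intro tendsto_intros isCont_tendsto_compose[OF DERIV_isCont[OF derivs(2)[OF regt]] lim])
    moreover have "((\<lambda>x. cn (v x) * of_real (cos x)) \<longlongrightarrow> 1) (at t within A)"
      by (rule Lim_transform_within[OF tendsto_const zero_less_one]) (use cnA in auto)
    ultimately have "cn (v t) * of_real (cos t) = 1"
      using A(3) tendsto_unique[of "at t within A"] by (auto simp: trivial_limit_within)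
    then show "v t \<in> regular_points \<and> cn (v t) \<noteq> 0" using regt by auto
  qed (auto simp: u v_def at_0 \<Delta>_def)
  have lim: "(v \<longlongrightarrow> v (pi/2)) (at (pi/2) within {0..<pi/2})"
    by (rule tendsto_within_subset[where S = "{0..pi/2}"]) (use cv'[of "pi/2"] in \<open>auto simp: continuous_within\<close>)
  have regt: "v (pi/2) \<in> regular_points" using reg by (simp add: v_def u)
  have isl: "at (pi/2) within {0..<pi/2} \<noteq> bot"
    unfolding trivial_limit_within not_not
    by (rule islimpt_subset[OF islimpt_greaterThanLessThan2[of 0 "pi/2"]]) auto
  have "((\<lambda>x. cn (v x) * of_real (cos x)) \<longlongrightarrow> cn (v (pi/2)) * of_real (cos (pi/2))) (at (pi/2) within {0..<pi/2})"
    by (intro tendsto_intros isCont_tendsto_compose[OF DERIV_isCont[OF derivs(2)[OF regt]] lim])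
  moreover have "((\<lambda>x. cn (v x) * of_real (cos x)) \<longlongrightarrow> 1) (at (pi/2) within {0..<pi/2})"
  proof (rule Lim_transform_within[OF tendsto_const zero_less_one])
    fix x assume "x \<in> {0..<pi/2}"
    then show "1 = cn (v x) * of_real (cos x)" using eq[of x] by (auto simp: field_simps)
  qed
  ultimately have "cn (v (pi/2)) * of_real (cos (pi/2)) = 1" by (rule tendsto_unique[OF isl])
  then show False by simp
qed

end

section \<open>Translation by quarter periods\<close>

locale jacobi_periods = jacobi_functions +
  assumes modulus: "elliptic_modulus k"
begin

definition K where "K = quarter_period k"
definition pole where "pole = \<i> * quarter_period' k"

lemma K_values: "K \<in> regular_points" "sn K = 1" "cn K = 0"
  using quarter_period_values[OF modulus] by (auto simp: K_def)

lemma k_nonzero: "k \<noteq> 0" "k^2 \<noteq> 1"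
  using legendre_modulus[OF modulus] by auto

lemma dn_K_nonzero: "dn K \<noteq> 0"
  using pythagoras(2)[OF K_values(1)] K_values k_nonzero by auto

text \<open>For v = K the denominator of the addition formulas is 1 - k^2 sn^2 u = dn^2 u, and all
  three numerators contain the factor dn u. One factor is cancelled, which requires dn u \<noteq> 0
  and hence a neighbourhood of 0.\<close>

lemma shift_K_near_0:
  "\<forall>\<^sub>F u in nhds 0. u \<in> regular_points \<and> - u \<in> regular_points \<and> u + K \<in> regular_points \<and> K - u \<in> regular_points \<and>
     dn u \<noteq> 0 \<and> sn (u + K) * dn u = cn u \<and> cn (u + K) * dn u = - (dn K * sn u) \<and> dn (u + K) * dn u = dn K"
proof -
  have 1: "\<forall>\<^sub>F t in nhds 0. t \<in> {t. 1 * t + 0 \<in> regular_points \<and> 1 * t + K \<in> regular_points}"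
    using K_values at_0 by (intro eventually_nhds_in_open open_connected_two(1)[OF _ _ refl]) auto
  have 2: "\<forall>\<^sub>F t in nhds 0. t \<in> {t. (-1) * t + 0 \<in> regular_points \<and> (-1) * t + K \<in> regular_points}"
    using K_values at_0 by (intro eventually_nhds_in_open open_connected_two(1)[OF _ _ refl]) auto
  have "\<forall>\<^sub>F t in nhds 0. dn t \<noteq> 0"
    by (rule isCont_eventually_ne[OF DERIV_isCont[OF derivs(3)[OF at_0(1)]]]) (simp add: at_0)
  with 1 2 show ?thesis
  proof eventually_elim
    case (elim u)
    then have u: "u \<in> regular_points" "u + K \<in> regular_points" by auto
    have d: "1 - k^2 * (sn u)^2 * (sn K)^2 = (dn u)^2"
      using pythagoras(2)[OF u(1)] by (simp add: K_values algebra_simps)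
    note a = addition[OF u(1) K_values(1) u(2), unfolded d]
    have "(sn (u + K) * dn u) * dn u = cn u * dn u" "(cn (u + K) * dn u) * dn u = - (dn K * sn u) * dn u"
      "(dn (u + K) * dn u) * dn u = dn K * dn u"
      using a by (simp_all add: K_values power2_eq_square mult_ac)
    note this[THEN mult_right_cancel[OF elim(3), THEN iffD1]]
    moreover have "- u \<in> regular_points" "K - u \<in> regular_points" using elim(2) by auto
    ultimately show ?case using u elim(3) by blast
  qed
qed

text \<open>sn(u + K) is cd u. That dn u does not vanish comes from dn(u + K) dn u = dn K, a nonzero
  constant.\<close>

lemma shift_K:
  assumes u: "u \<in> regular_points" "u + K \<in> regular_points"
  shows "sn (u + K) * dn u = cn u" "dn u \<noteq> 0"
proof -
  define M where "M = {u. 1 * u + 0 \<in> regular_points \<and> 1 * u + K \<in> regular_points}"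
  have MM: "t \<in> M \<longleftrightarrow> t \<in> regular_points \<and> t + K \<in> regular_points" for t by (auto simp: M_def)
  have 0: "0 \<in> M" and uM: "u \<in> M" using u K_values at_0 by (auto simp: MM)
  have hol: "(\<lambda>t. sn t) holomorphic_on M" "(\<lambda>t. cn t) holomorphic_on M" "(\<lambda>t. dn t) holomorphic_on M"
    "(\<lambda>t. sn (t + K)) holomorphic_on M" "(\<lambda>t. dn (t + K)) holomorphic_on M"
    by (rule holomorphic_comp; auto simp: MM intro!: holomorphic_intros)+
  have "sn (u + K) * dn u - cn u = 0"
  proof (rule identity_continuation[OF _ _ M_def _ _ 0 uM])
    show "(\<lambda>u. sn (u + K) * dn u - cn u) holomorphic_on M" by (intro holomorphic_intros hol)
    show "\<forall>\<^sub>F u in nhds 0. sn (u + K) * dn u - cn u = 0" using shift_K_near_0 by eventually_elim auto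
  qed simp_all
  then show "sn (u + K) * dn u = cn u" by simp
  have "dn (u + K) * dn u - dn K = 0"
  proof (rule identity_continuation[OF _ _ M_def _ _ 0 uM])
    show "(\<lambda>u. dn (u + K) * dn u - dn K) holomorphic_on M" by (intro holomorphic_intros hol)
    show "\<forall>\<^sub>F u in nhds 0. dn (u + K) * dn u - dn K = 0" using shift_K_near_0 by eventually_elim auto
  qed simp_all
  then show "dn u \<noteq> 0" using dn_K_nonzero by auto
qed

lemma regular_shift_K:
  assumes "u \<in> regular_points" "dn u \<noteq> 0"
  shows "u + K \<in> regular_points"
  using pythagoras(2)[OF assms(1)] assms(2)
  by (intro regular_add[OF assms(1) K_values(1)]) (auto simp: K_values algebra_simps)

text \<open>u itself may be a pole here, so K - u cannot be reached through -u. The symmetry about K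
  is proved near 0 and continued; the regularity of K - u then follows from the finite limit of sn(w
  + K).\<close>

lemma reflect_K:
  assumes u: "u + K \<in> regular_points"
  shows "K - u \<in> regular_points" "sn (K - u) = sn (u + K)"
    "cn (K - u) * dn (K - u) = - (cn (u + K) * dn (u + K))"
proof -
  define M where "M = {u. 1 * u + K \<in> regular_points \<and> (-1) * u + K \<in> regular_points}"
  have MM: "t \<in> M \<longleftrightarrow> t + K \<in> regular_points \<and> K - t \<in> regular_points" for t by (auto simp: M_def)
  have 0: "0 \<in> M" using K_values by (auto simp: MM)
  have hol: "(\<lambda>t. sn (K - t)) holomorphic_on M" "(\<lambda>t. cn (K - t)) holomorphic_on M" "(\<lambda>t. dn (K - t)) holomorphic_on M"
    "(\<lambda>t. sn (t + K)) holomorphic_on M" "(\<lambda>t. cn (t + K)) holomorphic_on M" "(\<lambda>t. dn (t + K)) holomorphic_on M"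
    by (rule holomorphic_comp; auto simp: MM intro!: holomorphic_intros)+
  have "filterlim uminus (nhds (0::complex)) (nhds 0)"
    using tendsto_minus[OF tendsto_ident_at[of "0::complex" UNIV]]
    using filterlim_ident[of "nhds (0::complex)"] tendsto_minus[of "\<lambda>x. x" "0::complex"] by simp
  from eventually_compose_filterlim[OF shift_K_near_0 this] shift_K_near_0
  have ev: "\<forall>\<^sub>F u in nhds 0. sn (u + K) - sn (K - u) = 0 \<and>
      cn (K - u) * dn (K - u) + cn (u + K) * dn (u + K) = 0"
  proof eventually_elim
    case (elim u)
    then have r: "u \<in> regular_points" by simp
    note e = reflection(2-)[OF r]
    have 1: "dn u \<noteq> 0" "sn (u + K) * dn u = cn u" "cn (u + K) * dn u = - (dn K * sn u)" "dn (u + K) * dn u = dn K"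
      "sn (K - u) * dn u = cn u" "cn (K - u) * dn u = dn K * sn u" "dn (K - u) * dn u = dn K"
      using elim by (auto simp: e)
    have "(sn (u + K) - sn (K - u)) * dn u = 0" using 1 by (simp add: algebra_simps)
    moreover have "(cn (K - u) * dn (K - u) + cn (u + K) * dn (u + K)) * (dn u)^2
      = (cn (K - u) * dn u) * (dn (K - u) * dn u) + (cn (u + K) * dn u) * (dn (u + K) * dn u)"
      by (simp add: algebra_simps power2_eq_square)
    then have "(cn (K - u) * dn (K - u) + cn (u + K) * dn (u + K)) * (dn u)^2 = 0"
      unfolding 1 by simp
    ultimately show ?case using 1 by simp
  qed
  have s: "sn (t + K) - sn (K - t) = 0" if "t \<in> M" for t
  proof (rule identity_continuation[OF _ _ M_def _ _ 0 that])
    show "(\<lambda>t. sn (t + K) - sn (K - t)) holomorphic_on M" by (intro holomorphic_intros hol)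
    show "\<forall>\<^sub>F u in nhds 0. sn (u + K) - sn (K - u) = 0" using ev by eventually_elim auto
  qed simp_all
  have m0: "(-1::complex) \<noteq> 0" by simp
  have "\<forall>\<^sub>F w in at u. sn ((-1) * w + K) = sn (w + K)"
    using eventually_regular_affine[OF one_neq_zero, of K u] eventually_regular_affine[OF m0, of K u]
  proof eventually_elim
    case (elim w)
    then have "sn (w + K) - sn (K - w) = 0" using s[of w] by (simp add: MM)
    then show ?case by simp
  qed
  moreover have "isCont (\<lambda>w. sn (w + K)) u" by (rule isCont_comp) (use u in \<open>auto intro: continuous_intros\<close>)
  then have "((\<lambda>w. sn (w + K)) \<longlongrightarrow> sn (u + K)) (at u)" by (simp add: isCont_def)
  ultimately have "(-1) * u + K \<in> regular_points" by (rule regularI[OF m0])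
  then show reg: "K - u \<in> regular_points" by simp
  then have uM: "u \<in> M" using u by (simp add: MM)
  from s[OF uM] show "sn (K - u) = sn (u + K)" by simp
  have "cn (K - u) * dn (K - u) + cn (u + K) * dn (u + K) = 0"
  proof (rule identity_continuation[OF _ _ M_def _ _ 0 uM])
    show "(\<lambda>t. cn (K - t) * dn (K - t) + cn (t + K) * dn (t + K)) holomorphic_on M" by (intro holomorphic_intros hol)
    show "\<forall>\<^sub>F u in nhds 0. cn (K - u) * dn (K - u) + cn (u + K) * dn (u + K) = 0" using ev by eventually_elim auto
  qed simp_all
  then show "cn (K - u) * dn (K - u) = - (cn (u + K) * dn (u + K))" by (simp add: eq_neg_iff_add_eq_0)
qed

section \<open>Translation by the pole \<i> K'\<close>

lemma pole: "is_pole sn pole"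
  using quarter_period'_pole[OF modulus] by (simp add: pole_def regular_points_def)

lemma inverse_sn_at_pole: "((\<lambda>w. inverse (sn w)) \<longlongrightarrow> 0) (at pole)"
  by (rule filterlim_compose[OF tendsto_inverse_0 pole[unfolded is_pole_def]])

lemma eventually_sn_nonzero_at_pole: "\<forall>\<^sub>F w in at pole. sn w \<noteq> 0"
  using non_zero_neighbour_pole[OF pole] .

text \<open>cn dn / sn^2 is minus the derivative of 1 / sn, which extends holomorphically to the
  pole with value 0. Its square (1/sn^2 - 1)(1/sn^2 - k^2) tends to k^2, so the limit is k or
  -k.\<close>

lemma pole_limit:
  obtains L where "((\<lambda>w. cn w * dn w / (sn w)^2) \<longlongrightarrow> L) (at pole)" "L^2 = k^2"
proof -
  have "\<forall>\<^sub>F w in at pole. w \<in> regular_points \<and> sn w \<noteq> 0"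
    using eventually_regular eventually_sn_nonzero_at_pole by eventually_elim auto
  then obtain e where e: "e > 0" "\<And>w. w \<noteq> pole \<Longrightarrow> dist w pole < e \<Longrightarrow> w \<in> regular_points \<and> sn w \<noteq> 0"
    unfolding eventually_at by auto
  define S where "S = ball pole e"
  have S: "w \<in> regular_points" "sn w \<noteq> 0" if "w \<in> S - {pole}" for w
    using e that by (auto simp: S_def dist_commute)
  have "open S" "pole \<in> S" using e by (auto simp: S_def)
  define r where "r = (\<lambda>w. if w = pole then 0 else inverse (sn w))"
  have "(\<lambda>u. sn u) holomorphic_on (S - {pole})"
    by (rule holomorphic_comp) (use S in \<open>auto intro: holomorphic_intros\<close>)
  then have hol: "r holomorphic_on S"
    unfolding r_def by (intro is_pole_inverse_holomorphic \<open>open S\<close> pole) (use S in auto)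
  have "(deriv r) holomorphic_on S" using hol \<open>open S\<close> by (rule holomorphic_deriv)
  then have "isCont (deriv r) pole"
    using \<open>open S\<close> \<open>pole \<in> S\<close> holomorphic_on_imp_continuous_on continuous_on_eq_continuous_at by blast
  then have "(deriv r \<longlongrightarrow> deriv r pole) (at pole)" by (simp add: isCont_def)
  then have "((\<lambda>w. - deriv r w) \<longlongrightarrow> - deriv r pole) (at pole)" by (rule tendsto_minus)
  then have lim: "((\<lambda>w. cn w * dn w / (sn w)^2) \<longlongrightarrow> - deriv r pole) (at pole)"
  proof (rule Lim_transform_within_open[OF _ \<open>open S\<close> \<open>pole \<in> S\<close>])
    fix w assume w: "w \<in> S" "w \<noteq> pole"
    then have w': "w \<in> S - {pole}" by auto
    have "((\<lambda>w. inverse (sn w)) has_field_derivative - (cn w * dn w / (sn w)^2)) (at w)"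
      using DERIV_inverse_fun[OF derivs(1)[OF S(1)[OF w']] S(2)[OF w']]
      by (rule DERIV_cong) (simp add: field_simps power2_eq_square)
    then have "(r has_field_derivative - (cn w * dn w / (sn w)^2)) (at w)"
      by (rule has_field_derivative_transform_within_open[of _ _ _ "S - {pole}"])
         (use \<open>open S\<close> w in \<open>auto simp: r_def\<close>)
    then show "- deriv r w = cn w * dn w / (sn w)^2" by (simp add: DERIV_imp_deriv)
  qed
  have "((\<lambda>w. ((inverse (sn w))^2 - 1) * ((inverse (sn w))^2 - k^2)) \<longlongrightarrow> (0^2 - 1) * (0^2 - k^2)) (at pole)"
    by (intro tendsto_intros inverse_sn_at_pole)
  then have "((\<lambda>w. (cn w * dn w / (sn w)^2)^2) \<longlongrightarrow> (0^2 - 1) * (0^2 - k^2)) (at pole)"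
  proof (rule Lim_transform_within_open[OF _ \<open>open S\<close> \<open>pole \<in> S\<close>])
    fix w assume "w \<in> S" "w \<noteq> pole"
    then have w: "w \<in> S - {pole}" by auto
    show "((inverse (sn w))^2 - 1) * ((inverse (sn w))^2 - k^2) = (cn w * dn w / (sn w)^2)^2"
      unfolding power_divide cn_dn_sq[OF S(1)[OF w]] using S(2)[OF w] by (simp add: field_simps)
  qed
  moreover have "((\<lambda>w. (cn w * dn w / (sn w)^2)^2) \<longlongrightarrow> (- deriv r pole)^2) (at pole)"
    by (intro tendsto_power lim)
  ultimately have "(- deriv r pole)^2 = k^2"
    using tendsto_unique[of "at pole"] by fastforce
  then show thesis using that lim by blast
qed

text \<open>Zeros of sn are simple: where sn = 0, both cn^2 and dn^2 equal 1, so the derivative cn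
  dn is nonzero.\<close>

lemma eventually_sn_nonzero:
  assumes v: "v \<in> regular_points"
  shows "\<forall>\<^sub>F w in at v. sn w \<noteq> 0"
proof (cases "sn v = 0")
  case False
  then show ?thesis
    using isCont_eventually_ne[OF DERIV_isCont[OF derivs(1)[OF v]], of 0] by (simp add: eventually_nhds_conv_at)
next
  case True
  have "cn v * dn v \<noteq> 0" using pythagoras[OF v] True by auto
  moreover have "((\<lambda>w. (sn w - sn v) / (w - v)) \<longlongrightarrow> cn v * dn v) (at v)"
    using derivs(1)[OF v] by (simp add: has_field_derivative_iff)
  ultimately have "\<forall>\<^sub>F w in at v. (sn w - sn v) / (w - v) \<noteq> 0"
    by (intro tendsto_imp_eventually_ne)
  then show ?thesis by eventually_elim (use True in auto)
qed

text \<open>Dividing the addition formula by sn^2 w and letting w tend to the pole gives k sn v sn(v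
  + \<i> K') = \<epsilon>, with a sign independent of v. The sign may stay undetermined because the
  base points occur in pairs of opposite points. Stated in \<open>P1\<close>, the formula includes
  the zeros of sn v, where the value is \<open>Infty\<close>.\<close>

lemma shift_pole:
  obtains \<epsilon> where "\<epsilon>^2 = 1" "\<And>v. v \<in> regular_points \<Longrightarrow> P1_value sn (v + pole) = P1_of_ratio \<epsilon> (k * sn v)"
proof -
  obtain L where L: "((\<lambda>w. cn w * dn w / (sn w)^2) \<longlongrightarrow> L) (at pole)" "L^2 = k^2"
    by (rule pole_limit)
  define \<epsilon> where "\<epsilon> = - L / k"
  have eps: "\<epsilon>^2 = 1" "\<epsilon> \<noteq> 0" using L(2) k_nonzero by (auto simp: \<epsilon>_def power_divide)
  have prod: "k * sn v * sn (v + pole) = \<epsilon>"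
    if v: "v \<in> regular_points" "v + pole \<in> regular_points" "sn v \<noteq> 0" for v
  proof -
    have ev: "\<forall>\<^sub>F w in at pole. sn (v + w) * ((inverse (sn w))^2 - k^2 * (sn v)^2) =
        sn v * (cn w * dn w / (sn w)^2) + inverse (sn w) * (cn v * dn v)"
      using eventually_regular[of pole] eventually_regular_affine[OF one_neq_zero, of v pole] eventually_sn_nonzero_at_pole
    proof eventually_elim
      case (elim w)
      then have w: "w \<in> regular_points" "v + w \<in> regular_points" "sn w \<noteq> 0" by (auto simp: add.commute)
      have "sn (v + w) * ((inverse (sn w))^2 - k^2 * (sn v)^2) =
         sn (v + w) * (1 - k^2 * (sn v)^2 * (sn w)^2) / (sn w)^2"
        using w(3) by (simp add: field_simps)
      also have "\<dots> = sn v * (cn w * dn w / (sn w)^2) + inverse (sn w) * (cn v * dn v)"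
        unfolding addition(1)[OF v(1) w(1,2)] using w(3) by (simp add: field_simps power2_eq_square)
      finally show ?case .
    qed
    have "isCont (\<lambda>w. sn (v + w)) pole" by (rule isCont_comp) (use v in \<open>auto intro: continuous_intros\<close>)
    then have "((\<lambda>w. sn (v + w) * ((inverse (sn w))^2 - k^2 * (sn v)^2)) \<longlongrightarrow>
        sn (v + pole) * (0^2 - k^2 * (sn v)^2)) (at pole)"
      by (intro tendsto_intros inverse_sn_at_pole) (simp add: isCont_def)
    moreover have "((\<lambda>w. sn (v + w) * ((inverse (sn w))^2 - k^2 * (sn v)^2)) \<longlongrightarrow> sn v * L + 0 * (cn v * dn v)) (at pole)"
      unfolding filterlim_cong[OF refl refl ev] by (intro tendsto_intros inverse_sn_at_pole L)
    ultimately have "sn (v + pole) * (0^2 - k^2 * (sn v)^2) = sn v * L + 0 * (cn v * dn v)"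
      using tendsto_unique[of "at pole"] by fastforce
    then have "sn v * (- (k * (k * sn v * sn (v + pole)))) = sn v * L"
      by (simp add: power2_eq_square algebra_simps)
    then have "- (k * (k * sn v * sn (v + pole))) = L" by (rule mult_left_cancel[OF v(3), THEN iffD1])
    then show ?thesis using k_nonzero by (auto simp: \<epsilon>_def field_simps)
  qed
  have ev: "\<forall>\<^sub>F w in at v. k * sn w * sn (w + pole) = \<epsilon> \<and> sn w \<noteq> 0" if "v \<in> regular_points" for v
    using eventually_regular[of v] eventually_regular_affine[OF one_neq_zero, of pole v] eventually_sn_nonzero[OF that]
    by eventually_elim (simp add: prod)
  have "P1_value sn (v + pole) = P1_of_ratio \<epsilon> (k * sn v)" if v: "v \<in> regular_points" for v
  proof -
    have cont: "(sn \<longlongrightarrow> sn v) (at v)" using DERIV_isCont[OF derivs(1)[OF v]] by (simp add: isCont_def)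
    show ?thesis
    proof (cases "sn v = 0")
      case False
      have "\<forall>\<^sub>F w in at v. sn (1 * w + pole) = \<epsilon> / (k * sn w)"
        using ev[OF v] by eventually_elim (use k_nonzero in \<open>auto simp: field_simps\<close>)
      moreover have "((\<lambda>w. \<epsilon> / (k * sn w)) \<longlongrightarrow> \<epsilon> / (k * sn v)) (at v)"
        using False k_nonzero by (intro tendsto_intros cont) auto
      ultimately have "1 * v + pole \<in> regular_points" by (rule regularI[OF one_neq_zero])
      then have "v + pole \<in> regular_points" by simp
      then show ?thesis using prod[OF v _ False] False k_nonzero
        by (auto simp: P1_value_def P1_of_ratio_def regular_points_def field_simps)
    next
      case True
      \<comment> \<open>The product k sn w sn(w + pole) is the nonzero constant \<epsilon> near v,
        but would tend to 0 if sn were finite at v + pole.\<close>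
      have "v + pole \<notin> regular_points"
      proof
        assume r: "v + pole \<in> regular_points"
        have "isCont (\<lambda>w. sn (w + pole)) v" by (rule isCont_comp) (use r in \<open>auto intro: continuous_intros\<close>)
        then have "((\<lambda>w. k * sn w * sn (w + pole)) \<longlongrightarrow> k * sn v * sn (v + pole)) (at v)"
          by (intro tendsto_intros cont) (simp add: isCont_def)
        moreover have "((\<lambda>w. k * sn w * sn (w + pole)) \<longlongrightarrow> \<epsilon>) (at v)"
          by (rule tendsto_eventually) (use ev[OF v] in \<open>auto elim: eventually_mono\<close>)
        ultimately have "k * sn v * sn (v + pole) = \<epsilon>" using tendsto_unique[of "at v"] by fastforce
        then show False using True eps by simp
      qed
      then show ?thesis using True by (simp add: P1_value_def P1_of_ratio_def regular_points_def)
    qed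
  qed
  then show thesis using that eps by blast
qed

end

section \<open>The second-order equation\<close>

text \<open>(s, c, d) and (S, C, D) belong to z and \<gamma>; \<sigma>, \<sigma>' are sn(z -
  \<gamma>), sn(z + \<gamma>), and \<tau>, \<tau>' the products cn dn there. The coefficients of the
  second-order equation are tied to these quantities by two relations, because a single one may
  degenerate to 0 = 0.\<close>

lemma addition_quotients:
  fixes s c d S C D m :: complex
  assumes r: "c^2 = 1 - s^2" "d^2 = 1 - m * s^2" "C^2 = 1 - S^2" "D^2 = 1 - m * S^2"
    and dS: "dS = 1 - m * s^2 * S^2" "dS \<noteq> 0"
    and s1: "\<sigma> * dS = s * C * D - S * c * d" and s2: "\<sigma>' * dS = s * C * D + S * c * d"
    and t1: "\<tau> * dS^2 = (c * C + s * S * d * D) * (d * D + m * s * S * c * C)"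
    and t2: "\<tau>' * dS^2 = (c * C - s * S * d * D) * (d * D - m * s * S * c * C)"
  shows "\<sigma> * \<sigma>' * dS = s^2 - S^2"
    and "(1 - m * s^4) * C * D * (\<sigma>' - \<sigma>) = dS * c * d * (\<tau> * \<sigma>' - \<sigma> * \<tau>')"
    and "(1 - m * s^4) * C * D * (\<tau> * \<sigma>' + \<sigma> * \<tau>') = dS * c * d * (\<sigma>' + \<sigma>) * (1 - m * \<sigma>^2 * \<sigma>'^2)"
proof -
  \<comment> \<open>Changing the sign of S exchanges \<sigma> with \<sigma>' and \<tau> with
    \<tau>'. Accordingly a and u are the parts of \<sigma> dS and \<tau> dS^2 even in S, while -b
    and v are the odd parts.\<close>
  define a b u v where "a = s * C * D" and "b = S * c * d"
    and "u = c * d * C * D * (1 + m * s^2 * S^2)" and "v = s * S * (d^2 * D^2 + m * c^2 * C^2)"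
  have t: "\<tau> * dS^2 = u + v" "\<tau>' * dS^2 = u - v"
    unfolding t1 t2 u_def v_def by (simp_all add: algebra_simps power2_eq_square)
  have sg: "\<sigma> * dS = a - b" "\<sigma>' * dS = a + b" using s1 s2 by (auto simp: a_def b_def)
  have ab: "a^2 - b^2 = (s^2 - S^2) * dS"
    unfolding a_def b_def power_mult_distrib r dS(1) by (simp add: algebra_simps power2_eq_square)
  have "(\<sigma> * \<sigma>' * dS) * dS = (\<sigma> * dS) * (\<sigma>' * dS)" by simp
  also have "\<dots> = a^2 - b^2" unfolding sg by (simp add: algebra_simps power2_eq_square)
  finally show ss: "\<sigma> * \<sigma>' * dS = s^2 - S^2" unfolding ab using dS(2) by simp
  have "u * b + v * a = S * C * D * (c^2 * d^2 * (1 + m * s^2 * S^2) + s^2 * (d^2 * D^2 + m * c^2 * C^2))"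
    unfolding u_def v_def a_def b_def by (simp add: algebra_simps power2_eq_square)
  also have "c^2 * d^2 * (1 + m * s^2 * S^2) + s^2 * (d^2 * D^2 + m * c^2 * C^2) = (1 - m * s^4) * dS"
    unfolding r dS(1) by (simp add: algebra_simps power2_eq_square power4_eq_xxxx)
  finally have ub: "u * b + v * a = S * C * D * ((1 - m * s^4) * dS)" .
  have "u * a + v * b = s * c * d * (C^2 * D^2 * (1 + m * s^2 * S^2) + S^2 * (d^2 * D^2 + m * c^2 * C^2))"
    unfolding u_def v_def a_def b_def by (simp add: algebra_simps power2_eq_square)
  also have "C^2 * D^2 * (1 + m * s^2 * S^2) + S^2 * (d^2 * D^2 + m * c^2 * C^2) = (1 - m * S^4) * dS"
    unfolding r dS(1) by (simp add: algebra_simps power2_eq_square power4_eq_xxxx)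
  finally have ua: "u * a + v * b = s * c * d * ((1 - m * S^4) * dS)" .
  have "(\<tau> * \<sigma>' - \<sigma> * \<tau>') * dS^3 = (\<tau> * dS^2) * (\<sigma>' * dS) - (\<sigma> * dS) * (\<tau>' * dS^2)"
    by (simp add: algebra_simps power2_eq_square power3_eq_cube)
  also have "\<dots> = 2 * (u * b + v * a)" unfolding t sg by (simp add: algebra_simps)
  finally have m3: "(\<tau> * \<sigma>' - \<sigma> * \<tau>') * dS^3 = 2 * S * C * D * (1 - m * s^4) * dS" unfolding ub by simp
  have "(\<tau> * \<sigma>' + \<sigma> * \<tau>') * dS^3 = (\<tau> * dS^2) * (\<sigma>' * dS) + (\<sigma> * dS) * (\<tau>' * dS^2)"
    by (simp add: algebra_simps power2_eq_square power3_eq_cube)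
  also have "\<dots> = 2 * (u * a + v * b)" unfolding t sg by (simp add: algebra_simps)
  finally have p3: "(\<tau> * \<sigma>' + \<sigma> * \<tau>') * dS^3 = 2 * s * c * d * (1 - m * S^4) * dS" unfolding ua by simp
  have dif: "(\<sigma>' - \<sigma>) * dS = 2 * S * c * d" "(\<sigma>' + \<sigma>) * dS = 2 * s * C * D"
    using sg by (simp_all add: algebra_simps a_def b_def)
  have "((1 - m * s^4) * C * D * (\<sigma>' - \<sigma>)) * dS^3 = (1 - m * s^4) * C * D * ((\<sigma>' - \<sigma>) * dS) * dS^2"
    by (simp add: power2_eq_square power3_eq_cube)
  also have "\<dots> = c * d * dS * (2 * S * C * D * (1 - m * s^4) * dS)" unfolding dif
    by (simp add: power2_eq_square)
  also have "\<dots> = (dS * c * d * (\<tau> * \<sigma>' - \<sigma> * \<tau>')) * dS^3" unfolding m3[symmetric] by simp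
  finally show "(1 - m * s^4) * C * D * (\<sigma>' - \<sigma>) = dS * c * d * (\<tau> * \<sigma>' - \<sigma> * \<tau>')"
    using dS(2) by simp
  have "(1 - m * \<sigma>^2 * \<sigma>'^2) * dS^2 = dS^2 - m * (\<sigma> * \<sigma>' * dS)^2"
    by (simp add: algebra_simps power2_eq_square)
  also have "\<dots> = (1 - m * s^4) * (1 - m * S^4)" unfolding ss unfolding dS(1)
    by (simp add: algebra_simps power2_eq_square power4_eq_xxxx)
  finally have sq: "(1 - m * \<sigma>^2 * \<sigma>'^2) * dS^2 = (1 - m * s^4) * (1 - m * S^4)" .
  have "((1 - m * s^4) * C * D * (\<tau> * \<sigma>' + \<sigma> * \<tau>')) * dS^3 = c * d * dS * (2 * s * C * D) * ((1 - m * s^4) * (1 - m * S^4))"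
    unfolding mult.assoc p3[unfolded mult.assoc] by (simp add: algebra_simps)
  also have "\<dots> = (dS * c * d * (\<sigma>' + \<sigma>) * (1 - m * \<sigma>^2 * \<sigma>'^2)) * dS^3"
    unfolding sq[symmetric] dif[symmetric] by (simp add: power2_eq_square power3_eq_cube)
  finally show "(1 - m * s^4) * C * D * (\<tau> * \<sigma>' + \<sigma> * \<tau>') = dS * c * d * (\<sigma>' + \<sigma>) * (1 - m * \<sigma>^2 * \<sigma>'^2)"
    using dS(2) by simp
qed

text \<open>Intended values: t = sn w, q = sn(w - \<eta>), h = sn(w + H), with \<sigma> = sn \<eta>
  and \<sigma>' = sn H. Both conclusions determine the ratio of \<open>E\<close> to t (q + h), in
  exactly the two forms that \<open>addition_quotients\<close> gives for the coefficients of the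
  second-order equation.\<close>

lemma shifted_pair_identities:
  fixes t T \<sigma> \<sigma>' \<tau> \<tau>' m :: complex
  assumes T: "T^2 = (1 - t^2) * (1 - m * t^2)" and t1: "\<tau>^2 = (1 - \<sigma>^2) * (1 - m * \<sigma>^2)"
    and t2: "\<tau>'^2 = (1 - \<sigma>'^2) * (1 - m * \<sigma>'^2)"
    and q: "q * (1 - m * \<sigma>^2 * t^2) = t * \<tau> - \<sigma> * T" "1 - m * \<sigma>^2 * t^2 \<noteq> 0"
    and h: "h * (1 - m * \<sigma>'^2 * t^2) = t * \<tau>' + \<sigma>' * T" "1 - m * \<sigma>'^2 * t^2 \<noteq> 0"
  defines "E \<equiv> t^2 + q * h + \<sigma> * \<sigma>' * (1 + m * t^2 * q * h)"
  shows "(\<sigma>' - \<sigma>) * E = (\<tau> * \<sigma>' - \<sigma> * \<tau>') * (t * (q + h))"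
    and "(\<tau> * \<sigma>' + \<sigma> * \<tau>') * E = (\<sigma>' + \<sigma>) * (1 - m * \<sigma>^2 * \<sigma>'^2) * (t * (q + h))"
proof -
  define d d' p where "d = 1 - m * \<sigma>^2 * t^2" and "d' = 1 - m * \<sigma>'^2 * t^2" and "p = \<sigma> * \<sigma>'"
  define X where "X = (t^2 + p) * (d * d') - (1 + m * t^2 * p) * p * T^2"
  define w where "w = (1 + m * t^2 * p) * t"
  have qh: "q * d = t * \<tau> - \<sigma> * T" "h * d' = t * \<tau>' + \<sigma>' * T" using q h by (auto simp: d_def d'_def)
  have "(q * h) * (d * d') = (q * d) * (h * d')" by simp
  also have "\<dots> = t^2 * (\<tau> * \<tau>') + t * T * (\<tau> * \<sigma>' - \<sigma> * \<tau>') - p * T^2"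
    unfolding qh p_def by (simp add: algebra_simps power2_eq_square)
  finally have qh2: "(q * h) * (d * d') = t^2 * (\<tau> * \<tau>') + t * T * (\<tau> * \<sigma>' - \<sigma> * \<tau>') - p * T^2" .
  have "E * (d * d') = (t^2 + p) * (d * d') + (1 + m * t^2 * p) * ((q * h) * (d * d'))"
    by (simp add: E_def p_def algebra_simps)
  also have "\<dots> = X + w * (t * (\<tau> * \<tau>') + T * (\<tau> * \<sigma>' - \<sigma> * \<tau>'))"
    unfolding qh2 X_def w_def by (simp add: algebra_simps power2_eq_square)
  finally have E: "E * (d * d') = X + w * (t * (\<tau> * \<tau>') + T * (\<tau> * \<sigma>' - \<sigma> * \<tau>'))" .
  have "(t * (q + h)) * (d * d') = t * ((q * d) * d' + (h * d') * d)" by (simp add: algebra_simps)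
  also have "\<dots> = t^2 * (\<tau> * d' + \<tau>' * d) + t * T * (\<sigma>' * d - \<sigma> * d')"
    unfolding qh by (simp add: algebra_simps power2_eq_square)
  also have "\<sigma>' * d - \<sigma> * d' = (\<sigma>' - \<sigma>) * (1 + m * t^2 * p)"
    unfolding d_def d'_def p_def by (simp add: algebra_simps power2_eq_square)
  finally have R: "(t * (q + h)) * (d * d') = t^2 * (\<tau> * d' + \<tau>' * d) + T * (\<sigma>' - \<sigma>) * w"
    by (simp add: w_def algebra_simps)
  have dd: "d * d' \<noteq> 0" using q h by (auto simp: d_def d'_def)
  have X1: "(\<sigma>' - \<sigma>) * X = t^2 * (\<tau>^2 * \<sigma>' * d' - \<sigma> * \<tau>'^2 * d)"
    unfolding X_def T t1 t2 d_def d'_def p_def by (simp add: algebra_simps power2_eq_square)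
  have dsum: "\<sigma>' * d - \<sigma> * d' = (\<sigma>' - \<sigma>) * (1 + m * t^2 * p)"
    unfolding d_def d'_def p_def by (simp add: algebra_simps power2_eq_square)
  have "((\<sigma>' - \<sigma>) * E) * (d * d') = (\<sigma>' - \<sigma>) * (E * (d * d'))" by simp
  also have "\<dots> = t^2 * (\<tau>^2 * \<sigma>' * d' - \<sigma> * \<tau>'^2 * d) + t^2 * (\<tau> * \<tau>') * ((\<sigma>' - \<sigma>) * (1 + m * t^2 * p))
       + (\<sigma>' - \<sigma>) * w * T * (\<tau> * \<sigma>' - \<sigma> * \<tau>')"
    unfolding E X1[symmetric] w_def by (simp add: algebra_simps power2_eq_square)
  also have "\<dots> = (\<tau> * \<sigma>' - \<sigma> * \<tau>') * ((t * (q + h)) * (d * d'))"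
    unfolding R dsum[symmetric] by (simp add: algebra_simps power2_eq_square)
  finally show "(\<sigma>' - \<sigma>) * E = (\<tau> * \<sigma>' - \<sigma> * \<tau>') * (t * (q + h))"
    using dd by simp
  define n where "n = 1 - m * \<sigma>^2 * \<sigma>'^2"
  have X2: "\<sigma>' * X + \<sigma> * w * t * \<tau>'^2 = (\<sigma>' + \<sigma>) * n * t^2 * d'"
    unfolding X_def T t2 d_def d'_def p_def n_def w_def by (simp add: algebra_simps power2_eq_square)
  have X3: "\<sigma> * X + \<sigma>' * w * t * \<tau>^2 = (\<sigma>' + \<sigma>) * n * t^2 * d"
    unfolding X_def T t1 d_def d'_def p_def n_def w_def by (simp add: algebra_simps power2_eq_square)
  have X4: "\<tau>^2 * \<sigma>'^2 - \<sigma>^2 * \<tau>'^2 = (\<sigma>' + \<sigma>) * (\<sigma>' - \<sigma>) * n"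
    unfolding t1 t2 n_def by (simp add: algebra_simps power2_eq_square)
  have "((\<tau> * \<sigma>' + \<sigma> * \<tau>') * E) * (d * d') = (\<tau> * \<sigma>' + \<sigma> * \<tau>') * (E * (d * d'))" by simp
  also have "\<dots> = \<tau> * (\<sigma>' * X + \<sigma> * w * t * \<tau>'^2) + \<tau>' * (\<sigma> * X + \<sigma>' * w * t * \<tau>^2)
       + w * T * (\<tau>^2 * \<sigma>'^2 - \<sigma>^2 * \<tau>'^2)"
    unfolding E by (simp add: algebra_simps power2_eq_square)
  also have "\<dots> = (\<sigma>' + \<sigma>) * n * ((t * (q + h)) * (d * d'))"
    unfolding X2 X3 X4 R by (simp add: algebra_simps power2_eq_square)
  finally show "(\<tau> * \<sigma>' + \<sigma> * \<tau>') * E = (\<sigma>' + \<sigma>) * (1 - m * \<sigma>^2 * \<sigma>'^2) * (t * (q + h))"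
    using dd by (simp add: n_def)
qed

text \<open>Equal products force equal sums of squares through the two biquadratic relations, hence
  {x^2, y^2} = {t^2, q^2}; as x^2 \<noteq> t^2, this leaves q = e x, t = e y with a sign e. Then
  \<omega> \<noteq> 0 (it will be sn(\<gamma>e + \<gamma>o)) and \<sigma> \<noteq> 0 impose
  incompatible signs on the products cn dn. The second claim runs parallel, with (t, q) replaced by
  (1/(k t), 1/(k q)), where m = k^2.\<close>

lemma products_separated:
  fixes x y t q X Y T Q \<sigma> \<tau> \<omega> m :: complex
  assumes sq: "X^2 = (1 - x^2) * (1 - m * x^2)" "Y^2 = (1 - y^2) * (1 - m * y^2)"
      "T^2 = (1 - t^2) * (1 - m * t^2)" "Q^2 = (1 - q^2) * (1 - m * q^2)"
    and s1: "\<sigma> * (1 - m * x^2 * y^2) = x * Y - y * X" and s2: "\<sigma> * (1 - m * t^2 * q^2) = t * Q - q * T"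
    and w1: "\<omega> * (1 - m * x^2 * q^2) = - (q * X + x * Q)" and w2: "\<omega> * (1 - m * y^2 * t^2) = - (t * Y + y * T)"
    and e1: "x^2 + y^2 - 2 * \<tau> * x * y - \<sigma>^2 * (1 + m * x^2 * y^2) = 0"
    and e2: "t^2 + q^2 - 2 * \<tau> * t * q - \<sigma>^2 * (1 + m * t^2 * q^2) = 0"
    and nz: "x \<noteq> 0" "1 - m * x^4 \<noteq> 0" "x^2 \<noteq> t^2" "m * x^2 * t^2 \<noteq> 1" "m * x^2 * y^2 \<noteq> 1" "\<sigma> \<noteq> 0" "\<omega> \<noteq> 0"
  shows "x * y \<noteq> t * q" "m * (x * y) * (t * q) \<noteq> 1"
proof -
  show "x * y \<noteq> t * q"
  proof
    assume P: "x * y = t * q"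
    have P2: "x^2 * y^2 = t^2 * q^2" using P by (metis power_mult_distrib)
    have "x^2 + y^2 = 2 * \<tau> * (x * y) + \<sigma>^2 * (1 + m * (x^2 * y^2))" using e1 by (simp add: algebra_simps)
    also have "\<dots> = t^2 + q^2" unfolding P P2 using e2 by (simp add: algebra_simps)
    finally have S: "x^2 + y^2 = t^2 + q^2" .
    have "(x^2 - t^2) * (x^2 - q^2) = x^2 * (x^2 - (t^2 + q^2)) + t^2 * q^2" by (simp add: algebra_simps)
    also have "\<dots> = 0" unfolding S[symmetric] P2[symmetric] by (simp add: algebra_simps)
    finally have q2: "q^2 = x^2" using nz(3) by simp
    define e where "e = q / x"
    have q: "q = e * x" and ee: "e * e = 1"
      using nz(1) q2 by (auto simp: e_def field_simps power2_eq_square)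
    have "x * y = x * (t * e)" using P q by simp
    then have "y = t * e" using nz(1) by simp
    then have t: "t = e * y" using ee by (simp add: mult.assoc mult.left_commute)
    have t2: "t^2 = y^2" using S q2 by simp
    have "Q^2 = X^2" "T^2 = Y^2" unfolding sq q2 t2 by simp_all
    moreover have "X^2 = (e * X)^2" "Y^2 = (e * Y)^2" using ee by (simp_all add: power2_eq_square algebra_simps)
    ultimately have Q: "Q = e * X \<or> Q = - (e * X)" and T: "T = e * Y \<or> T = - (e * Y)"
      by (simp_all add: power2_eq_iff)
    \<comment> \<open>The other sign, Q = -e X, would make \<omega> (1 - m x^4) vanish.\<close>
    have "\<omega> * (1 - m * x^4) = - (x * (e * X + Q))"
      using w1 unfolding q2 unfolding q by (simp add: algebra_simps power2_eq_square power4_eq_xxxx)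
    then have "e * X + Q \<noteq> 0" using nz by auto
    then have Q: "Q = e * X" and "X \<noteq> 0" using Q by auto
    have s2': "\<sigma> * (1 - m * x^2 * y^2) = y * X - e * x * T"
      using s2 unfolding mult.assoc P2[symmetric] unfolding Q t q using ee by (simp add: algebra_simps)
    have eea: "e * (e * a) = a" for a using ee by (simp flip: mult.assoc)
    from T show False
    proof
      assume T: "T = e * Y"
      then have "y * X - e * x * T = - (x * Y - y * X)" using eea by (simp add: algebra_simps)
      then have "\<sigma> * (1 - m * x^2 * y^2) = - (\<sigma> * (1 - m * x^2 * y^2))"
        using s1 s2' by metis
      then show False using nz by simp
    next
      assume "T = - (e * Y)"
      then have "y * X - e * x * T = y * X + x * Y" using eea by (simp add: algebra_simps)
      then have "y * X + x * Y = x * Y - y * X" using s1 s2' by metis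
      then have "2 * (y * X) = 0" by (simp add: algebra_simps)
      then have "y = 0" using \<open>X \<noteq> 0\<close> by simp
      then show False using w2 t nz by simp
    qed
  qed
  show "m * (x * y) * (t * q) \<noteq> 1"
  proof
    assume R: "m * (x * y) * (t * q) = 1"
    define P P' where "P = x * y" and "P' = t * q"
    have PP: "m * P * P' = 1" using R by (simp add: P_def P'_def)
    then have P0: "P \<noteq> 0" by auto
    have S: "x^2 + y^2 = 2 * \<tau> * P + \<sigma>^2 * (1 + m * P^2)"
      using e1 by (simp add: P_def power_mult_distrib algebra_simps)
    have S': "t^2 + q^2 = 2 * \<tau> * P' + \<sigma>^2 * (1 + m * P'^2)"
      using e2 by (simp add: P'_def power_mult_distrib algebra_simps)
    have "m * P^2 * (t^2 + q^2) = 2 * \<tau> * P * (m * P * P') + \<sigma>^2 * (m * P^2 + (m * P * P')^2)"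
      unfolding S' by (simp add: algebra_simps power2_eq_square)
    also have "\<dots> = x^2 + y^2" unfolding PP S by simp
    finally have SS: "m * P^2 * (t^2 + q^2) = x^2 + y^2" .
    have "P^2 * ((m * t^2 * x^2 - 1) * (m * q^2 * x^2 - 1)) =
       (m * P * P')^2 * x^4 - x^2 * (m * P^2 * (t^2 + q^2)) + P^2"
      unfolding P'_def by (simp add: algebra_simps power2_eq_square power4_eq_xxxx)
    also have "\<dots> = 0" unfolding PP SS by (simp add: P_def algebra_simps power2_eq_square power4_eq_xxxx)
    finally have "(m * t^2 * x^2 - 1) * (m * q^2 * x^2 - 1) = 0" using P0 by simp
    then have qx: "m * x^2 * q^2 = 1" using nz(4) unfolding mult_eq_0_iff by (auto simp: mult_ac)
    have "(m * x^2 * q^2) * (m * y^2 * t^2) = (m * P * P')^2"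
      by (simp add: P_def P'_def algebra_simps power2_eq_square)
    then have ty: "m * y^2 * t^2 = 1" using qx PP by simp
    \<comment> \<open>Both formulas for \<omega> have denominator 0 in this case, so their
      numerators vanish; this replaces the sign discussion of the first part.\<close>
    have z: "x * Q = - (q * X)" "y * T = - (t * Y)" using w1 w2 unfolding qx ty by (simp_all add: eq_neg_iff_add_eq_0 add.commute)
    have s2P: "\<sigma> * (1 - m * P'^2) = t * Q - q * T"
      using s2 by (simp add: P'_def power_mult_distrib mult.assoc)
    have "P * (\<sigma> * (1 - m * P'^2)) = (y * t) * (x * Q) - (x * q) * (y * T)"
      unfolding s2P P_def by (simp add: algebra_simps)
    also have "\<dots> = P' * (x * Y - y * X)" unfolding z P'_def by (simp add: algebra_simps)
    also have "\<dots> = P' * (\<sigma> * (1 - m * P^2))" using s1 by (simp add: P_def power_mult_distrib mult.assoc)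
    finally have "\<sigma> * (P - P' * (m * P * P')) = \<sigma> * (P' - P * (m * P * P'))"
      by (simp add: algebra_simps power2_eq_square)
    then have "P = P'" using nz(6) unfolding PP by (simp add: algebra_simps)
    then show False using PP nz(5) by (simp add: P_def power2_eq_square algebra_simps)
  qed
qed

text \<open>x and y are cd z and cd \<gamma>. The first three items transport the genericity
  conditions from sn to cd, at the price of the factor 1 - m. The last two say that numerator and
  denominator of the half-step vanish at (x, y).\<close>

lemma cd_identities:
  fixes s c d S C D x y m :: complex
  assumes r: "c^2 = 1 - s^2" "d^2 = 1 - m * s^2" "C^2 = 1 - S^2" "D^2 = 1 - m * S^2"
    and x: "x * d = c" and y: "y * D = C"
  shows "(1 - m * x^4) * d^4 = (1 - m) * (1 - m * s^4)"
    and "(x^2 - y^2) * (d^2 * D^2) = (1 - m) * (S^2 - s^2)"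
    and "(1 - m * x^2 * y^2) * (d^2 * D^2) = (1 - m) * (1 - m * s^2 * S^2)"
    and "(C^2 - c^2) * c * d + (1 - m * S^2 * s^2) * c * d * x^2 = (1 - m * s^4) * C * D * x * y"
    and "(m * ((C^2 - c^2) * c * d) * x^2 + (1 - m * S^2 * s^2) * c * d) * y = (1 - m * s^4) * C * D * x"
proof -
  have x2: "x^2 * d^2 = 1 - s^2" and y2: "y^2 * D^2 = 1 - S^2"
    using x y r by (metis power_mult_distrib)+
  have "(1 - m * x^4) * d^4 = (d^2)^2 - m * (x^2 * d^2)^2"
    by (simp add: algebra_simps power2_eq_square power4_eq_xxxx)
  also have "\<dots> = (1 - m) * (1 - m * s^4)" unfolding x2 unfolding r
    by (simp add: algebra_simps power2_eq_square power4_eq_xxxx)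
  finally show "(1 - m * x^4) * d^4 = (1 - m) * (1 - m * s^4)" .
  have "(x^2 - y^2) * (d^2 * D^2) = (x^2 * d^2) * D^2 - (y^2 * D^2) * d^2" by (simp add: algebra_simps)
  also have "\<dots> = (1 - m) * (S^2 - s^2)" unfolding x2 y2 unfolding r by (simp add: algebra_simps)
  finally show "(x^2 - y^2) * (d^2 * D^2) = (1 - m) * (S^2 - s^2)" .
  have "(1 - m * x^2 * y^2) * (d^2 * D^2) = d^2 * D^2 - m * (x^2 * d^2) * (y^2 * D^2)" by (simp add: algebra_simps)
  also have "\<dots> = (1 - m) * (1 - m * s^2 * S^2)" unfolding x2 y2 unfolding r by (simp add: algebra_simps)
  finally show "(1 - m * x^2 * y^2) * (d^2 * D^2) = (1 - m) * (1 - m * s^2 * S^2)" .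
  have 1: "d^2 * (C^2 - c^2) + (1 - m * S^2 * s^2) * (x^2 * d^2) = (1 - m * s^4) * C^2"
    unfolding x2 unfolding r by (simp add: algebra_simps power2_eq_square power4_eq_xxxx)
  have xd: "c * d = x * d^2" and yD: "C^2 = C * D * y" "D^2 * y = C * D"
    unfolding x[symmetric] y[symmetric] by (simp_all add: power2_eq_square)
  have "(C^2 - c^2) * c * d + (1 - m * S^2 * s^2) * c * d * x^2 =
      ((C^2 - c^2) + (1 - m * S^2 * s^2) * x^2) * (c * d)"
    by (simp add: algebra_simps)
  also have "\<dots> = x * (d^2 * (C^2 - c^2) + (1 - m * S^2 * s^2) * (x^2 * d^2))"
    unfolding xd by (simp add: algebra_simps)
  also have "\<dots> = (1 - m * s^4) * C * D * x * y"
    unfolding 1 unfolding yD(1) by (simp add: mult_ac)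
  finally show "(C^2 - c^2) * c * d + (1 - m * S^2 * s^2) * c * d * x^2 = (1 - m * s^4) * C * D * x * y" .
  have 2: "m * (C^2 - c^2) * (x^2 * d^2) + (1 - m * S^2 * s^2) * d^2 = (1 - m * s^4) * D^2"
    unfolding x2 unfolding r by (simp add: algebra_simps power2_eq_square power4_eq_xxxx)
  have "(m * ((C^2 - c^2) * c * d) * x^2 + (1 - m * S^2 * s^2) * c * d) * y =
      (m * (C^2 - c^2) * x^2 + (1 - m * S^2 * s^2)) * (c * d) * y"
    by (simp add: algebra_simps)
  also have "\<dots> = x * y * (m * (C^2 - c^2) * (x^2 * d^2) + (1 - m * S^2 * s^2) * d^2)"
    unfolding xd by (simp add: algebra_simps)
  also have "\<dots> = x * (1 - m * s^4) * (D^2 * y)"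
    unfolding 2 by (simp add: mult_ac)
  also have "\<dots> = (1 - m * s^4) * C * D * x"
    unfolding yD(2) by (simp add: mult_ac)
  finally show "(m * ((C^2 - c^2) * c * d) * x^2 + (1 - m * S^2 * s^2) * c * d) * y = (1 - m * s^4) * C * D * x" .
qed

context jacobi_periods
begin

lemma squares:
  assumes "u \<in> regular_points"
  shows "(cn u)^2 = 1 - (sn u)^2" "(dn u)^2 = 1 - k^2 * (sn u)^2"
  using pythagoras[OF assms] by (auto simp: algebra_simps)

text \<open>sn(w - (z - \<gamma>)), sn w, sn(w + (z + \<gamma>)) are three consecutive values of a
  solution, for every w. Near w = 0, two multiples of the defect \<open>E\<close> vanish by the
  preceding identities, and their multipliers are not both zero; continuation in w does the
  rest.\<close>

lemma second_order_equation:
  assumes z: "z \<in> regular_points" and g: "\<gamma> \<in> regular_points"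
    and dS: "1 - k^2 * (sn z)^2 * (sn \<gamma>)^2 \<noteq> 0" and ne: "(sn z)^2 \<noteq> (sn \<gamma>)^2"
    and cd: "cn z \<noteq> 0" "dn z \<noteq> 0"
    and w: "w \<in> regular_points" "w - (z - \<gamma>) \<in> regular_points" "w + (z + \<gamma>) \<in> regular_points"
  defines "t \<equiv> sn w" and "q \<equiv> sn (w - (z - \<gamma>))" and "h \<equiv> sn (w + (z + \<gamma>))"
  shows "(1 - k^2 * sn z ^ 4) * cn \<gamma> * dn \<gamma> * (t * (q + h)) =
    (1 - k^2 * (sn z)^2 * (sn \<gamma>)^2) * cn z * dn z * (t^2 + q * h)
    + ((cn \<gamma>)^2 - (cn z)^2) * cn z * dn z * (1 + k^2 * t^2 * q * h)"
proof -
  define \<eta> H where "\<eta> = z - \<gamma>" and "H = z + \<gamma>"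
  have reg: "\<eta> \<in> regular_points" "H \<in> regular_points"
    unfolding \<eta>_def H_def using regular_diff[OF z g dS] regular_add[OF z g dS] by auto
  define dd where "dd = 1 - k^2 * (sn z)^2 * (sn \<gamma>)^2"
  have dd: "dd \<noteq> 0" using dS by (simp add: dd_def)
  define \<alpha> where "\<alpha> = (1 - k^2 * sn z ^ 4) * cn \<gamma> * dn \<gamma>"
  note sub = subtraction[OF z g reg(1)[unfolded \<eta>_def], folded \<eta>_def dd_def]
  note add = addition[OF z g reg(2)[unfolded H_def], folded H_def dd_def]
  have t1: "cn \<eta> * dn \<eta> * dd^2 = (cn z * cn \<gamma> + sn z * sn \<gamma> * dn z * dn \<gamma>) * (dn z * dn \<gamma> + k^2 * sn z * sn \<gamma> * cn z * cn \<gamma>)"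
    unfolding sub(2,3)[symmetric] by (simp add: power2_eq_square)
  have t2: "cn H * dn H * dd^2 = (cn z * cn \<gamma> - sn z * sn \<gamma> * dn z * dn \<gamma>) * (dn z * dn \<gamma> - k^2 * sn z * sn \<gamma> * cn z * cn \<gamma>)"
    unfolding add(2,3)[symmetric] by (simp add: power2_eq_square)
  note aq = addition_quotients[OF squares[OF z] squares[OF g] dd_def dd sub(1) add(1) t1 t2]
  define \<sigma> \<sigma>' \<tau> \<tau>' where "\<sigma> = sn \<eta>" and "\<sigma>' = sn H" and "\<tau> = cn \<eta> * dn \<eta>" and "\<tau>' = cn H * dn H"
  define E where "E = (\<lambda>w. \<alpha> * (sn w * (sn (w - \<eta>) + sn (w + H)))
     - dd * cn z * dn z * ((sn w)^2 + sn (w - \<eta>) * sn (w + H) + \<sigma> * \<sigma>' * (1 + k^2 * (sn w)^2 * sn (w - \<eta>) * sn (w + H))))"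
  define M where "M = {u. \<forall>(e, c)\<in>{(1, 0), (1, - \<eta>), (1, H)}. e * u + c \<in> regular_points}"
  have MM: "u \<in> M \<longleftrightarrow> u \<in> regular_points \<and> u - \<eta> \<in> regular_points \<and> u + H \<in> regular_points" for u
    by (auto simp: M_def)
  have 0: "0 \<in> M" and wM: "w \<in> M" using reg w reflection(1)[OF reg(1)] at_0 by (simp_all add: MM \<eta>_def H_def)
  have hol: "(\<lambda>u. sn u) holomorphic_on M" "(\<lambda>u. sn (u - \<eta>)) holomorphic_on M" "(\<lambda>u. sn (u + H)) holomorphic_on M"
    by (rule holomorphic_comp; auto simp: MM intro!: holomorphic_intros)+
  have cont: "isCont sn 0" using DERIV_isCont[OF derivs(1)[OF at_0(1)]] .
  have "\<forall>\<^sub>F u in nhds 0. 1 - k^2 * \<sigma>^2 * (sn u)^2 \<noteq> 0" "\<forall>\<^sub>F u in nhds 0. 1 - k^2 * \<sigma>'^2 * (sn u)^2 \<noteq> 0"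
    by (rule isCont_eventually_ne, intro continuous_intros cont, simp add: at_0)+
  moreover have "\<forall>\<^sub>F u in nhds 0. u \<in> M"
    using 0 by (intro eventually_nhds_in_open open_connected_affine(1)[OF _ _ M_def]) auto
  ultimately have ev: "\<forall>\<^sub>F u in nhds 0. E u = 0"
  proof eventually_elim
    case (elim u)
    then have u: "u \<in> regular_points" "u - \<eta> \<in> regular_points" "u + H \<in> regular_points" by (auto simp: MM)
    have q: "sn (u - \<eta>) * (1 - k^2 * \<sigma>^2 * (sn u)^2) = sn u * \<tau> - \<sigma> * (cn u * dn u)"
      using subtraction(1)[OF u(1) reg(1) u(2)] by (simp add: \<sigma>_def \<tau>_def mult_ac)
    have h: "sn (u + H) * (1 - k^2 * \<sigma>'^2 * (sn u)^2) = sn u * \<tau>' + \<sigma>' * (cn u * dn u)"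
      using addition(1)[OF u(1) reg(2) u(3)] by (simp add: \<sigma>'_def \<tau>'_def mult_ac)
    note si = shifted_pair_identities[OF cn_dn_sq[OF u(1)] cn_dn_sq[OF reg(1), folded \<sigma>_def \<tau>_def]
        cn_dn_sq[OF reg(2), folded \<sigma>'_def \<tau>'_def] q elim(1) h elim(2)]
    define R L where "R = sn u * (sn (u - \<eta>) + sn (u + H))"
      and "L = (sn u)^2 + sn (u - \<eta>) * sn (u + H) + \<sigma> * \<sigma>' * (1 + k^2 * (sn u)^2 * sn (u - \<eta>) * sn (u + H))"
    note si = si[folded R_def L_def]
    note aq' = aq(2,3)[folded \<sigma>_def \<sigma>'_def \<tau>_def \<tau>'_def \<alpha>_def]
    have Eu: "E u = \<alpha> * R - dd * cn z * dn z * L" by (simp add: E_def R_def L_def)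
    have "(\<sigma>' - \<sigma>) * E u = (\<alpha> * (\<sigma>' - \<sigma>)) * R - dd * cn z * dn z * ((\<sigma>' - \<sigma>) * L)"
      unfolding Eu by (simp add: algebra_simps)
    also have "\<dots> = 0" unfolding aq'(1) si(1) by simp
    finally have z1: "(\<sigma>' - \<sigma>) * E u = 0" .
    have "(\<tau> * \<sigma>' + \<sigma> * \<tau>') * E u = (\<alpha> * (\<tau> * \<sigma>' + \<sigma> * \<tau>')) * R - dd * cn z * dn z * ((\<tau> * \<sigma>' + \<sigma> * \<tau>') * L)"
      unfolding Eu by (simp add: algebra_simps)
    also have "\<dots> = 0" unfolding aq'(2) si(2) by simp
    finally have z2: "(\<tau> * \<sigma>' + \<sigma> * \<tau>') * E u = 0" .
    show "E u = 0"
    proof (rule ccontr)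
      assume "E u \<noteq> 0"
      then have eq: "\<sigma>' = \<sigma>" "\<tau> * \<sigma>' + \<sigma> * \<tau>' = 0" using z1 z2 by auto
      \<comment> \<open>sn(z + \<gamma>) = sn(z - \<gamma>) forces sn \<gamma> = 0. Then \<tau> =
        \<tau>' \<noteq> 0, so the second multiplier vanishes only if \<sigma> = 0, that is sn z =
        0, against sn^2 z \<noteq> sn^2 \<gamma>.\<close>
      have S0: "sn \<gamma> = 0" using sub(1) add(1) cd eq(1) by (simp add: \<sigma>_def \<sigma>'_def)
      have "cn \<gamma> * cn \<gamma> = 1" "dn \<gamma> * dn \<gamma> = 1" "dd = 1" using squares[OF g] S0 by (auto simp: power2_eq_square dd_def)
      then have "\<sigma> = sn z * (cn \<gamma> * dn \<gamma>)" "\<tau> = cn z * dn z * (cn \<gamma> * dn \<gamma>)" "\<tau>' = \<tau>"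
        using sub(1) t1 t2 S0 by (auto simp: \<sigma>_def \<tau>_def \<tau>'_def)
      moreover have "cn \<gamma> \<noteq> 0" "dn \<gamma> \<noteq> 0" using \<open>cn \<gamma> * cn \<gamma> = 1\<close> \<open>dn \<gamma> * dn \<gamma> = 1\<close> by auto
      ultimately have "sn z = 0" using eq cd by auto
      then show False using S0 ne by simp
    qed
  qed
  have "E w = 0"
  proof (rule identity_continuation_affine[OF _ _ M_def _ ev 0 wM])
    show "E holomorphic_on M" unfolding E_def by (intro holomorphic_intros hol)
  qed auto
  moreover have ds: "dd * (\<sigma> * \<sigma>') = (cn \<gamma>)^2 - (cn z)^2"
    using aq(1) squares[OF z] squares[OF g] by (simp add: \<sigma>_def \<sigma>'_def mult_ac)
  ultimately show ?thesis
    unfolding t_def q_def h_def E_def \<alpha>_def \<eta>_def[symmetric] H_def[symmetric] dd_def[symmetric] ds[symmetric]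
    by (simp add: algebra_simps)
qed

text \<open>The interface between the elliptic functions and the algebra that follows: z = z_{2n},
  \<delta> = \<gamma>o, z + \<gamma> + \<delta> = z_{2n+1}, z - \<gamma> - \<delta> = z_{2n-1}. Of
  the obtained constants, h is cd z_{2n+1}, and \<sigma>, \<tau> are sn and cn dn at z -
  \<gamma>.\<close>

lemma configuration:
  fixes z \<gamma> \<delta> :: complex
  assumes reg: "z \<in> regular_points" "\<gamma> \<in> regular_points" "\<delta> \<in> regular_points" "z + \<gamma> + \<delta> \<in> regular_points"
    and regK: "z + K \<in> regular_points" "\<gamma> + K \<in> regular_points" "\<delta> + K \<in> regular_points"
      "z - \<gamma> - \<delta> + K \<in> regular_points"
    and ge: "generic_half_step k sn cn dn z \<gamma>"
    and go: "generic_half_step k sn cn dn (z + \<gamma> + \<delta>) \<delta>"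
    and geo: "(sn z)^2 \<noteq> (sn \<delta>)^2" "k^2 * (sn z)^2 * (sn \<delta>)^2 \<noteq> 1"
    and period: "sn (\<gamma> + \<delta>) \<noteq> 0"
  defines "x \<equiv> sn (z + K)" and "y \<equiv> sn (\<gamma> + K)" and "t \<equiv> sn (\<delta> + K)" and "q \<equiv> sn (z - \<gamma> - \<delta> + K)"
  obtains \<sigma> \<tau> h where
    "x * dn z = cn z" "y * dn \<gamma> = cn \<gamma>" "t * dn \<delta> = cn \<delta>" "h * dn (z + \<gamma> + \<delta>) = cn (z + \<gamma> + \<delta>)"
    "dn \<gamma> \<noteq> 0" "dn \<delta> \<noteq> 0"
    "(1 - k^2 * sn z ^ 4) * cn \<gamma> * dn \<gamma> * (t * (q + h)) =
       (1 - k^2 * (sn z)^2 * (sn \<gamma>)^2) * cn z * dn z * (t^2 + q * h)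
       + ((cn \<gamma>)^2 - (cn z)^2) * cn z * dn z * (1 + k^2 * t^2 * q * h)"
    "\<tau>^2 = (1 - \<sigma>^2) * (1 - k^2 * \<sigma>^2)" "\<sigma> \<noteq> 0"
    "x^2 + y^2 - 2 * \<tau> * x * y - \<sigma>^2 * (1 + k^2 * x^2 * y^2) = 0"
    "t^2 + q^2 - 2 * \<tau> * t * q - \<sigma>^2 * (1 + k^2 * t^2 * q^2) = 0"
    "x * y \<noteq> t * q" "k^2 * (x * y) * (t * q) \<noteq> 1"
    "x \<noteq> 0" "1 - k^2 * x^4 \<noteq> 0" "x^2 \<noteq> t^2" "k^2 * x^2 * t^2 \<noteq> 1" "x^2 \<noteq> y^2" "k^2 * x^2 * y^2 \<noteq> 1"
proof -
  note ge' = ge[unfolded generic_half_step_def]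
  note go' = go[unfolded generic_half_step_def]
  have xs: "x * dn z = cn z" and ys: "y * dn \<gamma> = cn \<gamma>" "dn \<gamma> \<noteq> 0" and ts: "t * dn \<delta> = cn \<delta>" "dn \<delta> \<noteq> 0"
    unfolding x_def y_def t_def using shift_K reg regK by auto
  define h where "h = sn (z + \<gamma> + \<delta> + K)"
  have regh: "z + \<gamma> + \<delta> + K \<in> regular_points" using regular_shift_K reg(4) go' by blast
  then have hs: "h * dn (z + \<gamma> + \<delta>) = cn (z + \<gamma> + \<delta>)" unfolding h_def using shift_K reg by blast
  have dz: "dn z \<noteq> 0" and cz: "cn z \<noteq> 0" using ge' by auto
  have k1: "1 - k^2 \<noteq> 0" using k_nonzero by auto
  have ss: "(sn \<gamma>)^2 \<noteq> (sn z)^2" using ge' squares[OF reg(1)] squares[OF reg(2)] by auto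
  note ci = cd_identities[OF squares[OF reg(1)] squares[OF reg(2)] xs ys(1)]
  note ci' = cd_identities[OF squares[OF reg(1)] squares[OF reg(3)] xs ts(1)]
  have x0: "x \<noteq> 0" using xs cz by auto
  have x4: "1 - k^2 * x^4 \<noteq> 0"
  proof
    assume "1 - k^2 * x^4 = 0"
    then show False using ci(1) k1 ge' by simp
  qed
  have xt: "x^2 \<noteq> t^2"
  proof
    assume "x^2 = t^2"
    then show False using ci'(2) k1 geo(1) by simp
  qed
  have kxt: "k^2 * x^2 * t^2 \<noteq> 1"
  proof
    assume "k^2 * x^2 * t^2 = 1"
    then show False using ci'(3) k1 geo(2) by simp
  qed
  have xy: "x^2 \<noteq> y^2"
  proof
    assume "x^2 = y^2"
    then show False using ci(2) k1 ss by simp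
  qed
  have kxy: "k^2 * x^2 * y^2 \<noteq> 1"
  proof
    assume "k^2 * x^2 * y^2 = 1"
    then show False using ci(3) k1 ge' by simp
  qed
  define \<eta> where "\<eta> = z - \<gamma>"
  have dS: "1 - k^2 * (sn z)^2 * (sn \<gamma>)^2 \<noteq> 0" using ge' by auto
  have reg\<eta>: "\<eta> \<in> regular_points" unfolding \<eta>_def using regular_diff reg dS by blast
  define \<sigma> \<tau> where "\<sigma> = sn \<eta>" and "\<tau> = cn \<eta> * dn \<eta>"
  have regm: "- \<eta> \<in> regular_points" and refl: "sn (- \<eta>) = - \<sigma>" "cn (- \<eta>) * dn (- \<eta>) = \<tau>"
    using reflection[OF reg\<eta>] by (auto simp: \<sigma>_def \<tau>_def)
  \<comment> \<open>By reflection about K, q = sn(z_{2n-1} + K) = sn a. The arguments \<delta> + K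
    and a differ by the same \<eta> as z + K and \<gamma> + K, so (x, y) and (t, q) satisfy one and
    the same biquadratic relation.\<close>
  define a where "a = \<delta> + K - \<eta>"
  have a: "a = K - (z - \<gamma> - \<delta>)" by (simp add: a_def \<eta>_def)
  have rega: "a \<in> regular_points" and sna: "sn a = q"
    and cna: "cn a * dn a = - (cn (z - \<gamma> - \<delta> + K) * dn (z - \<gamma> - \<delta> + K))"
    unfolding a q_def using reflect_K[OF regK(4)] by auto
  have \<tau>2: "\<tau>^2 = (1 - \<sigma>^2) * (1 - k^2 * \<sigma>^2)" using cn_dn_sq[OF reg\<eta>] by (simp add: \<sigma>_def \<tau>_def)
  have xe: "x^2 + y^2 - 2 * \<tau> * x * y - \<sigma>^2 * (1 + k^2 * x^2 * y^2) = 0"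
    using biquadratic_relation[OF regK(2) reg\<eta>] regK(1)
    by (simp add: \<eta>_def[symmetric] x_def y_def \<sigma>_def \<tau>_def) (simp add: \<eta>_def algebra_simps)
  have "\<delta> + K + - \<eta> = a" by (simp add: a_def)
  then have te: "t^2 + q^2 - 2 * \<tau> * t * q - \<sigma>^2 * (1 + k^2 * t^2 * q^2) = 0"
    using biquadratic_relation[OF regK(3) regm] rega unfolding refl by (simp add: sna t_def)
  have "\<sigma> * (1 - k^2 * (sn z)^2 * (sn \<gamma>)^2) = sn z * cn \<gamma> * dn \<gamma> - sn \<gamma> * cn z * dn z"
    unfolding \<sigma>_def \<eta>_def using subtraction(1)[OF reg(1,2)] reg\<eta> by (simp add: \<eta>_def)
  moreover have "(sn z * cn \<gamma> * dn \<gamma> - sn \<gamma> * cn z * dn z) * (sn z * cn \<gamma> * dn \<gamma> + sn \<gamma> * cn z * dn z) =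
     (sn z)^2 * (cn \<gamma> * dn \<gamma>)^2 - (sn \<gamma>)^2 * (cn z * dn z)^2"
    by (simp add: algebra_simps power2_eq_square)
  moreover have "(sn z)^2 * (cn \<gamma> * dn \<gamma>)^2 - (sn \<gamma>)^2 * (cn z * dn z)^2 =
     ((sn z)^2 - (sn \<gamma>)^2) * (1 - k^2 * (sn z)^2 * (sn \<gamma>)^2)"
    unfolding cn_dn_sq[OF reg(1)] cn_dn_sq[OF reg(2)] by (simp add: algebra_simps)
  ultimately have \<sigma>0: "\<sigma> \<noteq> 0" using dS ss by auto
  \<comment> \<open>A nicely meromorphic function has the value 0 at its poles, so sn(\<gamma> +
    \<delta>) \<noteq> 0 rules out a pole.\<close>
  have regw: "\<gamma> + \<delta> \<in> regular_points"
  proof (rule ccontr)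
    assume "\<gamma> + \<delta> \<notin> regular_points"
    then have "is_pole sn (\<gamma> + \<delta>)" by (simp add: regular_points_def)
    moreover have "sn nicely_meromorphic_on UNIV" using jacobi by (simp add: jacobi_elliptic_def)
    ultimately show False using period is_pole_zero_at_nicely_mero by blast
  qed
  have zK: "z - K \<in> regular_points" "sn (z - K) = - x" "cn (z - K) * dn (z - K) = - (cn (z + K) * dn (z + K))"
    using reflection[OF reflect_K(1)[OF regK(1)]] reflect_K[OF regK(1)] by (simp_all add: x_def)
  have gK: "\<gamma> - K \<in> regular_points" "sn (\<gamma> - K) = - y" "cn (\<gamma> - K) * dn (\<gamma> - K) = - (cn (\<gamma> + K) * dn (\<gamma> + K))"
    using reflection[OF reflect_K(1)[OF regK(2)]] reflect_K[OF regK(2)] by (simp_all add: y_def)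
  define X Y T Q where "X = cn (z + K) * dn (z + K)" and "Y = cn (\<gamma> + K) * dn (\<gamma> + K)"
    and "T = cn (\<delta> + K) * dn (\<delta> + K)" and "Q = cn a * dn a"
  have sep: "x * y \<noteq> t * q" "k^2 * (x * y) * (t * q) \<noteq> 1"
  proof -
    note cn_dn_sq[OF regK(1), folded X_def x_def] cn_dn_sq[OF regK(2), folded Y_def y_def]
      cn_dn_sq[OF regK(3), folded T_def t_def] cn_dn_sq[OF rega, folded Q_def, unfolded sna]
    moreover have "\<sigma> * (1 - k^2 * x^2 * y^2) = x * Y - y * X"
      using subtraction(1)[OF regK(1,2)] reg\<eta> by (simp add: \<sigma>_def x_def y_def X_def Y_def \<eta>_def mult.assoc)
    moreover have "\<sigma> * (1 - k^2 * t^2 * q^2) = t * Q - q * T"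
      using subtraction(1)[OF regK(3) rega] reg\<eta> by (simp add: \<sigma>_def t_def T_def Q_def sna mult.assoc) (simp add: a_def mult.assoc)
    moreover have "sn (\<gamma> + \<delta>) * (1 - k^2 * x^2 * q^2) = - (q * X + x * Q)"
    proof -
      have e: "a + (z - K) = \<gamma> + \<delta>" by (simp add: a)
      have "sn (\<gamma> + \<delta>) * (1 - k^2 * q^2 * x^2) = q * (cn (z - K) * dn (z - K)) + (- x) * (cn a * dn a)"
        using addition(1)[OF rega zK(1)] regw unfolding e by (simp add: sna zK(2) mult.assoc)
      then show ?thesis unfolding zK(3) X_def Q_def by (simp add: algebra_simps)
    qed
    moreover have "sn (\<gamma> + \<delta>) * (1 - k^2 * y^2 * t^2) = - (t * Y + y * T)"
    proof -
      have e: "\<gamma> - K + (\<delta> + K) = \<gamma> + \<delta>" by simp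
      have "sn (\<gamma> + \<delta>) * (1 - k^2 * y^2 * t^2) = (- y) * (cn (\<delta> + K) * dn (\<delta> + K)) + t * (cn (\<gamma> - K) * dn (\<gamma> - K))"
        using addition(1)[OF gK(1) regK(3)] regw unfolding e by (simp add: t_def gK(2) mult.assoc)
      then show ?thesis unfolding gK(3) Y_def T_def by (simp add: algebra_simps)
    qed
    ultimately show "x * y \<noteq> t * q" "k^2 * (x * y) * (t * q) \<noteq> 1"
      using products_separated[OF _ _ _ _ _ _ _ _ xe te x0 x4 xt kxt kxy \<sigma>0 period] by blast+
  qed
  have "(1 - k^2 * sn z ^ 4) * cn \<gamma> * dn \<gamma> * (t * (q + h)) =
       (1 - k^2 * (sn z)^2 * (sn \<gamma>)^2) * cn z * dn z * (t^2 + q * h)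
       + ((cn \<gamma>)^2 - (cn z)^2) * cn z * dn z * (1 + k^2 * t^2 * q * h)"
  proof -
    \<comment> \<open>At w = \<delta> + K the three consecutive values are q, t, h.\<close>
    have e1: "\<delta> + K - (z - \<gamma>) = a" by (simp add: a_def \<eta>_def)
    have e2: "\<delta> + K + (z + \<gamma>) = z + \<gamma> + \<delta> + K" by simp
    from second_order_equation[OF reg(1,2) dS ss[symmetric] cz dz regK(3), unfolded e1 e2 sna]
    show ?thesis using rega regh by (simp add: t_def h_def)
  qed
  then show thesis using that xs ys ts hs \<tau>2 \<sigma>0 xe te sep x0 x4 xt kxt xy kxy by blast
qed

end

section \<open>Half-steps on the projective line\<close>

lemma P1_of_ratio_eq_iff:
  assumes "(a, b) \<noteq> (0, 0)" "(c, d) \<noteq> (0, 0)"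
  shows "P1_of_ratio a b = P1_of_ratio c d \<longleftrightarrow> a * d = b * c"
  using assms by (auto simp: P1_of_ratio_def field_simps)

lemma P1_of_ratio_hom_coords: "P1_of_ratio (fst (hom_coords P)) (snd (hom_coords P)) = P"
  by (cases P) (auto simp: P1_of_ratio_def)

lemma hom_coords_nonzero: "(fst (hom_coords P), snd (hom_coords P)) \<noteq> (0, 0)"
  by (cases P) auto

lemma hom_coords_P1_of_ratio:
  assumes "(a, b) \<noteq> (0, 0)"
  obtains l where "l \<noteq> 0" "hom_coords (P1_of_ratio a b) = (l * a, l * b)"
proof (cases "b = 0")
  case True
  then show thesis using assms that[of "1 / a"] by (auto simp: P1_of_ratio_def)
next
  case False
  then show thesis using that[of "1 / b"] by (auto simp: P1_of_ratio_def)
qed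

lemma P1_quotient_scale: "l \<noteq> 0 \<Longrightarrow> P1_quotient (l * a) (l * b) = P1_quotient a b"
  by (auto simp: P1_quotient_def P1_of_ratio_def)

text \<open>
  \<open>step_num\<close> and \<open>step_den\<close> are linear in the second argument, with traceless matrix
  \<open>(p, -r; r', -p)\<close>; \<open>step_disc\<close> is its determinant, and \<open>d_step_disc\<close>, \<open>d_step_num\<close>,
  \<open>d_step_den\<close> are directional derivatives.
\<close>

definition step_num :: "complex \<Rightarrow> complex \<Rightarrow> complex \<Rightarrow> complex \<Rightarrow> complex \<Rightarrow> complex \<Rightarrow> complex \<Rightarrow> complex" where
  "step_num \<alpha> \<beta> \<epsilon> X0 X1 Y0 Y1 = \<alpha> * X0 * X1 * Y0 - \<beta> * X1^2 * Y1 - \<epsilon> * X0^2 * Y1"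

definition step_den :: "complex \<Rightarrow> complex \<Rightarrow> complex \<Rightarrow> complex \<Rightarrow> complex \<Rightarrow> complex \<Rightarrow> complex \<Rightarrow> complex \<Rightarrow> complex" where
  "step_den m \<alpha> \<beta> \<epsilon> X0 X1 Y0 Y1 = m * \<beta> * X0^2 * Y0 - \<alpha> * X0 * X1 * Y1 + \<epsilon> * X1^2 * Y0"

definition step_disc :: "complex \<Rightarrow> complex \<Rightarrow> complex \<Rightarrow> complex \<Rightarrow> complex \<Rightarrow> complex \<Rightarrow> complex" where
  "step_disc m \<alpha> \<beta> \<epsilon> X0 X1 = (\<beta> * X1^2 + \<epsilon> * X0^2) * (m * \<beta> * X0^2 + \<epsilon> * X1^2) - (\<alpha> * X0 * X1)^2"

definition d_step_disc :: "complex \<Rightarrow> complex \<Rightarrow> complex \<Rightarrow> complex \<Rightarrow> complex \<Rightarrow> complex \<Rightarrow> complex \<Rightarrow> complex \<Rightarrow> complex" where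
  "d_step_disc m \<alpha> \<beta> \<epsilon> X0 X1 V0 V1 =
     2 * (\<beta> * X1 * V1 + \<epsilon> * X0 * V0) * (m * \<beta> * X0^2 + \<epsilon> * X1^2)
     + 2 * (\<beta> * X1^2 + \<epsilon> * X0^2) * (m * \<beta> * X0 * V0 + \<epsilon> * X1 * V1)
     - 2 * \<alpha>^2 * X0 * X1 * (X0 * V1 + X1 * V0)"

definition d_step_num where
  "d_step_num \<alpha> \<beta> \<epsilon> X0 X1 Y0 Y1 V0 V1 W0 W1 =
     \<alpha> * (V0 * X1 + X0 * V1) * Y0 - 2 * (\<beta> * X1 * V1 + \<epsilon> * X0 * V0) * Y1
     + step_num \<alpha> \<beta> \<epsilon> X0 X1 W0 W1"

definition d_step_den where
  "d_step_den m \<alpha> \<beta> \<epsilon> X0 X1 Y0 Y1 V0 V1 W0 W1 =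
     2 * (m * \<beta> * X0 * V0 + \<epsilon> * X1 * V1) * Y0 - \<alpha> * (V0 * X1 + X0 * V1) * Y1
     + step_den m \<alpha> \<beta> \<epsilon> X0 X1 W0 W1"

lemma step_wronskian:
  "step_num \<alpha> \<beta> \<epsilon> X0 X1 Y0 Y1 * step_den m \<alpha> \<beta> \<epsilon> X0 X1 W0 W1 - step_den m \<alpha> \<beta> \<epsilon> X0 X1 Y0 Y1 * step_num \<alpha> \<beta> \<epsilon> X0 X1 W0 W1
   = step_disc m \<alpha> \<beta> \<epsilon> X0 X1 * (Y0 * W1 - Y1 * W0)"
  by (simp add: step_num_def step_den_def step_disc_def algebra_simps power2_eq_square)

text \<open>The adjugate of the matrix applied to (num, den); as the trace is 0, the adjugate is
  minus the matrix itself.\<close>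

lemma step_disc_combinations:
  "step_disc m \<alpha> \<beta> \<epsilon> X0 X1 * Y0 = (\<beta> * X1^2 + \<epsilon> * X0^2) * step_den m \<alpha> \<beta> \<epsilon> X0 X1 Y0 Y1 - \<alpha> * X0 * X1 * step_num \<alpha> \<beta> \<epsilon> X0 X1 Y0 Y1"
  "step_disc m \<alpha> \<beta> \<epsilon> X0 X1 * Y1 = \<alpha> * X0 * X1 * step_den m \<alpha> \<beta> \<epsilon> X0 X1 Y0 Y1 - (m * \<beta> * X0^2 + \<epsilon> * X1^2) * step_num \<alpha> \<beta> \<epsilon> X0 X1 Y0 Y1"
  by (simp_all add: step_num_def step_den_def step_disc_def algebra_simps power2_eq_square)

lemma step_nonzero:
  assumes "step_disc m \<alpha> \<beta> \<epsilon> X0 X1 \<noteq> 0" "(Y0, Y1) \<noteq> (0, 0)"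
  shows "(step_num \<alpha> \<beta> \<epsilon> X0 X1 Y0 Y1, step_den m \<alpha> \<beta> \<epsilon> X0 X1 Y0 Y1) \<noteq> (0, 0)"
proof
  assume "(step_num \<alpha> \<beta> \<epsilon> X0 X1 Y0 Y1, step_den m \<alpha> \<beta> \<epsilon> X0 X1 Y0 Y1) = (0, 0)"
  then have "step_disc m \<alpha> \<beta> \<epsilon> X0 X1 * Y0 = 0" "step_disc m \<alpha> \<beta> \<epsilon> X0 X1 * Y1 = 0"
    using step_disc_combinations[where ?Y0.0 = Y0 and ?Y1.0 = Y1] by auto
  then show False using assms by simp
qed

text \<open>At a base point (Y0, Y1) lies in the kernel of the matrix, so the derivative of the
  determinant along (V0, V1) is governed by the image of (Y0, Y1) under the derivative of the
  matrix. A simple zero of the determinant thus makes numerator and denominator transversal.\<close>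

lemma step_jacobian:
  assumes "step_num \<alpha> \<beta> \<epsilon> X0 X1 Y0 Y1 = 0" "step_den m \<alpha> \<beta> \<epsilon> X0 X1 Y0 Y1 = 0"
  shows "d_step_num \<alpha> \<beta> \<epsilon> X0 X1 Y0 Y1 V0 V1 0 0 * step_den m \<alpha> \<beta> \<epsilon> X0 X1 W0 W1
       - step_num \<alpha> \<beta> \<epsilon> X0 X1 W0 W1 * d_step_den m \<alpha> \<beta> \<epsilon> X0 X1 Y0 Y1 V0 V1 0 0
     = d_step_disc m \<alpha> \<beta> \<epsilon> X0 X1 V0 V1 * (Y0 * W1 - Y1 * W0)"
proof -
  define p r r' where "p = \<alpha> * X0 * X1" and "r = \<beta> * X1^2 + \<epsilon> * X0^2" and "r' = m * \<beta> * X0^2 + \<epsilon> * X1^2"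
  define pv rv rv' where "pv = \<alpha> * (V0 * X1 + X0 * V1)" and "rv = 2 * (\<beta> * X1 * V1 + \<epsilon> * X0 * V0)"
    and "rv' = 2 * (m * \<beta> * X0 * V0 + \<epsilon> * X1 * V1)"
  have e: "p * Y0 = r * Y1" "r' * Y0 = p * Y1"
    using assms by (simp_all add: step_num_def step_den_def p_def r_def r'_def algebra_simps)
  have 1: "step_num \<alpha> \<beta> \<epsilon> X0 X1 W0 W1 = p * W0 - r * W1" "step_den m \<alpha> \<beta> \<epsilon> X0 X1 W0 W1 = r' * W0 - p * W1"
    by (simp_all add: step_num_def step_den_def p_def r_def r'_def algebra_simps)
  have 2: "d_step_num \<alpha> \<beta> \<epsilon> X0 X1 Y0 Y1 V0 V1 0 0 = pv * Y0 - rv * Y1"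
    "d_step_den m \<alpha> \<beta> \<epsilon> X0 X1 Y0 Y1 V0 V1 0 0 = rv' * Y0 - pv * Y1"
    by (simp_all add: d_step_num_def d_step_den_def step_num_def step_den_def pv_def rv_def rv'_def)
  have 3: "d_step_disc m \<alpha> \<beta> \<epsilon> X0 X1 V0 V1 = rv * r' + r * rv' - 2 * p * pv"
    by (simp add: d_step_disc_def p_def r_def r'_def pv_def rv_def rv'_def algebra_simps power2_eq_square)
  have "(pv * Y0 - rv * Y1) * (r' * W0 - p * W1) - (p * W0 - r * W1) * (rv' * Y0 - pv * Y1)
     = W0 * (pv * (r' * Y0) - rv * r' * Y1 - rv' * (p * Y0) + pv * p * Y1)
     + W1 * (- pv * p * Y0 + rv * (p * Y1) + rv' * r * Y0 - pv * (r * Y1))"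
    by (simp add: algebra_simps)
  also have "pv * (r' * Y0) - rv * r' * Y1 - rv' * (p * Y0) + pv * p * Y1 = - ((rv * r' + r * rv' - 2 * p * pv) * Y1)"
    unfolding e by (simp add: algebra_simps)
  also have "- pv * p * Y0 + rv * (p * Y1) + rv' * r * Y0 - pv * (r * Y1) = (rv * r' + r * rv' - 2 * p * pv) * Y0"
    unfolding e[symmetric] by (simp add: algebra_simps)
  also have "W0 * - ((rv * r' + r * rv' - 2 * p * pv) * Y1) + W1 * ((rv * r' + r * rv' - 2 * p * pv) * Y0) =
      (rv * r' + r * rv' - 2 * p * pv) * (Y0 * W1 - Y1 * W0)" by (simp add: algebra_simps)
  finally show ?thesis unfolding 1 2 3 .
qed

text \<open>Made for the second half-step, whose first argument moves with both local coordinates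
  and whose second argument moves with one. By Euler's relation the X-gradients of numerator and
  denominator both annihilate (X0, X1) at a common zero, hence are proportional, and the terms in
  U0, U1 drop out.\<close>

lemma step_jacobian_first:
  assumes 0: "step_num \<alpha> \<beta> \<epsilon> X0 X1 Y0 Y1 = 0" "step_den m \<alpha> \<beta> \<epsilon> X0 X1 Y0 Y1 = 0"
    and X: "(X0, X1) \<noteq> (0, 0)"
  shows "d_step_num \<alpha> \<beta> \<epsilon> X0 X1 Y0 Y1 U0 U1 V0 V1 * d_step_den m \<alpha> \<beta> \<epsilon> X0 X1 Y0 Y1 W0 W1 0 0
       - d_step_num \<alpha> \<beta> \<epsilon> X0 X1 Y0 Y1 W0 W1 0 0 * d_step_den m \<alpha> \<beta> \<epsilon> X0 X1 Y0 Y1 U0 U1 V0 V1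
     = - (d_step_disc m \<alpha> \<beta> \<epsilon> X0 X1 W0 W1 * (Y0 * V1 - Y1 * V0))"
proof -
  define l0 l1 where "l0 = \<alpha> * X1 * Y0 - 2 * \<epsilon> * X0 * Y1" and "l1 = \<alpha> * X0 * Y0 - 2 * \<beta> * X1 * Y1"
  define n0 n1 where "n0 = 2 * m * \<beta> * X0 * Y0 - \<alpha> * X1 * Y1" and "n1 = 2 * \<epsilon> * X1 * Y0 - \<alpha> * X0 * Y1"
  have N: "d_step_num \<alpha> \<beta> \<epsilon> X0 X1 Y0 Y1 Z0 Z1 V0 V1 = l0 * Z0 + l1 * Z1 + step_num \<alpha> \<beta> \<epsilon> X0 X1 V0 V1"
    and D: "d_step_den m \<alpha> \<beta> \<epsilon> X0 X1 Y0 Y1 Z0 Z1 V0 V1 = n0 * Z0 + n1 * Z1 + step_den m \<alpha> \<beta> \<epsilon> X0 X1 V0 V1" for Z0 Z1 V0 V1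
    by (simp_all add: d_step_num_def d_step_den_def l0_def l1_def n0_def n1_def algebra_simps)
  have s0: "step_num \<alpha> \<beta> \<epsilon> X0 X1 0 0 = 0" "step_den m \<alpha> \<beta> \<epsilon> X0 X1 0 0 = 0"
    by (simp_all add: step_num_def step_den_def)
  have "l0 * X0 + l1 * X1 = 2 * step_num \<alpha> \<beta> \<epsilon> X0 X1 Y0 Y1" "n0 * X0 + n1 * X1 = 2 * step_den m \<alpha> \<beta> \<epsilon> X0 X1 Y0 Y1"
    by (simp_all add: l0_def l1_def n0_def n1_def step_num_def step_den_def algebra_simps power2_eq_square)
  then have e: "l0 * X0 = - (l1 * X1)" "n0 * X0 = - (n1 * X1)" using 0 by (simp_all add: eq_neg_iff_add_eq_0)
  then have e': "l1 * X1 = - (l0 * X0)" "n1 * X1 = - (n0 * X0)" by simp_all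
  have "(l0 * n1 - l1 * n0) * X0 = (l0 * X0) * n1 - l1 * (n0 * X0)" by (simp add: algebra_simps)
  also have "\<dots> = 0" unfolding e by simp
  finally have "(l0 * n1 - l1 * n0) * X0 = 0" .
  moreover have "(l0 * n1 - l1 * n0) * X1 = l0 * (n1 * X1) - (l1 * X1) * n0" by (simp add: algebra_simps)
  then have "(l0 * n1 - l1 * n0) * X1 = 0" unfolding e' by simp
  ultimately have z: "l0 * n1 - l1 * n0 = 0" using X by auto
  have "(l0 * U0 + l1 * U1) * (n0 * W0 + n1 * W1) - (l0 * W0 + l1 * W1) * (n0 * U0 + n1 * U1) =
     (l0 * n1 - l1 * n0) * (U0 * W1 - U1 * W0)" by (simp add: algebra_simps)
  then have "(l0 * U0 + l1 * U1) * (n0 * W0 + n1 * W1) - (l0 * W0 + l1 * W1) * (n0 * U0 + n1 * U1) = 0"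
    unfolding z by simp
  moreover have "(l0 * W0 + l1 * W1) * step_den m \<alpha> \<beta> \<epsilon> X0 X1 V0 V1 - step_num \<alpha> \<beta> \<epsilon> X0 X1 V0 V1 * (n0 * W0 + n1 * W1)
     = d_step_disc m \<alpha> \<beta> \<epsilon> X0 X1 W0 W1 * (Y0 * V1 - Y1 * V0)"
    using step_jacobian[OF 0, of W0 W1 V0 V1] unfolding N D s0 by simp
  ultimately show ?thesis unfolding N D s0 by (simp add: algebra_simps)
qed

text \<open>\<alpha>, \<beta>, \<epsilon> abstract the three coefficients of a half-step;
  \<open>num0\<close> and \<open>den0\<close> say that (x, y) is a base point. From here on the
  elliptic functions disappear.\<close>

locale step_map =
  fixes k \<alpha> \<beta> \<epsilon> x y :: complex
  assumes k: "k \<noteq> 0" and be: "\<beta> \<noteq> 0" "\<epsilon> \<noteq> 0" and x: "x \<noteq> 0" "1 - k^2 * x^4 \<noteq> 0"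
    and num0: "\<beta> + \<epsilon> * x^2 = \<alpha> * x * y" and den0: "(k^2 * \<beta> * x^2 + \<epsilon>) * y = \<alpha> * x"
begin

abbreviation "num \<equiv> step_num \<alpha> \<beta> \<epsilon>"
abbreviation "den \<equiv> step_den (k^2) \<alpha> \<beta> \<epsilon>"
abbreviation "disc \<equiv> step_disc (k^2) \<alpha> \<beta> \<epsilon>"
abbreviation "d_disc \<equiv> d_step_disc (k^2) \<alpha> \<beta> \<epsilon>"

lemma alpha_square: "\<alpha>^2 * x^2 = (\<beta> + \<epsilon> * x^2) * (k^2 * \<beta> * x^2 + \<epsilon>)"
proof -
  have "(\<beta> + \<epsilon> * x^2) * (k^2 * \<beta> * x^2 + \<epsilon>) = \<alpha> * x * ((k^2 * \<beta> * x^2 + \<epsilon>) * y)"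
    unfolding num0 by (simp add: mult_ac)
  then show ?thesis unfolding den0 by (simp add: power2_eq_square)
qed

text \<open>\<open>alpha_square\<close> eliminates \<alpha>; what remains is even in X and splits
  with the zeros \<plusminus> x and \<plusminus> 1/(k x).\<close>

lemma disc_factor: "x^2 * disc X0 X1 = \<beta> * \<epsilon> * (X0^2 - x^2 * X1^2) * (k^2 * x^2 * X0^2 - X1^2)"
proof -
  have "x^2 * disc X0 X1 = x^2 * ((\<beta> * X1^2 + \<epsilon> * X0^2) * (k^2 * \<beta> * X0^2 + \<epsilon> * X1^2)) - (\<alpha>^2 * x^2) * (X0^2 * X1^2)"
    by (simp add: step_disc_def algebra_simps power_mult_distrib)
  then show ?thesis unfolding alpha_square by (simp add: algebra_simps)
qed

lemma d_disc_factor: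
  "x^2 * d_disc X0 X1 V0 V1 = 2 * \<beta> * \<epsilon> * ((X0 * V0 - x^2 * X1 * V1) * (k^2 * x^2 * X0^2 - X1^2)
      + (X0^2 - x^2 * X1^2) * (k^2 * x^2 * X0 * V0 - X1 * V1))"
proof -
  have "x^2 * d_disc X0 X1 V0 V1 = x^2 * (2 * (\<beta> * X1 * V1 + \<epsilon> * X0 * V0) * (k^2 * \<beta> * X0^2 + \<epsilon> * X1^2)
     + 2 * (\<beta> * X1^2 + \<epsilon> * X0^2) * (k^2 * \<beta> * X0 * V0 + \<epsilon> * X1 * V1))
     - 2 * (\<alpha>^2 * x^2) * X0 * X1 * (X0 * V1 + X1 * V0)"
    by (simp add: d_step_disc_def algebra_simps)
  then show ?thesis unfolding alpha_square by (simp add: algebra_simps power2_eq_square)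
qed

text \<open>This coefficient makes Y unique at a zero of the determinant. If it vanished, so would
  \<beta> + \<epsilon> x^2, and then \<beta> (1 - k^2 x^4).\<close>

lemma coeff_nonzero: "k^2 * \<beta> * x^2 + \<epsilon> \<noteq> 0"
proof
  assume 0: "k^2 * \<beta> * x^2 + \<epsilon> = 0"
  then have "\<alpha> = 0" using den0 x by auto
  then have "\<beta> + \<epsilon> * x^2 = 0" using num0 by simp
  moreover have "\<epsilon> = - (k^2 * \<beta> * x^2)" using 0 by (simp add: eq_neg_iff_add_eq_0 add.commute)
  ultimately have "\<beta> * (1 - k^2 * x^4) = 0" by (simp add: algebra_simps power2_eq_square power4_eq_xxxx)
  then show False using be x by simp
qed

lemma disc_zero_cases:
  assumes "disc X0 X1 = 0"
  obtains e where "e^2 = 1" "X0 = e * x * X1" | e where "e^2 = 1" "X1 = e * k * x * X0"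
proof -
  have "X0^2 = (x * X1)^2 \<or> X1^2 = (k * x * X0)^2"
    using disc_factor[of X0 X1] assms be by (auto simp: power_mult_distrib)
  then have "(X0 = 1 * x * X1 \<or> X0 = (-1) * x * X1) \<or> (X1 = 1 * k * x * X0 \<or> X1 = (-1) * k * x * X0)"
    by (simp add: power2_eq_iff)
  then show thesis using that[of 1] that[of "-1"] by auto
qed

text \<open>A common zero needs a vanishing determinant, which fixes X up to four choices; the
  kernel is then one-dimensional and fixes Y. The second alternative is the point (e/(k x), e/(k
  y)), in homogeneous form so that y = 0 is included.\<close>

lemma base_point_iff:
  assumes X: "(X0, X1) \<noteq> (0, 0)" and Y: "(Y0, Y1) \<noteq> (0, 0)"
  shows "num X0 X1 Y0 Y1 = 0 \<and> den X0 X1 Y0 Y1 = 0 \<longleftrightarrow>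
    (\<exists>e. e^2 = 1 \<and> (X0 = e * x * X1 \<and> Y0 = e * y * Y1 \<or> X1 = e * k * x * X0 \<and> Y1 = e * k * y * Y0))"
    (is "?L \<longleftrightarrow> ?R")
proof
  assume L: ?L
  have d0: "disc X0 X1 = 0" using step_nonzero[of "k^2" \<alpha> \<beta> \<epsilon> X0 X1 Y0 Y1] L Y by auto
  then show ?R
  proof (cases rule: disc_zero_cases)
    case (1 e)
    have e: "e * e = 1" using 1 by (simp add: power2_eq_square)
    have X1: "X1 \<noteq> 0" using 1 X by auto
    have "den X0 X1 Y0 Y1 = X1^2 * ((k^2 * \<beta> * ((e * e) * x^2) + \<epsilon>) * Y0 - (\<alpha> * x) * e * Y1)"
      unfolding 1 by (simp add: step_den_def algebra_simps power2_eq_square)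
    also have "\<dots> = X1^2 * ((k^2 * \<beta> * x^2 + \<epsilon>) * (Y0 - e * y * Y1))"
      unfolding e den0[symmetric] by (simp add: algebra_simps)
    finally have "Y0 - e * y * Y1 = 0" using L X1 coeff_nonzero by simp
    then show ?R using 1 by auto
  next
    case (2 e)
    have e: "e * e = 1" using 2 by (simp add: power2_eq_square)
    have X0: "X0 \<noteq> 0" using 2 X by auto
    have "num X0 X1 Y0 Y1 = X0^2 * ((\<alpha> * x) * e * k * Y0 - (k^2 * \<beta> * ((e * e) * x^2) + \<epsilon>) * Y1)"
      unfolding 2 by (simp add: step_num_def algebra_simps power2_eq_square)
    also have "\<dots> = X0^2 * ((k^2 * \<beta> * x^2 + \<epsilon>) * (e * k * y * Y0 - Y1))"
      unfolding e den0[symmetric] by (simp add: algebra_simps)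
    finally have "e * k * y * Y0 - Y1 = 0" using L X0 coeff_nonzero by simp
    then show ?R using 2 by auto
  qed
next
  assume ?R
  then obtain e where e: "e * e = 1"
    and c: "X0 = e * x * X1 \<and> Y0 = e * y * Y1 \<or> X1 = e * k * x * X0 \<and> Y1 = e * k * y * Y0"
    by (auto simp: power2_eq_square)
  from c show ?L
  proof
    assume c: "X0 = e * x * X1 \<and> Y0 = e * y * Y1"
    have "num (e * x * X1) X1 (e * y * Y1) Y1 = X1^2 * Y1 * ((e * e) * (\<alpha> * x * y) - \<beta> - \<epsilon> * ((e * e) * x^2))"
      by (simp add: step_num_def algebra_simps power2_eq_square)
    moreover have "den (e * x * X1) X1 (e * y * Y1) Y1 = e * X1^2 * Y1 * ((k^2 * \<beta> * ((e * e) * x^2) + \<epsilon>) * y - \<alpha> * x)"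
      by (simp add: step_den_def algebra_simps power2_eq_square)
    ultimately show ?L using c unfolding e num0[symmetric] by (simp add: den0)
  next
    assume c: "X1 = e * k * x * X0 \<and> Y1 = e * k * y * Y0"
    have "num X0 (e * k * x * X0) Y0 (e * k * y * Y0) = e * k * X0^2 * Y0 * (\<alpha> * x - (k^2 * \<beta> * ((e * e) * x^2) + \<epsilon>) * y)"
      by (simp add: step_num_def algebra_simps power2_eq_square)
    moreover have "den X0 (e * k * x * X0) Y0 (e * k * y * Y0) = k^2 * X0^2 * Y0 * (\<beta> - (e * e) * (\<alpha> * x * y) + \<epsilon> * ((e * e) * x^2))"
      by (simp add: step_den_def algebra_simps power2_eq_square)
    ultimately show ?L using c unfolding e num0[symmetric] by (simp add: den0)
  qed
qed

text \<open>The four zeros are simple, since two of them coincide only for x = 0 or k^2 x^4 = 1. The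
  direction must be independent of (X0, X1), because moving along (X0, X1) does not move the
  projective point.\<close>

lemma d_disc_nonzero:
  assumes "disc X0 X1 = 0" "X0 * V1 - X1 * V0 \<noteq> 0"
  shows "d_disc X0 X1 V0 V1 \<noteq> 0"
  using assms(1)
proof (cases rule: disc_zero_cases)
  case (1 e)
  have e: "e * e = 1" using 1 by (simp add: power2_eq_square)
  have "x^2 * d_disc X0 X1 V0 V1 = 2 * \<beta> * \<epsilon> * (x * X1 * (e * V0 - x * V1) * (X1^2 * ((e * e) * k^2 * x^4 - 1))
     + (((e * e) - 1) * (x^2 * X1^2)) * (k^2 * x^2 * X0 * V0 - X1 * V1))"
    unfolding d_disc_factor unfolding 1 by (simp add: algebra_simps power2_eq_square power4_eq_xxxx)
  also have "\<dots> = 2 * \<beta> * \<epsilon> * (x * X1 * (e * V0 - x * V1) * (X1^2 * (k^2 * x^4 - 1)))"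
    unfolding e by simp
  finally have f: "x^2 * d_disc X0 X1 V0 V1 = 2 * \<beta> * \<epsilon> * (x * X1 * (e * V0 - x * V1) * (X1^2 * (k^2 * x^4 - 1)))" .
  have "X0 * V1 - X1 * V0 = - e * X1 * (e * V0 - (e * e) * x * V1) + X1 * V0 * (e * e - 1) + ((e * e - 1) * (- e) * x * X1 * V1)"
    unfolding 1 by (simp add: algebra_simps)
  then have "X0 * V1 - X1 * V0 = - e * X1 * (e * V0 - x * V1)" unfolding e by simp
  then have "X1 \<noteq> 0" "e * V0 - x * V1 \<noteq> 0" using assms(2) by auto
  then show ?thesis using f be x by auto
next
  case (2 e)
  have e: "e * e = 1" using 2 by (simp add: power2_eq_square)
  have "x^2 * d_disc X0 X1 V0 V1 = 2 * \<beta> * \<epsilon> * ((X0 * V0 - x^2 * X1 * V1) * ((1 - e * e) * (k^2 * x^2 * X0^2))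
     + (X0^2 * (1 - (e * e) * k^2 * x^4)) * (k * x * X0 * (k * x * V0 - e * V1)))"
    unfolding d_disc_factor unfolding 2 by (simp add: algebra_simps power2_eq_square power4_eq_xxxx)
  also have "\<dots> = 2 * \<beta> * \<epsilon> * ((X0^2 * (1 - k^2 * x^4)) * (k * x * X0 * (k * x * V0 - e * V1)))"
    unfolding e by simp
  finally have f: "x^2 * d_disc X0 X1 V0 V1 = 2 * \<beta> * \<epsilon> * ((X0^2 * (1 - k^2 * x^4)) * (k * x * X0 * (k * x * V0 - e * V1)))" .
  have "X0 * V1 - X1 * V0 = - e * X0 * (k * x * V0 - e * V1) + (1 - e * e) * X0 * V1"
    unfolding 2 by (simp add: algebra_simps)
  then have "X0 * V1 - X1 * V0 = - e * X0 * (k * x * V0 - e * V1)" unfolding e by simp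
  then have "X0 \<noteq> 0" "k * x * V0 - e * V1 \<noteq> 0" using assms(2) by auto
  then show ?thesis using f be x k by auto
qed

text \<open>Where the determinant is nonzero, the half-step is a bijection in Y, so the preimage of
  (a : b) is the known (Z0 : Z1).\<close>

lemma step_injective:
  assumes d: "disc X0 X1 \<noteq> 0" and ab: "(a, b) \<noteq> (0, 0)" and Z: "(Z0, Z1) \<noteq> (0, 0)" and Y: "(Y0, Y1) \<noteq> (0, 0)"
    and z: "num X0 X1 Z0 Z1 * b = den X0 X1 Z0 Z1 * a"
  shows "num X0 X1 Y0 Y1 * b = den X0 X1 Y0 Y1 * a \<longleftrightarrow> Y0 * Z1 = Y1 * Z0"
proof -
  have w: "num X0 X1 Y0 Y1 * den X0 X1 Z0 Z1 - den X0 X1 Y0 Y1 * num X0 X1 Z0 Z1 = disc X0 X1 * (Y0 * Z1 - Y1 * Z0)"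
    by (rule step_wronskian)
  have nz: "(num X0 X1 Z0 Z1, den X0 X1 Z0 Z1) \<noteq> (0, 0)" using step_nonzero[OF d Z] .
  obtain l where l: "l \<noteq> 0" "num X0 X1 Z0 Z1 = l * a" "den X0 X1 Z0 Z1 = l * b"
  proof (cases "b = 0")
    case True
    then have "a \<noteq> 0" using ab by auto
    then have "den X0 X1 Z0 Z1 = 0" using z True by simp
    then show thesis using that[of "num X0 X1 Z0 Z1 / a"] True \<open>a \<noteq> 0\<close> nz by auto
  next
    case False
    have n: "num X0 X1 Z0 Z1 = den X0 X1 Z0 Z1 / b * a" using z False by (simp add: field_simps)
    then have "den X0 X1 Z0 Z1 \<noteq> 0" using nz by auto
    then show thesis using that[of "den X0 X1 Z0 Z1 / b"] False n by auto
  qed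
  have "l * (num X0 X1 Y0 Y1 * b - den X0 X1 Y0 Y1 * a) = disc X0 X1 * (Y0 * Z1 - Y1 * Z0)"
    using w unfolding l by (simp add: algebra_simps)
  then show ?thesis using l d by (metis mult_eq_0_iff right_minus_eq)
qed

end

definition P1_step :: "complex \<Rightarrow> complex \<Rightarrow> complex \<Rightarrow> complex \<Rightarrow> P1 \<Rightarrow> P1 \<Rightarrow> P1 option" where
  "P1_step k \<alpha> \<beta> \<epsilon> X Y =
     P1_quotient (step_num \<alpha> \<beta> \<epsilon> (fst (hom_coords X)) (snd (hom_coords X)) (fst (hom_coords Y)) (snd (hom_coords Y)))
                 (step_den (k^2) \<alpha> \<beta> \<epsilon> (fst (hom_coords X)) (snd (hom_coords X)) (fst (hom_coords Y)) (snd (hom_coords Y)))"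

lemma half_step_eq_P1_step:
  "half_step k (s, c, d) (S, C, D) =
     P1_step k ((1 - k^2 * s^4) * C * D) ((C^2 - c^2) * c * d) ((1 - k^2 * S^2 * s^2) * c * d)"
  by (intro ext)
     (simp add: half_step_def P1_step_def half_step_num_def half_step_den_def step_num_def step_den_def case_prod_beta mult.assoc)

lemma step_scale:
  "step_num \<alpha> \<beta> \<epsilon> (l * X0) (l * X1) (l' * Y0) (l' * Y1) = (l^2 * l') * step_num \<alpha> \<beta> \<epsilon> X0 X1 Y0 Y1"
  "step_den m \<alpha> \<beta> \<epsilon> (l * X0) (l * X1) (l' * Y0) (l' * Y1) = (l^2 * l') * step_den m \<alpha> \<beta> \<epsilon> X0 X1 Y0 Y1"
  by (simp_all add: step_num_def step_den_def algebra_simps power2_eq_square)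

lemma P1_step_ratio:
  assumes "(X0, X1) \<noteq> (0, 0)" "(Y0, Y1) \<noteq> (0, 0)"
  shows "P1_step k \<alpha> \<beta> \<epsilon> (P1_of_ratio X0 X1) (P1_of_ratio Y0 Y1) =
    P1_quotient (step_num \<alpha> \<beta> \<epsilon> X0 X1 Y0 Y1) (step_den (k^2) \<alpha> \<beta> \<epsilon> X0 X1 Y0 Y1)"
proof -
  obtain l where l: "l \<noteq> 0" "hom_coords (P1_of_ratio X0 X1) = (l * X0, l * X1)"
    using hom_coords_P1_of_ratio[OF assms(1)] .
  obtain l' where l': "l' \<noteq> 0" "hom_coords (P1_of_ratio Y0 Y1) = (l' * Y0, l' * Y1)"
    using hom_coords_P1_of_ratio[OF assms(2)] .
  show ?thesis unfolding P1_step_def l l' fst_conv snd_conv step_scale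
    using l l' by (intro P1_quotient_scale) simp
qed

section \<open>The composition of two half-steps and its base points\<close>

definition two_step :: "(P1 \<Rightarrow> P1 \<Rightarrow> P1 option) \<Rightarrow> (P1 \<Rightarrow> P1 \<Rightarrow> P1 option) \<Rightarrow> P1xP1 \<Rightarrow> P1xP1 option" where
  "two_step H1 H2 = (\<lambda>(f, g). case H1 f g of None \<Rightarrow> None
     | Some g' \<Rightarrow> (case H2 g' f of None \<Rightarrow> None | Some f' \<Rightarrow> Some (f', g')))"

text \<open>The second half-step has arguments g' and f in this order, so its base point is (h, t).
  \<open>transport\<close> says that the first half-step sends (t, q) to h; \<open>xt\<close> keeps
  the f-coordinates \<plusminus> t, \<plusminus> 1/(k t) off the zeros of the first
  determinant.\<close>

locale two_step_map =
  first: step_map k \<alpha> \<beta> \<epsilon> x y + second: step_map k \<alpha>' \<beta>' \<epsilon>' h t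
  for k \<alpha> \<beta> \<epsilon> x y \<alpha>' \<beta>' \<epsilon>' h t :: complex +
  fixes q :: complex
  assumes transport: "step_num \<alpha> \<beta> \<epsilon> t 1 q 1 = h * step_den (k^2) \<alpha> \<beta> \<epsilon> t 1 q 1"
    and xt: "x^2 \<noteq> t^2" "k^2 * x^2 * t^2 \<noteq> 1"
begin

definition "H1 = P1_step k \<alpha> \<beta> \<epsilon>"
definition "H2 = P1_step k \<alpha>' \<beta>' \<epsilon>'"
definition "\<Phi> = two_step H1 H2"

lemma first_disc_nonzero:
  assumes "e^2 = 1"
  shows "l \<noteq> 0 \<Longrightarrow> first.disc (e * t * l) l \<noteq> 0" "l \<noteq> 0 \<Longrightarrow> first.disc l (e * k * t * l) \<noteq> 0"
proof -
  have "x^2 * first.disc (e * t * l) l = \<beta> * \<epsilon> * (l^2 * l^2) * (e^2 * t^2 - x^2) * (k^2 * x^2 * t^2 * e^2 - 1)"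
    unfolding first.disc_factor by (simp add: algebra_simps power_mult_distrib)
  then show "l \<noteq> 0 \<Longrightarrow> first.disc (e * t * l) l \<noteq> 0"
    using xt first.be first.x unfolding assms by auto
  have "x^2 * first.disc l (e * k * t * l) = \<beta> * \<epsilon> * (l^2 * l^2 * k^2) * (1 - k^2 * x^2 * t^2 * e^2) * (x^2 - e^2 * t^2)"
    unfolding first.disc_factor by (simp add: algebra_simps power_mult_distrib)
  then show "l \<noteq> 0 \<Longrightarrow> first.disc l (e * k * t * l) \<noteq> 0"
    using xt first.be first.x first.k unfolding assms by auto
qed

text \<open>A half-step is compatible with changing all signs and with replacing every variable u by
  1/(k u), so \<open>transport\<close> carries over from (t, q) to its other three images.\<close>

lemma first_transport:
  assumes e: "e^2 = 1"
  shows "first.num (e * t) 1 (e * q) 1 * 1 = first.den (e * t) 1 (e * q) 1 * (e * h)"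
    and "first.num e (k * t) e (k * q) * (k * h) = first.den e (k * t) e (k * q) * e"
proof -
  have ee: "e * e = 1" using e by (simp add: power2_eq_square)
  have 1: "first.num (e * t) 1 (e * q) 1 = (e * e) * (\<alpha> * t * q) - \<beta> - (e * e) * (\<epsilon> * t^2)"
    "first.den (e * t) 1 (e * q) 1 = e * ((e * e) * (k^2 * \<beta> * t^2 * q) - \<alpha> * t + \<epsilon> * q)"
    by (simp_all add: step_num_def step_den_def algebra_simps power2_eq_square)
  have 2: "first.num e (k * t) e (k * q) = - (k * ((e * e) * (\<epsilon> * q) - (e * e) * (\<alpha> * t) + k^2 * \<beta> * t^2 * q))"
    "first.den e (k * t) e (k * q) = - (k^2 * e * (\<alpha> * t * q - (e * e) * \<beta> - \<epsilon> * t^2))"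
    by (simp_all add: step_num_def step_den_def algebra_simps power2_eq_square)
  have 3: "\<alpha> * t * q - \<beta> - \<epsilon> * t^2 = h * (k^2 * \<beta> * t^2 * q - \<alpha> * t + \<epsilon> * q)"
    using transport by (simp add: step_num_def step_den_def)
  have "e * (k^2 * \<beta> * t^2 * q - \<alpha> * t + \<epsilon> * q) * (e * h) = (e * e) * (h * (k^2 * \<beta> * t^2 * q - \<alpha> * t + \<epsilon> * q))"
    by (simp add: mult_ac)
  then show "first.num (e * t) 1 (e * q) 1 * 1 = first.den (e * t) 1 (e * q) 1 * (e * h)"
    unfolding 1 ee using 3 ee by simp
  have "- (k * (\<epsilon> * q - \<alpha> * t + k^2 * \<beta> * t^2 * q)) * (k * h) = - (k^2) * (h * (k^2 * \<beta> * t^2 * q - \<alpha> * t + \<epsilon> * q))"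
    by (simp add: algebra_simps power2_eq_square)
  also have "\<dots> = - (k^2) * ((e * e) * (\<alpha> * t * q - \<beta> - \<epsilon> * t^2))"
    unfolding 3 ee by simp
  also have "\<dots> = - (k^2 * e * (\<alpha> * t * q - \<beta> - \<epsilon> * t^2)) * e"
    by (simp only: mult_minus_left mult_minus_right mult_ac)
  finally show "first.num e (k * t) e (k * q) * (k * h) = first.den e (k * t) e (k * q) * e"
    unfolding 2 ee by simp
qed

text \<open>e/(k a) is written as the ratio of e to k a, so that a = 0 yields
  \<open>Infty\<close>.\<close>

definition base_set :: "P1xP1 set" where
  "base_set = (\<Union>e\<in>{1, -1}. {(P1_of_ratio (e * x) 1, P1_of_ratio (e * y) 1), (P1_of_ratio e (k * x), P1_of_ratio e (k * y)),
      (P1_of_ratio (e * t) 1, P1_of_ratio (e * q) 1), (P1_of_ratio e (k * t), P1_of_ratio e (k * q))})"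

lemma square_one_iff: "e^2 = 1 \<longleftrightarrow> e \<in> {1, -1}" for e :: complex
  by (auto simp: power2_eq_1_iff)

lemma pm_swap: "e^2 = 1 \<Longrightarrow> a = e * b \<longleftrightarrow> b = e * a" for a b e :: complex
  unfolding square_one_iff by auto

lemma first_undefined_iff:
  assumes X: "(X0, X1) \<noteq> (0, 0)" and Y: "(Y0, Y1) \<noteq> (0, 0)"
  shows "H1 (P1_of_ratio X0 X1) (P1_of_ratio Y0 Y1) = None \<longleftrightarrow>
    (\<exists>e. e^2 = 1 \<and> (X0 = e * x * X1 \<and> Y0 = e * y * Y1 \<or> X1 = e * k * x * X0 \<and> Y1 = e * k * y * Y0))"
  unfolding H1_def P1_step_ratio[OF X Y] first.base_point_iff[OF X Y, symmetric] by (simp add: P1_quotient_def)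

lemma second_undefined_iff:
  assumes X: "(X0, X1) \<noteq> (0, 0)" and Y: "(Y0, Y1) \<noteq> (0, 0)"
  shows "H2 (P1_of_ratio X0 X1) (P1_of_ratio Y0 Y1) = None \<longleftrightarrow>
    (\<exists>e. e^2 = 1 \<and> (X0 = e * h * X1 \<and> Y0 = e * t * Y1 \<or> X1 = e * k * h * X0 \<and> Y1 = e * k * t * Y0))"
  unfolding H2_def P1_step_ratio[OF X Y] second.base_point_iff[OF X Y, symmetric] by (simp add: P1_quotient_def)

lemma first_value:
  assumes "(X0, X1) \<noteq> (0, 0)" "(Y0, Y1) \<noteq> (0, 0)" "(first.num X0 X1 Y0 Y1, first.den X0 X1 Y0 Y1) \<noteq> (0, 0)"
  shows "H1 (P1_of_ratio X0 X1) (P1_of_ratio Y0 Y1) = Some (P1_of_ratio (first.num X0 X1 Y0 Y1) (first.den X0 X1 Y0 Y1))"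
  unfolding H1_def P1_step_ratio[OF assms(1,2)] P1_quotient_def using assms(3) by auto

text \<open>If the first half-step is defined, the second can fail only for f = \<plusminus> t or
  \<plusminus> 1/(k t). There the first half-step is a bijection in g, so the only preimage of the
  bad value of g' is the one given by \<open>first_transport\<close>.\<close>

lemma Phi_undefined_iff:
  assumes X: "(X0, X1) \<noteq> (0, 0)" and Y: "(Y0, Y1) \<noteq> (0, 0)"
  shows "\<Phi> (P1_of_ratio X0 X1, P1_of_ratio Y0 Y1) = None \<longleftrightarrow>
    (\<exists>e. e^2 = 1 \<and> (X0 = e * x * X1 \<and> Y0 = e * y * Y1 \<or> X1 = e * k * x * X0 \<and> Y1 = e * k * y * Y0
       \<or> X0 = e * t * X1 \<and> Y0 = e * q * Y1 \<or> X1 = e * k * t * X0 \<and> Y1 = e * k * q * Y0))"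
    (is "_ \<longleftrightarrow> ?R")
proof -
  define n d where "n = first.num X0 X1 Y0 Y1" and "d = first.den X0 X1 Y0 Y1"
  have t1: "n = e * h * d \<longleftrightarrow> Y0 = e * q * Y1" if e: "e^2 = 1" and X0: "X0 = e * t * X1" for e
  proof -
    have X1: "X1 \<noteq> 0" using X X0 by auto
    have disc: "first.disc X0 X1 \<noteq> 0" unfolding X0 using first_disc_nonzero(1)[OF e X1] .
    have "first.num X0 X1 (e * q) 1 * 1 = first.den X0 X1 (e * q) 1 * (e * h)"
      using first_transport(1)[OF e] step_scale(1)[of \<alpha> \<beta> \<epsilon> X1 "e * t" 1 1 "e * q" 1]
        step_scale(2)[of "k^2" \<alpha> \<beta> \<epsilon> X1 "e * t" 1 1 "e * q" 1] by (simp add: X0 mult_ac)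
    from first.step_injective[OF disc _ _ Y this]
    have "n * 1 = d * (e * h) \<longleftrightarrow> Y0 * 1 = Y1 * (e * q)" by (simp add: n_def d_def)
    then show "n = e * h * d \<longleftrightarrow> Y0 = e * q * Y1" by (simp add: mult_ac)
  qed
  have t2: "d = e * k * h * n \<longleftrightarrow> Y1 = e * k * q * Y0" if e: "e^2 = 1" and X1: "X1 = e * k * t * X0" for e
  proof -
    have X0: "X0 \<noteq> 0" using X X1 by auto
    have e0: "e \<noteq> 0" using e by auto
    have disc: "first.disc X0 X1 \<noteq> 0" unfolding X1 using first_disc_nonzero(2)[OF e X0] .
    have "e * e = 1" using e by (simp add: power2_eq_square)
    then have sc: "X0 = (e * X0) * e" "X1 = (e * X0) * (k * t)" using X1 by (simp_all add: mult_ac)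
    have "first.num X0 X1 e (k * q) * (k * h) = first.den X0 X1 e (k * q) * e"
      using first_transport(2)[OF e] step_scale(1)[of \<alpha> \<beta> \<epsilon> "e * X0" e "k * t" 1 e "k * q", folded sc]
        step_scale(2)[of "k^2" \<alpha> \<beta> \<epsilon> "e * X0" e "k * t" 1 e "k * q", folded sc] by simp
    from first.step_injective[OF disc _ _ Y this]
    have "n * (k * h) = d * e \<longleftrightarrow> Y0 * (k * q) = Y1 * e" using e0 by (simp add: n_def d_def)
    then show "d = e * k * h * n \<longleftrightarrow> Y1 = e * k * q * Y0"
      using pm_swap[OF e, of d "k * h * n"] pm_swap[OF e, of Y1 "k * q * Y0"] by (simp add: mult_ac eq_commute)
  qed
  show ?thesis
  proof (cases "(n, d) = (0, 0)")
    case True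
    then have "H1 (P1_of_ratio X0 X1) (P1_of_ratio Y0 Y1) = None"
      unfolding H1_def P1_step_ratio[OF X Y] by (simp add: P1_quotient_def n_def d_def)
    then show ?thesis using first_undefined_iff[OF X Y] by (auto simp: \<Phi>_def two_step_def)
  next
    case False
    then have v: "H1 (P1_of_ratio X0 X1) (P1_of_ratio Y0 Y1) = Some (P1_of_ratio n d)"
      using first_value[OF X Y] by (simp add: n_def d_def)
    then have "\<Phi> (P1_of_ratio X0 X1, P1_of_ratio Y0 Y1) = None \<longleftrightarrow> H2 (P1_of_ratio n d) (P1_of_ratio X0 X1) = None"
      by (auto simp: \<Phi>_def two_step_def split: option.splits)
    also have "\<dots> \<longleftrightarrow> (\<exists>e. e^2 = 1 \<and> (n = e * h * d \<and> X0 = e * t * X1 \<or> d = e * k * h * n \<and> X1 = e * k * t * X0))"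
      by (rule second_undefined_iff[OF False X])
    also have "\<dots> \<longleftrightarrow> (\<exists>e. e^2 = 1 \<and> (X0 = e * t * X1 \<and> Y0 = e * q * Y1 \<or> X1 = e * k * t * X0 \<and> Y1 = e * k * q * Y0))"
      using t1 t2 by blast
    also have "\<dots> \<longleftrightarrow> ?R"
      using v first_undefined_iff[OF X Y] by auto
    finally show ?thesis .
  qed
qed

lemma base_points_Phi: "base_points \<Phi> = base_set"
proof -
  have "(P, Q) \<in> base_points \<Phi> \<longleftrightarrow> (P, Q) \<in> base_set" for P Q
  proof -
    define X0 X1 Y0 Y1 where "X0 = fst (hom_coords P)" and "X1 = snd (hom_coords P)"
      and "Y0 = fst (hom_coords Q)" and "Y1 = snd (hom_coords Q)"
    have nz: "(X0, X1) \<noteq> (0, 0)" "(Y0, Y1) \<noteq> (0, 0)" and P: "P = P1_of_ratio X0 X1" and Q: "Q = P1_of_ratio Y0 Y1"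
      using hom_coords_nonzero[of P] hom_coords_nonzero[of Q]
      by (simp_all add: X0_def X1_def Y0_def Y1_def P1_of_ratio_hom_coords)
    have aff: "P1_of_ratio Z0 Z1 = P1_of_ratio (e * a) 1 \<longleftrightarrow> Z0 = e * a * Z1" if "(Z0, Z1) \<noteq> (0, 0)" for Z0 Z1 e a
      using P1_of_ratio_eq_iff[OF that, of "e * a" 1] by (simp add: mult_ac)
    have inv: "P1_of_ratio Z0 Z1 = P1_of_ratio e (k * a) \<longleftrightarrow> Z1 = e * k * a * Z0" if "(Z0, Z1) \<noteq> (0, 0)" "e^2 = 1" for Z0 Z1 e a
    proof -
      have "(e, k * a) \<noteq> (0, 0)" using that(2) by auto
      then have "P1_of_ratio Z0 Z1 = P1_of_ratio e (k * a) \<longleftrightarrow> Z0 * (k * a) = Z1 * e"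
        using P1_of_ratio_eq_iff[OF that(1)] by blast
      then show ?thesis using pm_swap[OF that(2), of Z1 "k * a * Z0"] by (simp add: mult_ac eq_commute)
    qed
    have "(P, Q) \<in> base_set \<longleftrightarrow> (\<exists>e. e \<in> {1, -1} \<and>
       (P = P1_of_ratio (e * x) 1 \<and> Q = P1_of_ratio (e * y) 1 \<or> P = P1_of_ratio e (k * x) \<and> Q = P1_of_ratio e (k * y)
       \<or> P = P1_of_ratio (e * t) 1 \<and> Q = P1_of_ratio (e * q) 1 \<or> P = P1_of_ratio e (k * t) \<and> Q = P1_of_ratio e (k * q)))"
      unfolding base_set_def UN_iff Bex_def by (simp only: insert_iff prod.inject empty_iff simp_thms)
    also have "\<dots> \<longleftrightarrow> (\<exists>e. e^2 = 1 \<and> (X0 = e * x * X1 \<and> Y0 = e * y * Y1 \<or> X1 = e * k * x * X0 \<and> Y1 = e * k * y * Y0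
       \<or> X0 = e * t * X1 \<and> Y0 = e * q * Y1 \<or> X1 = e * k * t * X0 \<and> Y1 = e * k * q * Y0))"
      unfolding square_one_iff[symmetric] P Q
      by (intro ex_cong1 conj_cong refl) (simp only: aff[OF nz(1)] aff[OF nz(2)] inv[OF nz(1)] inv[OF nz(2)])
    finally have "(P, Q) \<in> base_set \<longleftrightarrow> \<dots>" .
    then show ?thesis using Phi_undefined_iff[OF nz] by (simp add: base_points_def P Q)
  qed
  then show ?thesis by auto
qed

end

section \<open>First-order jets in the charts of the blow-up\<close>

text \<open>Extensional counterpart of \<open>poly2\<close>: numerators and denominators in a chart
  can be assembled as functions without naming their coefficients.\<close>

definition poly_fun :: "(complex \<times> complex \<Rightarrow> complex) \<Rightarrow> bool" where
  "poly_fun F \<longleftrightarrow> (\<exists>A. \<forall>w. poly2 A w = F w)"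

lemma poly_fun_const: "poly_fun (\<lambda>w. c)"
  unfolding poly_fun_def by (rule exI[of _ "[:[:c:]:]"]) (simp add: poly2_def)

lemma poly_fun_fst: "poly_fun fst"
  unfolding poly_fun_def by (rule exI[of _ "[:[:0, 1:]:]"]) (simp add: poly2_def)

lemma poly_fun_snd: "poly_fun snd"
  unfolding poly_fun_def by (rule exI[of _ "[:0, 1:]"]) (simp add: poly2_def)

lemma poly_fun_add: "poly_fun F \<Longrightarrow> poly_fun G \<Longrightarrow> poly_fun (\<lambda>w. F w + G w)"
  unfolding poly_fun_def by (metis poly2_def poly_add)

lemma poly_fun_mult: "poly_fun F \<Longrightarrow> poly_fun G \<Longrightarrow> poly_fun (\<lambda>w. F w * G w)"
  unfolding poly_fun_def by (metis poly2_def poly_mult)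

lemma poly_fun_diff: "poly_fun F \<Longrightarrow> poly_fun G \<Longrightarrow> poly_fun (\<lambda>w. F w - G w)"
  unfolding poly_fun_def by (metis poly2_def poly_diff)

lemma poly_fun_power: "poly_fun F \<Longrightarrow> poly_fun (\<lambda>w. F w ^ n)"
  by (induction n) (auto intro: poly_fun_const poly_fun_mult)

lemmas poly_fun_intros = poly_fun_const poly_fun_fst poly_fun_snd poly_fun_add poly_fun_mult poly_fun_diff poly_fun_power

lemma poly_fun_isCont:
  assumes "poly_fun F"
  shows "isCont F w"
proof -
  obtain A where A: "\<And>w. F w = poly2 A w" using assms unfolding poly_fun_def by metis
  have "isCont (\<lambda>w. poly (poly B [:snd w:]) (fst w)) w" for B :: "complex poly poly"
  proof (induction B)
    case (pCons a B)
    then show ?case by (simp, intro continuous_intros)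
  qed simp
  moreover have "F = poly2 A" using A by auto
  ultimately show ?thesis by (simp add: poly2_def[abs_def])
qed

lemma poly_fun_eventually_nonzero:
  assumes "poly_fun F" "poly_fun G" "(F c, G c) \<noteq> (0, 0)"
  shows "\<forall>\<^sub>F w in at c within S. (F w, G w) \<noteq> (0, 0)"
proof -
  have "isCont (\<lambda>w. (F w, G w)) c"
    using assms by (intro continuous_intros poly_fun_isCont)
  then have "\<forall>\<^sub>F w in nhds c. (F w, G w) \<noteq> (0, 0)"
    using assms(3) by (rule isCont_eventually_ne)
  then show ?thesis by (auto simp: eventually_at_filter elim: eventually_mono)
qed

section \<open>Charts of the blow-up and leading terms\<close>

fun chart_map :: "P1 \<Rightarrow> complex \<times> complex \<Rightarrow> complex \<times> complex" where
  "chart_map (Aff m) w = (fst w, fst w * snd w)"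
| "chart_map Infty w = (fst w * snd w, fst w)"

text \<open>The linear form a \<xi> + b \<omega> divided by the equation of the exceptional line,
  evaluated at the direction: a + b m for slope m, and b for the vertical direction.\<close>

fun lead :: "P1 \<Rightarrow> complex \<Rightarrow> complex \<Rightarrow> complex" where
  "lead (Aff m) a b = a + b * m"
| "lead Infty a b = b"

lemma blowup_chart_eq:
  "blowup_chart (P, Q) v w = (P1_chart P (fst (chart_map v w)), P1_chart Q (snd (chart_map v w)))"
  by (cases v; cases w) auto

lemma lead_add: "lead v (a + a') (b + b') = lead v a b + lead v a' b'"
  by (cases v) (auto simp: algebra_simps)

lemma lead_diff: "lead v (a - a') (b - b') = lead v a b - lead v a' b'"
  by (cases v) (auto simp: algebra_simps)

lemma lead_scale: "lead v (c * a) (c * b) = c * lead v a b"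
  by (cases v) (auto simp: algebra_simps)

text \<open>Two independent linear forms vanish in no common direction.\<close>

lemma lead_nonzero:
  assumes "a * d - b * c \<noteq> 0"
  shows "(lead v a b, lead v c d) \<noteq> (0, 0)"
proof
  assume "(lead v a b, lead v c d) = (0, 0)"
  then show False
  proof (cases v)
    case (Aff m)
    with \<open>_ = (0, 0)\<close> have "a = - (b * m)" "c = - (d * m)" by (auto simp: eq_neg_iff_add_eq_0)
    then show ?thesis using assms by (simp add: algebra_simps)
  qed (use assms in auto)
qed

text \<open>
  \<open>jet F c a b\<close>: \<open>F\<close> is a polynomial \<open>c + a \<xi> + b \<omega> + \<dots>\<close> in the local coordinates; in each chart
  \<open>F - c\<close> is divisible by the equation \<open>fst w\<close> of the exceptional line.
\<close>

definition jet :: "(complex \<times> complex \<Rightarrow> complex) \<Rightarrow> complex \<Rightarrow> complex \<Rightarrow> complex \<Rightarrow> bool" where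
  "jet F c a b \<longleftrightarrow> (\<forall>v. \<exists>Q. poly_fun Q \<and> (\<forall>w. F (chart_map v w) = c + fst w * Q w) \<and>
      Q (blowup_chart_center v) = lead v a b)"

lemma jetE:
  assumes "jet F c a b"
  obtains Q where "poly_fun Q" "\<And>w. F (chart_map v w) = c + fst w * Q w" "Q (blowup_chart_center v) = lead v a b"
  using assms unfolding jet_def by metis

lemma jet_poly_fun: "jet F c a b \<Longrightarrow> poly_fun (\<lambda>w. F (chart_map v w))"
  by (erule jetE[of _ _ _ _ v]) (simp add: poly_fun_intros)

lemma jet_center: "jet F c a b \<Longrightarrow> F (chart_map v (blowup_chart_center v)) = c"
proof (erule jetE[of _ _ _ _ v])
  fix Q assume "\<And>w. F (chart_map v w) = c + fst w * Q w"
  moreover have "fst (blowup_chart_center v) = 0" by (cases v) auto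
  ultimately show ?thesis by simp
qed

lemma jet_const: "jet (\<lambda>w. c) c 0 0"
  unfolding jet_def
proof
  fix v show "\<exists>Q. poly_fun Q \<and> (\<forall>w. c = c + fst w * Q w) \<and> Q (blowup_chart_center v) = lead v 0 0"
    by (rule exI[of _ "\<lambda>w. 0"]) (cases v; simp add: poly_fun_intros)
qed

lemma jet_fst: "jet fst 0 1 0"
  unfolding jet_def
proof
  fix v show "\<exists>Q. poly_fun Q \<and> (\<forall>w. fst (chart_map v w) = 0 + fst w * Q w) \<and> Q (blowup_chart_center v) = lead v 1 0"
    by (rule exI[of _ "case v of Aff m \<Rightarrow> (\<lambda>w. 1) | Infty \<Rightarrow> snd"]) (cases v; simp add: poly_fun_intros)
qed

lemma jet_snd: "jet snd 0 0 1"
  unfolding jet_def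
proof
  fix v show "\<exists>Q. poly_fun Q \<and> (\<forall>w. snd (chart_map v w) = 0 + fst w * Q w) \<and> Q (blowup_chart_center v) = lead v 0 1"
    by (rule exI[of _ "case v of Aff m \<Rightarrow> snd | Infty \<Rightarrow> (\<lambda>w. 1)"]) (cases v; simp add: poly_fun_intros)
qed

lemma jet_add:
  assumes "jet F c a b" "jet G c' a' b'"
  shows "jet (\<lambda>w. F w + G w) (c + c') (a + a') (b + b')"
  unfolding jet_def
proof
  fix v
  obtain Q where Q: "poly_fun Q" "\<And>w. F (chart_map v w) = c + fst w * Q w" "Q (blowup_chart_center v) = lead v a b"
    using jetE[OF assms(1), where v = v] by blast
  obtain R where R: "poly_fun R" "\<And>w. G (chart_map v w) = c' + fst w * R w" "R (blowup_chart_center v) = lead v a' b'"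
    using jetE[OF assms(2), where v = v] by blast
  show "\<exists>Q. poly_fun Q \<and> (\<forall>w. F (chart_map v w) + G (chart_map v w) = c + c' + fst w * Q w) \<and>
      Q (blowup_chart_center v) = lead v (a + a') (b + b')"
    by (rule exI[of _ "\<lambda>w. Q w + R w"]) (use Q R in \<open>auto simp: algebra_simps lead_add intro: poly_fun_intros\<close>)
qed

lemma jet_diff:
  assumes "jet F c a b" "jet G c' a' b'"
  shows "jet (\<lambda>w. F w - G w) (c - c') (a - a') (b - b')"
  unfolding jet_def
proof
  fix v
  obtain Q where Q: "poly_fun Q" "\<And>w. F (chart_map v w) = c + fst w * Q w" "Q (blowup_chart_center v) = lead v a b"
    using jetE[OF assms(1), where v = v] by blast
  obtain R where R: "poly_fun R" "\<And>w. G (chart_map v w) = c' + fst w * R w" "R (blowup_chart_center v) = lead v a' b'"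
    using jetE[OF assms(2), where v = v] by blast
  show "\<exists>Q. poly_fun Q \<and> (\<forall>w. F (chart_map v w) - G (chart_map v w) = c - c' + fst w * Q w) \<and>
      Q (blowup_chart_center v) = lead v (a - a') (b - b')"
    by (rule exI[of _ "\<lambda>w. Q w - R w"]) (use Q R in \<open>auto simp: algebra_simps lead_diff intro: poly_fun_intros\<close>)
qed

lemma jet_mult:
  assumes "jet F c a b" "jet G c' a' b'"
  shows "jet (\<lambda>w. F w * G w) (c * c') (c * a' + c' * a) (c * b' + c' * b)"
  unfolding jet_def
proof
  fix v
  obtain Q where Q: "poly_fun Q" "\<And>w. F (chart_map v w) = c + fst w * Q w" "Q (blowup_chart_center v) = lead v a b"
    using jetE[OF assms(1), where v = v] by blast
  obtain R where R: "poly_fun R" "\<And>w. G (chart_map v w) = c' + fst w * R w" "R (blowup_chart_center v) = lead v a' b'"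
    using jetE[OF assms(2), where v = v] by blast
  have "fst (blowup_chart_center v) = 0" by (cases v) auto
  note 0 = this
  show "\<exists>Q. poly_fun Q \<and> (\<forall>w. F (chart_map v w) * G (chart_map v w) = c * c' + fst w * Q w) \<and>
      Q (blowup_chart_center v) = lead v (c * a' + c' * a) (c * b' + c' * b)"
  proof (intro exI[of _ "\<lambda>w. c * R w + c' * Q w + fst w * (Q w * R w)"] conjI allI)
    show "poly_fun (\<lambda>w. c * R w + c' * Q w + fst w * (Q w * R w))"
      by (intro poly_fun_intros Q(1) R(1))
    show "F (chart_map v w) * G (chart_map v w) = c * c' + fst w * (c * R w + c' * Q w + fst w * (Q w * R w))" for w
      unfolding Q(2) R(2) by (simp add: algebra_simps)
  qed (simp add: Q(3) R(3) 0 lead_add lead_scale)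
qed

lemma jet_cong: "jet F c a b \<Longrightarrow> F = F' \<Longrightarrow> c = c' \<Longrightarrow> a = a' \<Longrightarrow> b = b' \<Longrightarrow> jet F' c' a' b'"
  by simp

lemma jet_step:
  assumes X: "jet X0 x0 a0 b0" "jet X1 x1 a1 b1" and Y: "jet Y0 y0 c0 d0" "jet Y1 y1 c1 d1"
  shows "jet (\<lambda>w. step_num \<alpha> \<beta> \<epsilon> (X0 w) (X1 w) (Y0 w) (Y1 w)) (step_num \<alpha> \<beta> \<epsilon> x0 x1 y0 y1)
      (d_step_num \<alpha> \<beta> \<epsilon> x0 x1 y0 y1 a0 a1 c0 c1) (d_step_num \<alpha> \<beta> \<epsilon> x0 x1 y0 y1 b0 b1 d0 d1)"
    and "jet (\<lambda>w. step_den m \<alpha> \<beta> \<epsilon> (X0 w) (X1 w) (Y0 w) (Y1 w)) (step_den m \<alpha> \<beta> \<epsilon> x0 x1 y0 y1)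
      (d_step_den m \<alpha> \<beta> \<epsilon> x0 x1 y0 y1 a0 a1 c0 c1) (d_step_den m \<alpha> \<beta> \<epsilon> x0 x1 y0 y1 b0 b1 d0 d1)"
proof -
  show "jet (\<lambda>w. step_num \<alpha> \<beta> \<epsilon> (X0 w) (X1 w) (Y0 w) (Y1 w)) (step_num \<alpha> \<beta> \<epsilon> x0 x1 y0 y1)
      (d_step_num \<alpha> \<beta> \<epsilon> x0 x1 y0 y1 a0 a1 c0 c1) (d_step_num \<alpha> \<beta> \<epsilon> x0 x1 y0 y1 b0 b1 d0 d1)"
    unfolding step_num_def power2_eq_square
    by (rule jet_cong[OF jet_diff[OF jet_diff[OF
          jet_mult[OF jet_mult[OF jet_mult[OF jet_const X(1)] X(2)] Y(1)]
          jet_mult[OF jet_mult[OF jet_const jet_mult[OF X(2) X(2)]] Y(2)]]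
          jet_mult[OF jet_mult[OF jet_const jet_mult[OF X(1) X(1)]] Y(2)]] refl])
       (simp_all add: d_step_num_def step_num_def algebra_simps power2_eq_square)
  show "jet (\<lambda>w. step_den m \<alpha> \<beta> \<epsilon> (X0 w) (X1 w) (Y0 w) (Y1 w)) (step_den m \<alpha> \<beta> \<epsilon> x0 x1 y0 y1)
      (d_step_den m \<alpha> \<beta> \<epsilon> x0 x1 y0 y1 a0 a1 c0 c1) (d_step_den m \<alpha> \<beta> \<epsilon> x0 x1 y0 y1 b0 b1 d0 d1)"
    unfolding step_den_def power2_eq_square
    by (rule jet_cong[OF jet_add[OF jet_diff[OF
          jet_mult[OF jet_mult[OF jet_mult[OF jet_const jet_const] jet_mult[OF X(1) X(1)]] Y(1)]
          jet_mult[OF jet_mult[OF jet_mult[OF jet_const X(1)] X(2)] Y(2)]]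
          jet_mult[OF jet_mult[OF jet_const jet_mult[OF X(2) X(2)]] Y(1)]] refl])
       (simp_all add: d_step_den_def step_den_def algebra_simps power2_eq_square)
qed

text \<open>A homogeneous representative of \<open>P1_chart\<close> that is polynomial in the local
  parameter even at \<open>Infty\<close>; \<open>local_dir\<close> is its derivative.\<close>

fun local_hom :: "P1 \<Rightarrow> complex \<Rightarrow> complex \<times> complex" where
  "local_hom (Aff x) \<xi> = (x + \<xi>, 1)"
| "local_hom Infty \<xi> = (1, \<xi>)"

fun local_dir :: "P1 \<Rightarrow> complex \<times> complex" where
  "local_dir (Aff x) = (1, 0)"
| "local_dir Infty = (0, 1)"

lemma P1_chart_local_hom: "P1_chart P \<xi> = P1_of_ratio (fst (local_hom P \<xi>)) (snd (local_hom P \<xi>))"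
  by (cases P) (auto simp: P1_of_ratio_def)

lemma local_hom_nonzero: "(fst (local_hom P \<xi>), snd (local_hom P \<xi>)) \<noteq> (0, 0)"
  by (cases P) auto

lemma local_dir_cross:
  "fst (hom_coords P) * snd (local_dir P) - snd (hom_coords P) * fst (local_dir P) \<noteq> 0"
  by (cases P) auto

lemma jet_local_hom:
  "jet (\<lambda>w. fst (local_hom P (fst w))) (fst (hom_coords P)) (fst (local_dir P)) 0"
  "jet (\<lambda>w. snd (local_hom P (fst w))) (snd (hom_coords P)) (snd (local_dir P)) 0"
  "jet (\<lambda>w. fst (local_hom P (snd w))) (fst (hom_coords P)) 0 (fst (local_dir P))"
  "jet (\<lambda>w. snd (local_hom P (snd w))) (snd (hom_coords P)) 0 (snd (local_dir P))"
proof -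
  have 1: "jet (\<lambda>w. x + fst w) x 1 0" "jet (\<lambda>w. x + snd w) x 0 1" for x
    using jet_add[OF jet_const[of x] jet_fst] jet_add[OF jet_const[of x] jet_snd] by simp_all
  show "jet (\<lambda>w. fst (local_hom P (fst w))) (fst (hom_coords P)) (fst (local_dir P)) 0"
    "jet (\<lambda>w. snd (local_hom P (fst w))) (snd (hom_coords P)) (snd (local_dir P)) 0"
    "jet (\<lambda>w. fst (local_hom P (snd w))) (fst (hom_coords P)) 0 (fst (local_dir P))"
    "jet (\<lambda>w. snd (local_hom P (snd w))) (snd (hom_coords P)) 0 (snd (local_dir P))"
    by (cases P; simp add: 1 jet_const jet_fst jet_snd)+
qed

section \<open>Regularity of the lifted map on the exceptional lines\<close>

lemma poly_fun_step:
  assumes "poly_fun X0" "poly_fun X1" "poly_fun Y0" "poly_fun Y1"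
  shows "poly_fun (\<lambda>w. step_num \<alpha> \<beta> \<epsilon> (X0 w) (X1 w) (Y0 w) (Y1 w))"
    "poly_fun (\<lambda>w. step_den m \<alpha> \<beta> \<epsilon> (X0 w) (X1 w) (Y0 w) (Y1 w))"
  unfolding step_num_def step_den_def by (intro poly_fun_intros assms)+

lemma P1_quotient_Some: "(a, b) \<noteq> (0, 0) \<Longrightarrow> P1_quotient a b = Some (P1_of_ratio a b)"
  by (auto simp: P1_quotient_def)

lemma regular_on_exceptionalI:
  assumes "poly_fun A" "poly_fun B" "poly_fun C" "poly_fun D"
    and "(A (blowup_chart_center v), B (blowup_chart_center v)) \<noteq> (0, 0)"
    and "(C (blowup_chart_center v), D (blowup_chart_center v)) \<noteq> (0, 0)"
    and "\<forall>\<^sub>F w in at (blowup_chart_center v) within {w. fst w \<noteq> 0}.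
           \<Phi> (blowup_chart p v w) = Some (P1_of_ratio (A w) (B w), P1_of_ratio (C w) (D w))"
  shows "regular_on_exceptional \<Phi> p v"
proof -
  obtain A' B' C' D' where "\<And>w. A w = poly2 A' w" "\<And>w. B w = poly2 B' w" "\<And>w. C w = poly2 C' w" "\<And>w. D w = poly2 D' w"
    using assms(1-4) unfolding poly_fun_def by metis
  then show ?thesis unfolding regular_on_exceptional_def using assms(5-7)
    by (intro exI[of _ A'] exI[of _ B'] exI[of _ C'] exI[of _ D']) simp
qed

text \<open>At a base point of the first half-step, numerator and denominator are divisible by the
  equation of the exceptional line, and the simple zero of the determinant leaves the two quotients
  without a common zero on it. The second half-step is then defined whatever value g' takes, by
  \<open>second\<close>.\<close>

lemma two_step_regular_first:
  fixes P Q :: P1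
  defines "X0 \<equiv> fst (hom_coords P)" and "X1 \<equiv> snd (hom_coords P)"
    and "Y0 \<equiv> fst (hom_coords Q)" and "Y1 \<equiv> snd (hom_coords Q)"
  assumes 0: "step_num \<alpha> \<beta> \<epsilon> X0 X1 Y0 Y1 = 0" "step_den (k^2) \<alpha> \<beta> \<epsilon> X0 X1 Y0 Y1 = 0"
    and simple: "d_step_disc (k^2) \<alpha> \<beta> \<epsilon> X0 X1 (fst (local_dir P)) (snd (local_dir P)) \<noteq> 0"
    and second: "\<And>a b. (a, b) \<noteq> (0, 0) \<Longrightarrow> (step_num \<alpha>' \<beta>' \<epsilon>' a b X0 X1, step_den (k^2) \<alpha>' \<beta>' \<epsilon>' a b X0 X1) \<noteq> (0, 0)"
  shows "regular_on_exceptional (two_step (P1_step k \<alpha> \<beta> \<epsilon>) (P1_step k \<alpha>' \<beta>' \<epsilon>')) (P, Q) v"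
proof -
  define F0 F1 G0 G1 where "F0 = (\<lambda>w::complex\<times>complex. fst (local_hom P (fst w)))"
    and "F1 = (\<lambda>w::complex\<times>complex. snd (local_hom P (fst w)))"
    and "G0 = (\<lambda>w::complex\<times>complex. fst (local_hom Q (snd w)))" and "G1 = (\<lambda>w::complex\<times>complex. snd (local_hom Q (snd w)))"
  define V0 V1 W0 W1 where "V0 = fst (local_dir P)" and "V1 = snd (local_dir P)"
    and "W0 = fst (local_dir Q)" and "W1 = snd (local_dir Q)"
  have jets: "jet F0 X0 V0 0" "jet F1 X1 V1 0" "jet G0 Y0 0 W0" "jet G1 Y1 0 W1"
    unfolding F0_def F1_def G0_def G1_def V0_def V1_def W0_def W1_def X0_def X1_def Y0_def Y1_def
    by (rule jet_local_hom)+
  define N D where "N = (\<lambda>w. step_num \<alpha> \<beta> \<epsilon> (F0 w) (F1 w) (G0 w) (G1 w))"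
    and "D = (\<lambda>w. step_den (k^2) \<alpha> \<beta> \<epsilon> (F0 w) (F1 w) (G0 w) (G1 w))"
  have jN: "jet N 0 (d_step_num \<alpha> \<beta> \<epsilon> X0 X1 Y0 Y1 V0 V1 0 0) (d_step_num \<alpha> \<beta> \<epsilon> X0 X1 Y0 Y1 0 0 W0 W1)"
    and jD: "jet D 0 (d_step_den (k^2) \<alpha> \<beta> \<epsilon> X0 X1 Y0 Y1 V0 V1 0 0) (d_step_den (k^2) \<alpha> \<beta> \<epsilon> X0 X1 Y0 Y1 0 0 W0 W1)"
    unfolding N_def D_def using jet_step(1)[OF jets, of \<alpha> \<beta> \<epsilon>] jet_step(2)[OF jets, of "k^2" \<alpha> \<beta> \<epsilon>] unfolding 0 by auto
  have dn: "d_step_num \<alpha> \<beta> \<epsilon> X0 X1 Y0 Y1 0 0 W0 W1 = step_num \<alpha> \<beta> \<epsilon> X0 X1 W0 W1"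
    "d_step_den (k^2) \<alpha> \<beta> \<epsilon> X0 X1 Y0 Y1 0 0 W0 W1 = step_den (k^2) \<alpha> \<beta> \<epsilon> X0 X1 W0 W1"
    by (simp_all add: d_step_num_def d_step_den_def)
  obtain QN where QN: "poly_fun QN" "\<And>w. N (chart_map v w) = 0 + fst w * QN w"
    "QN (blowup_chart_center v) = lead v (d_step_num \<alpha> \<beta> \<epsilon> X0 X1 Y0 Y1 V0 V1 0 0) (step_num \<alpha> \<beta> \<epsilon> X0 X1 W0 W1)"
    using jetE[OF jN[unfolded dn], where v = v] by blast
  obtain QD where QD: "poly_fun QD" "\<And>w. D (chart_map v w) = 0 + fst w * QD w"
    "QD (blowup_chart_center v) = lead v (d_step_den (k^2) \<alpha> \<beta> \<epsilon> X0 X1 Y0 Y1 V0 V1 0 0) (step_den (k^2) \<alpha> \<beta> \<epsilon> X0 X1 W0 W1)"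
    using jetE[OF jD[unfolded dn], where v = v] by blast
  have nzQ: "(QN (blowup_chart_center v), QD (blowup_chart_center v)) \<noteq> (0, 0)"
    unfolding QN QD
    by (rule lead_nonzero, unfold step_jacobian[OF 0])
       (use simple local_dir_cross[of Q] in \<open>simp add: V0_def V1_def W0_def W1_def Y0_def Y1_def\<close>)
  define f0 f1 where "f0 = (\<lambda>w. F0 (chart_map v w))" and "f1 = (\<lambda>w. F1 (chart_map v w))"
  have pf: "poly_fun f0" "poly_fun f1" unfolding f0_def f1_def using jets jet_poly_fun by blast+
  have fc: "f0 (blowup_chart_center v) = X0" "f1 (blowup_chart_center v) = X1"
    unfolding f0_def f1_def using jets jet_center by blast+
  define A B where "A = (\<lambda>w. step_num \<alpha>' \<beta>' \<epsilon>' (QN w) (QD w) (f0 w) (f1 w))"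
    and "B = (\<lambda>w. step_den (k^2) \<alpha>' \<beta>' \<epsilon>' (QN w) (QD w) (f0 w) (f1 w))"
  have pAB: "poly_fun A" "poly_fun B" unfolding A_def B_def by (intro poly_fun_step QN QD pf)+
  have nzA: "(A (blowup_chart_center v), B (blowup_chart_center v)) \<noteq> (0, 0)"
    unfolding A_def B_def fc by (rule second[OF nzQ])
  show ?thesis
  proof (rule regular_on_exceptionalI[OF pAB QN(1) QD(1) nzA nzQ])
    show "\<forall>\<^sub>F w in at (blowup_chart_center v) within {w. fst w \<noteq> 0}.
        two_step (P1_step k \<alpha> \<beta> \<epsilon>) (P1_step k \<alpha>' \<beta>' \<epsilon>') (blowup_chart (P, Q) v w) =
        Some (P1_of_ratio (A w) (B w), P1_of_ratio (QN w) (QD w))"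
      using poly_fun_eventually_nonzero[OF pAB nzA] poly_fun_eventually_nonzero[OF QN(1) QD(1) nzQ]
        eventually_at_filter[THEN iffD2, OF always_eventually, of "blowup_chart_center v" "{w. fst w \<noteq> 0}" "\<lambda>w. fst w \<noteq> 0", simplified]
    proof eventually_elim
      case (elim w)
      define fr gr where "fr = P1_of_ratio (f0 w) (f1 w)" and "gr = P1_of_ratio (G0 (chart_map v w)) (G1 (chart_map v w))"
      have ch: "blowup_chart (P, Q) v w = (fr, gr)"
        unfolding blowup_chart_eq fr_def gr_def f0_def f1_def F0_def F1_def G0_def G1_def by (simp add: P1_chart_local_hom)
      have nzf: "(f0 w, f1 w) \<noteq> (0, 0)" and nzg: "(G0 (chart_map v w), G1 (chart_map v w)) \<noteq> (0, 0)"
        unfolding f0_def f1_def F0_def F1_def G0_def G1_def by (rule local_hom_nonzero)+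
      have "P1_step k \<alpha> \<beta> \<epsilon> fr gr = P1_quotient (N (chart_map v w)) (D (chart_map v w))"
        unfolding fr_def gr_def P1_step_ratio[OF nzf nzg] by (simp add: N_def D_def f0_def f1_def)
      also have "\<dots> = P1_quotient (QN w) (QD w)" unfolding QN QD using elim(3) by (simp add: P1_quotient_scale)
      also have "\<dots> = Some (P1_of_ratio (QN w) (QD w))" using elim(2) by (rule P1_quotient_Some)
      finally have s1: "P1_step k \<alpha> \<beta> \<epsilon> fr gr = Some (P1_of_ratio (QN w) (QD w))" .
      have "P1_step k \<alpha>' \<beta>' \<epsilon>' (P1_of_ratio (QN w) (QD w)) fr = P1_quotient (A w) (B w)"
        unfolding fr_def P1_step_ratio[OF elim(2) nzf] A_def B_def ..
      also have "\<dots> = Some (P1_of_ratio (A w) (B w))" using elim(1) by (rule P1_quotient_Some)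
      finally show ?case unfolding ch two_step_def using s1 by simp
    qed
  qed
qed

text \<open>Here g' is regular and only the second half-step degenerates. Its first argument varies
  to first order with g in the direction (Z0, Z1), which is independent of (a, b) because the first
  determinant is nonzero; so the simple zero of the second determinant is met transversally.\<close>

lemma two_step_regular_second:
  fixes P Q :: P1 and k \<alpha> \<beta> \<epsilon> :: complex
  defines "X0 \<equiv> fst (hom_coords P)" and "X1 \<equiv> snd (hom_coords P)"
    and "Y0 \<equiv> fst (hom_coords Q)" and "Y1 \<equiv> snd (hom_coords Q)"
  defines "a \<equiv> step_num \<alpha> \<beta> \<epsilon> X0 X1 Y0 Y1" and "b \<equiv> step_den (k^2) \<alpha> \<beta> \<epsilon> X0 X1 Y0 Y1"
  assumes disc: "step_disc (k^2) \<alpha> \<beta> \<epsilon> X0 X1 \<noteq> 0"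
    and 0: "step_num \<alpha>' \<beta>' \<epsilon>' a b X0 X1 = 0" "step_den (k^2) \<alpha>' \<beta>' \<epsilon>' a b X0 X1 = 0"
    and simple: "\<And>V0 V1. a * V1 - b * V0 \<noteq> 0 \<Longrightarrow> d_step_disc (k^2) \<alpha>' \<beta>' \<epsilon>' a b V0 V1 \<noteq> 0"
  shows "regular_on_exceptional (two_step (P1_step k \<alpha> \<beta> \<epsilon>) (P1_step k \<alpha>' \<beta>' \<epsilon>')) (P, Q) v"
proof -
  define F0 F1 G0 G1 where "F0 = (\<lambda>w::complex\<times>complex. fst (local_hom P (fst w)))"
    and "F1 = (\<lambda>w::complex\<times>complex. snd (local_hom P (fst w)))"
    and "G0 = (\<lambda>w::complex\<times>complex. fst (local_hom Q (snd w)))" and "G1 = (\<lambda>w::complex\<times>complex. snd (local_hom Q (snd w)))"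
  define V0 V1 W0 W1 where "V0 = fst (local_dir P)" and "V1 = snd (local_dir P)"
    and "W0 = fst (local_dir Q)" and "W1 = snd (local_dir Q)"
  have jets: "jet F0 X0 V0 0" "jet F1 X1 V1 0" "jet G0 Y0 0 W0" "jet G1 Y1 0 W1"
    unfolding F0_def F1_def G0_def G1_def V0_def V1_def W0_def W1_def X0_def X1_def Y0_def Y1_def
    by (rule jet_local_hom)+
  define N D where "N = (\<lambda>w. step_num \<alpha> \<beta> \<epsilon> (F0 w) (F1 w) (G0 w) (G1 w))"
    and "D = (\<lambda>w. step_den (k^2) \<alpha> \<beta> \<epsilon> (F0 w) (F1 w) (G0 w) (G1 w))"
  define U0 U1 where "U0 = d_step_num \<alpha> \<beta> \<epsilon> X0 X1 Y0 Y1 V0 V1 0 0" and "U1 = d_step_den (k^2) \<alpha> \<beta> \<epsilon> X0 X1 Y0 Y1 V0 V1 0 0"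
  define Z0 Z1 where "Z0 = step_num \<alpha> \<beta> \<epsilon> X0 X1 W0 W1" and "Z1 = step_den (k^2) \<alpha> \<beta> \<epsilon> X0 X1 W0 W1"
  have jND: "jet N a U0 Z0" "jet D b U1 Z1"
    using jet_step(1)[OF jets, of \<alpha> \<beta> \<epsilon>] jet_step(2)[OF jets, of "k^2" \<alpha> \<beta> \<epsilon>] unfolding N_def D_def a_def b_def U0_def U1_def Z0_def Z1_def
    by (simp_all add: d_step_num_def d_step_den_def)
  have Yc: "Y0 * W1 - Y1 * W0 \<noteq> 0" using local_dir_cross[of Q] by (simp add: Y0_def Y1_def W0_def W1_def)
  have Xc: "X0 * V1 - X1 * V0 \<noteq> 0" using local_dir_cross[of P] by (simp add: X0_def X1_def V0_def V1_def)
  have Ynz: "(Y0, Y1) \<noteq> (0, 0)" unfolding Y0_def Y1_def by (rule hom_coords_nonzero)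
  have nzab: "(a, b) \<noteq> (0, 0)" unfolding a_def b_def by (rule step_nonzero[OF disc Ynz])
  have "a * Z1 - b * Z0 = step_disc (k^2) \<alpha> \<beta> \<epsilon> X0 X1 * (Y0 * W1 - Y1 * W0)"
    unfolding a_def b_def Z0_def Z1_def by (rule step_wronskian)
  then have sim: "d_step_disc (k^2) \<alpha>' \<beta>' \<epsilon>' a b Z0 Z1 \<noteq> 0" using simple[where ?V0.0 = Z0 and ?V1.0 = Z1] disc Yc by simp
  define N' D' where "N' = (\<lambda>w. step_num \<alpha>' \<beta>' \<epsilon>' (N w) (D w) (F0 w) (F1 w))"
    and "D' = (\<lambda>w. step_den (k^2) \<alpha>' \<beta>' \<epsilon>' (N w) (D w) (F0 w) (F1 w))"
  have jN: "jet N' 0 (d_step_num \<alpha>' \<beta>' \<epsilon>' a b X0 X1 U0 U1 V0 V1) (d_step_num \<alpha>' \<beta>' \<epsilon>' a b X0 X1 Z0 Z1 0 0)"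
    and jD: "jet D' 0 (d_step_den (k^2) \<alpha>' \<beta>' \<epsilon>' a b X0 X1 U0 U1 V0 V1) (d_step_den (k^2) \<alpha>' \<beta>' \<epsilon>' a b X0 X1 Z0 Z1 0 0)"
    unfolding N'_def D'_def using jet_step(1)[OF jND jets(1,2), of \<alpha>' \<beta>' \<epsilon>'] jet_step(2)[OF jND jets(1,2), of "k^2" \<alpha>' \<beta>' \<epsilon>'] unfolding 0 by auto
  obtain QN where QN: "poly_fun QN" "\<And>w. N' (chart_map v w) = 0 + fst w * QN w"
    "QN (blowup_chart_center v) = lead v (d_step_num \<alpha>' \<beta>' \<epsilon>' a b X0 X1 U0 U1 V0 V1) (d_step_num \<alpha>' \<beta>' \<epsilon>' a b X0 X1 Z0 Z1 0 0)"
    using jetE[OF jN, where v = v] by blast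
  obtain QD where QD: "poly_fun QD" "\<And>w. D' (chart_map v w) = 0 + fst w * QD w"
    "QD (blowup_chart_center v) = lead v (d_step_den (k^2) \<alpha>' \<beta>' \<epsilon>' a b X0 X1 U0 U1 V0 V1) (d_step_den (k^2) \<alpha>' \<beta>' \<epsilon>' a b X0 X1 Z0 Z1 0 0)"
    using jetE[OF jD, where v = v] by blast
  have nzQ: "(QN (blowup_chart_center v), QD (blowup_chart_center v)) \<noteq> (0, 0)"
    unfolding QN QD
    by (rule lead_nonzero, unfold step_jacobian_first[OF 0 nzab]) (use sim Xc in simp)
  define n d where "n = (\<lambda>w. N (chart_map v w))" and "d = (\<lambda>w. D (chart_map v w))"
  have pn: "poly_fun n" "poly_fun d" unfolding n_def d_def using jND jet_poly_fun by blast+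
  have nc: "n (blowup_chart_center v) = a" "d (blowup_chart_center v) = b"
    unfolding n_def d_def using jND jet_center by blast+
  have nzn: "(n (blowup_chart_center v), d (blowup_chart_center v)) \<noteq> (0, 0)" unfolding nc by (rule nzab)
  show ?thesis
  proof (rule regular_on_exceptionalI[OF QN(1) QD(1) pn nzQ nzn])
    show "\<forall>\<^sub>F w in at (blowup_chart_center v) within {w. fst w \<noteq> 0}.
        two_step (P1_step k \<alpha> \<beta> \<epsilon>) (P1_step k \<alpha>' \<beta>' \<epsilon>') (blowup_chart (P, Q) v w) =
        Some (P1_of_ratio (QN w) (QD w), P1_of_ratio (n w) (d w))"
      using poly_fun_eventually_nonzero[OF pn nzn] poly_fun_eventually_nonzero[OF QN(1) QD(1) nzQ]
        eventually_at_filter[THEN iffD2, OF always_eventually, of "blowup_chart_center v" "{w. fst w \<noteq> 0}" "\<lambda>w. fst w \<noteq> 0", simplified]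
    proof eventually_elim
      case (elim w)
      define fr gr where "fr = P1_of_ratio (F0 (chart_map v w)) (F1 (chart_map v w))"
        and "gr = P1_of_ratio (G0 (chart_map v w)) (G1 (chart_map v w))"
      have ch: "blowup_chart (P, Q) v w = (fr, gr)"
        unfolding blowup_chart_eq fr_def gr_def F0_def F1_def G0_def G1_def by (simp add: P1_chart_local_hom)
      have nzf: "(F0 (chart_map v w), F1 (chart_map v w)) \<noteq> (0, 0)" and nzg: "(G0 (chart_map v w), G1 (chart_map v w)) \<noteq> (0, 0)"
        unfolding F0_def F1_def G0_def G1_def by (rule local_hom_nonzero)+
      have "P1_step k \<alpha> \<beta> \<epsilon> fr gr = P1_quotient (n w) (d w)"
        unfolding fr_def gr_def P1_step_ratio[OF nzf nzg] by (simp add: N_def D_def n_def d_def)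
      also have "\<dots> = Some (P1_of_ratio (n w) (d w))" using elim(1) by (rule P1_quotient_Some)
      finally have s1: "P1_step k \<alpha> \<beta> \<epsilon> fr gr = Some (P1_of_ratio (n w) (d w))" .
      have "P1_step k \<alpha>' \<beta>' \<epsilon>' (P1_of_ratio (n w) (d w)) fr = P1_quotient (N' (chart_map v w)) (D' (chart_map v w))"
        unfolding fr_def P1_step_ratio[OF elim(1) nzf] by (simp add: N'_def D'_def n_def d_def)
      also have "\<dots> = P1_quotient (QN w) (QD w)" unfolding QN QD using elim(3) by (simp add: P1_quotient_scale)
      also have "\<dots> = Some (P1_of_ratio (QN w) (QD w))" using elim(2) by (rule P1_quotient_Some)
      finally show ?case unfolding ch two_step_def using s1 by simp
    qed
  qed
qed

context two_step_map
begin

text \<open>The two ways of failing exclude each other: at a zero of the first determinant f is none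
  of \<plusminus> t, \<plusminus> 1/(k t), so the second half-step is defined there for every g',
  and conversely.\<close>

lemma regular_on_exceptional_Phi:
  assumes "p \<in> base_points \<Phi>"
  shows "regular_on_exceptional \<Phi> p v"
proof -
  obtain P Q where p: "p = (P, Q)" by (cases p)
  define X0 X1 Y0 Y1 where "X0 = fst (hom_coords P)" and "X1 = snd (hom_coords P)"
    and "Y0 = fst (hom_coords Q)" and "Y1 = snd (hom_coords Q)"
  have nz: "(X0, X1) \<noteq> (0, 0)" "(Y0, Y1) \<noteq> (0, 0)" and P: "P = P1_of_ratio X0 X1" and Q: "Q = P1_of_ratio Y0 Y1"
    using hom_coords_nonzero[of P] hom_coords_nonzero[of Q]
    by (simp_all add: X0_def X1_def Y0_def Y1_def P1_of_ratio_hom_coords)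
  have cross: "X0 * snd (local_dir P) - X1 * fst (local_dir P) \<noteq> 0"
    using local_dir_cross[of P] by (simp add: X0_def X1_def)
  show ?thesis
  proof (cases "first.num X0 X1 Y0 Y1 = 0 \<and> first.den X0 X1 Y0 Y1 = 0")
    case True
    have disc0: "first.disc X0 X1 = 0" using step_nonzero[of "k^2" \<alpha> \<beta> \<epsilon> X0 X1, OF _ nz(2)] True by auto
    have sec: "(second.num a b X0 X1, second.den a b X0 X1) \<noteq> (0, 0)" if ab: "(a, b) \<noteq> (0, 0)" for a b
    proof
      assume "(second.num a b X0 X1, second.den a b X0 X1) = (0, 0)"
      then have "second.num a b X0 X1 = 0 \<and> second.den a b X0 X1 = 0" by simp
      then obtain e where e: "e^2 = 1" and "X0 = e * t * X1 \<or> X1 = e * k * t * X0"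
        using second.base_point_iff[OF ab nz(1)] by blast
      then show False
      proof (elim disjE)
        assume X: "X0 = e * t * X1"
        then have "X1 \<noteq> 0" using nz by auto
        then show False using first_disc_nonzero(1)[OF e, of X1] disc0 X by simp
      next
        assume X: "X1 = e * k * t * X0"
        then have "X0 \<noteq> 0" using nz by auto
        then show False using first_disc_nonzero(2)[OF e, of X0] disc0 X by simp
      qed
    qed
    show ?thesis unfolding p \<Phi>_def H1_def H2_def
      by (rule two_step_regular_first)
         (use True sec first.d_disc_nonzero[OF disc0 cross] in \<open>simp_all add: X0_def X1_def Y0_def Y1_def\<close>)
  next
    case False
    define a b where "a = first.num X0 X1 Y0 Y1" and "b = first.den X0 X1 Y0 Y1"
    have ab: "(a, b) \<noteq> (0, 0)" using False by (auto simp: a_def b_def)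
    have v: "H1 P Q = Some (P1_of_ratio a b)"
      using first_value[OF nz] ab by (simp add: P Q a_def b_def)
    have "\<Phi> (P, Q) = None" using assms by (simp add: p base_points_def)
    then have "H2 (P1_of_ratio a b) P = None" using v by (auto simp: \<Phi>_def two_step_def split: option.splits)
    then have 0: "second.num a b X0 X1 = 0 \<and> second.den a b X0 X1 = 0"
      unfolding second.base_point_iff[OF ab nz(1)] unfolding P second_undefined_iff[OF ab nz(1)] .
    then obtain e where e: "e^2 = 1" and X: "X0 = e * t * X1 \<or> X1 = e * k * t * X0"
      using second.base_point_iff[OF ab nz(1)] by blast
    have disc: "first.disc X0 X1 \<noteq> 0"
      using X
    proof
      assume X: "X0 = e * t * X1"
      then have "X1 \<noteq> 0" using nz by auto
      then show ?thesis using first_disc_nonzero(1)[OF e, of X1] X by simp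
    next
      assume X: "X1 = e * k * t * X0"
      then have "X0 \<noteq> 0" using nz by auto
      then show ?thesis using first_disc_nonzero(2)[OF e, of X0] X by simp
    qed
    have disc2: "second.disc a b = 0" using step_nonzero[of "k^2" \<alpha>' \<beta>' \<epsilon>' a b, OF _ nz(1)] 0 by auto
    show ?thesis unfolding p \<Phi>_def H1_def H2_def
      by (rule two_step_regular_second)
         (use 0 disc second.d_disc_nonzero[OF disc2] in \<open>simp_all add: X0_def X1_def Y0_def Y1_def a_def b_def\<close>)
  qed
qed

lemma no_lift_base_point: "p \<in> blowup (base_points \<Phi>) \<Longrightarrow> \<not> lift_base_point \<Phi> p"
  unfolding blowup_def using regular_on_exceptional_Phi by (auto simp: base_points_def)

end

section \<open>The invariant biquadratic curve\<close>

text \<open>After division by A3 the curve is Euler's biquadratic relation, with \<sigma> = sn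
  \<eta> and \<tau> = cn \<eta> dn \<eta> in the application.\<close>

locale jacobi_biquadratic =
  fixes k \<sigma> \<tau> A1 A2 A3 :: complex
  assumes k: "k \<noteq> 0" "k^2 \<noteq> 1" and \<sigma>: "\<sigma> \<noteq> 0" and \<tau>: "\<tau>^2 = (1 - \<sigma>^2) * (1 - k^2 * \<sigma>^2)"
    and A: "A3 \<noteq> 0" "A1 = - (\<sigma>^2 * A3)" "A2 = - (2 * \<tau> * A3)"
begin

abbreviation "E \<equiv> symmetric_biquadratic k A1 A2 A3"

lemma A1_nonzero: "A1 \<noteq> 0" using A \<sigma> by simp

definition form :: "complex \<Rightarrow> complex \<Rightarrow> complex \<Rightarrow> complex \<Rightarrow> complex" where
  "form X0 X1 Y0 Y1 = A1 * (X1^2 * Y1^2 + k^2 * X0^2 * Y0^2) + A2 * X0 * X1 * Y0 * Y1 + A3 * (X0^2 * Y1^2 + X1^2 * Y0^2)"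

lemma local_coeff_00:
  "local_coeff 2 2 E (P, Q) 0 0 = form (fst (hom_coords P)) (snd (hom_coords P)) (fst (hom_coords Q)) (snd (hom_coords Q))"
  by (cases P; cases Q)
     (simp_all add: local_coeff_def symmetric_biquadratic_def form_def numeral_2_eq_2 algebra_simps)

lemma local_coeff_10_Aff:
  "local_coeff 2 2 E (Aff f, Aff g) 1 0 = 2 * A1 * k^2 * f * g^2 + A2 * g + 2 * A3 * f"
  "local_coeff 2 2 E (Aff f, Aff g) 0 1 = 2 * A1 * k^2 * f^2 * g + A2 * f + 2 * A3 * g"
  by (simp_all add: local_coeff_def symmetric_biquadratic_def numeral_2_eq_2 algebra_simps)

lemma local_coeff_Infty:
  "local_coeff 2 2 E (Infty, Aff g) 0 1 = 2 * A1 * k^2 * g"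
  "local_coeff 2 2 E (Aff g, Infty) 1 0 = 2 * A1 * k^2 * g"
  by (simp_all add: local_coeff_def symmetric_biquadratic_def numeral_2_eq_2 algebra_simps)

lemma form_scale: "form (l * X0) (l * X1) (l' * Y0) (l' * Y1) = (l^2 * l'^2) * form X0 X1 Y0 Y1"
  by (simp add: form_def algebra_simps power2_eq_square)

lemma form_commute: "form X0 X1 Y0 Y1 = form Y0 Y1 X0 X1"
  by (simp add: form_def algebra_simps)

lemma on_curve_ratio:
  assumes "(X0, X1) \<noteq> (0, 0)" "(Y0, Y1) \<noteq> (0, 0)"
  shows "on_curve 2 2 E (P1_of_ratio X0 X1, P1_of_ratio Y0 Y1) \<longleftrightarrow> form X0 X1 Y0 Y1 = 0"
proof -
  obtain l where l: "l \<noteq> 0" "hom_coords (P1_of_ratio X0 X1) = (l * X0, l * X1)"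
    using hom_coords_P1_of_ratio[OF assms(1)] .
  obtain l' where l': "l' \<noteq> 0" "hom_coords (P1_of_ratio Y0 Y1) = (l' * Y0, l' * Y1)"
    using hom_coords_P1_of_ratio[OF assms(2)] .
  show ?thesis using l l' by (simp add: on_curve_def local_coeff_00 form_scale)
qed

lemma form_Aff: "form f 1 g 1 = A3 * (f^2 + g^2 - 2 * \<tau> * f * g - \<sigma>^2 * (1 + k^2 * f^2 * g^2))"
  unfolding form_def by (simp add: A algebra_simps)

lemma on_curve_points:
  assumes "f^2 + g^2 - 2 * \<tau> * f * g - \<sigma>^2 * (1 + k^2 * f^2 * g^2) = 0" "e^2 = 1"
  shows "on_curve 2 2 E (P1_of_ratio (e * f) 1, P1_of_ratio (e * g) 1)"
    and "on_curve 2 2 E (P1_of_ratio e (k * f), P1_of_ratio e (k * g))"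
proof -
  have f0: "form f 1 g 1 = 0" unfolding form_Aff assms(1) by simp
  have ee: "e * e = 1" and e: "e \<noteq> 0" using assms(2) by (auto simp: power2_eq_square)
  have "form (e * f) 1 (e * g) 1 = A1 * (1 + k^2 * ((e * e) * (e * e)) * f^2 * g^2) + A2 * (e * e) * f * g + A3 * ((e * e) * f^2 + (e * e) * g^2)"
    by (simp add: form_def algebra_simps power2_eq_square)
  then have "form (e * f) 1 (e * g) 1 = form f 1 g 1" unfolding ee by (simp add: form_def)
  then show "on_curve 2 2 E (P1_of_ratio (e * f) 1, P1_of_ratio (e * g) 1)"
    using f0 by (subst on_curve_ratio) auto
  have "form e (k * f) e (k * g) = k^2 * (A1 * (k^2 * f^2 * g^2 + (e * e) * (e * e)) + A2 * (e * e) * f * g + A3 * ((e * e) * f^2 + (e * e) * g^2))"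
    by (simp add: form_def algebra_simps power2_eq_square)
  then have "form e (k * f) e (k * g) = k^2 * form f 1 g 1" unfolding ee by (simp add: form_def algebra_simps)
  then show "on_curve 2 2 E (P1_of_ratio e (k * f), P1_of_ratio e (k * g))"
    using f0 e by (subst on_curve_ratio) auto
qed

text \<open>
  The discriminant of the equation with respect to \<open>g\<close> is \<open>4 \<sigma>^2 A3^2 (1 - f^2) (1 - k^2 f^2)\<close>, which has
  four distinct roots; a singular point would give a double root.
\<close>

lemma smooth: "smooth_curve 2 2 E"
  unfolding smooth_curve_def
proof (intro allI impI)
  fix p assume on: "on_curve 2 2 E p"
  obtain P Q where p: "p = (P, Q)" by (cases p)
  show "local_coeff 2 2 E p 1 0 \<noteq> 0 \<or> local_coeff 2 2 E p 0 1 \<noteq> 0"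
  proof (cases P)
    case P: Infty
    show ?thesis
    proof (cases Q)
      case Infty
      then show ?thesis using on P A1_nonzero k by (simp add: p on_curve_def local_coeff_00 form_def)
    next
      case (Aff g)
      then have "A1 * k^2 * g^2 + A3 = 0" using on P by (simp add: p on_curve_def local_coeff_00 form_def algebra_simps)
      then have "g \<noteq> 0" using A by auto
      then show ?thesis using P Aff A1_nonzero k by (simp add: p local_coeff_Infty del: One_nat_def)
    qed
  next
    case P: (Aff f)
    show ?thesis
    proof (cases Q)
      case Infty
      then have "A1 * k^2 * f^2 + A3 = 0" using on P by (simp add: p on_curve_def local_coeff_00 form_def algebra_simps)
      then have "f \<noteq> 0" using A by auto
      then show ?thesis using P Infty A1_nonzero k by (simp add: p local_coeff_Infty del: One_nat_def)
    next
      case Q: (Aff g)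
      show ?thesis
      proof (rule ccontr)
        assume "\<not> ?thesis"
        then have d: "2 * A1 * k^2 * f * g^2 + A2 * g + 2 * A3 * f = 0" "2 * A1 * k^2 * f^2 * g + A2 * f + 2 * A3 * g = 0"
          by (simp_all add: p P Q local_coeff_10_Aff del: One_nat_def)
        have 0: "form f 1 g 1 = 0" using on by (simp add: p P Q on_curve_def local_coeff_00)
        \<comment> \<open>The discriminant is also (g-derivative)^2 - 4 (leading
          coefficient)(equation), hence zero at a singular point.\<close>
        have "4 * \<sigma>^2 * A3^2 * ((1 - f^2) * (1 - k^2 * f^2)) = (A2 * f)^2 - 4 * (A1 * k^2 * f^2 + A3) * (A1 + A3 * f^2)"
          unfolding A power_mult_distrib power2_minus \<tau> by (simp add: algebra_simps power2_eq_square)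
        also have "\<dots> = (2 * A1 * k^2 * f^2 * g + A2 * f + 2 * A3 * g)^2 - 4 * (A1 * k^2 * f^2 + A3) * form f 1 g 1"
          by (simp add: form_def algebra_simps power2_eq_square)
        finally have r1: "(1 - f^2) * (1 - k^2 * f^2) = 0" using A \<sigma> unfolding d 0 by simp
        \<comment> \<open>The same identity differentiated in f; the right side now also contains
          the f-derivative of the equation and vanishes again. So f would be a double root of (1 -
          f^2)(1 - k^2 f^2).\<close>
        have "8 * \<sigma>^2 * A3^2 * (- f * (1 - k^2 * f^2) - k^2 * f * (1 - f^2)) =
            2 * A2^2 * f - 8 * A1 * k^2 * f * (A1 + A3 * f^2) - 8 * (A1 * k^2 * f^2 + A3) * A3 * f"
          unfolding A power_mult_distrib power2_minus \<tau> by (simp add: algebra_simps power2_eq_square)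
        also have "\<dots> = 2 * (2 * A1 * k^2 * f^2 * g + A2 * f + 2 * A3 * g) * (4 * A1 * k^2 * f * g + A2)
           - 8 * A1 * k^2 * f * form f 1 g 1 - 4 * (A1 * k^2 * f^2 + A3) * (2 * A1 * k^2 * f * g^2 + A2 * g + 2 * A3 * f)"
          by (simp add: form_def algebra_simps power2_eq_square)
        finally have r2: "- f * (1 - k^2 * f^2) - k^2 * f * (1 - f^2) = 0" using A \<sigma> unfolding d 0 by simp
        from r1 have "f^2 = 1 \<or> k^2 * f^2 = 1" by auto
        then show False
        proof
          assume "f^2 = 1"
          then have "f \<noteq> 0" "f * (1 - k^2) = 0" using r2 by auto
          then show False using k by simp
        next
          assume kf: "k^2 * f^2 = 1"
          then have "f \<noteq> 0" "k^2 * f * (1 - f^2) = 0" using r2 by auto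
          then have "f^2 = 1" using k by simp
          then show False using kf k by simp
        qed
      qed
    qed
  qed
qed

section \<open>Lines, multiplicities and fixed points on the curve\<close>

lemma quadratic_three_zeros:
  assumes z: "\<And>i. i \<in> {Q1, Q2, Q3} \<Longrightarrow> a * (fst (hom_coords i))^2 + b * fst (hom_coords i) * snd (hom_coords i) + c * (snd (hom_coords i))^2 = 0"
    and d: "Q1 \<noteq> Q2" "Q2 \<noteq> Q3" "Q1 \<noteq> Q3"
  shows "a = 0 \<and> b = 0 \<and> (c :: complex) = 0"
proof -
  have two: "a * (g + h) + b = 0" if "Aff g \<in> {Q1, Q2, Q3}" "Aff h \<in> {Q1, Q2, Q3}" "g \<noteq> h" for g h
  proof -
    have "a * g^2 + b * g + c = 0" "a * h^2 + b * h + c = 0" using z[OF that(1)] z[OF that(2)] by auto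
    moreover have "(g - h) * (a * (g + h) + b) = (a * g^2 + b * g + c) - (a * h^2 + b * h + c)"
      by (simp add: algebra_simps power2_eq_square)
    ultimately have "(g - h) * (a * (g + h) + b) = 0" by simp
    then show ?thesis using that by simp
  qed
  have "a = 0"
  proof (cases "Infty \<in> {Q1, Q2, Q3}")
    case True
    then show ?thesis using z[OF True] by simp
  next
    case False
    then obtain g1 g2 g3 where g: "Q1 = Aff g1" "Q2 = Aff g2" "Q3 = Aff g3" by (cases Q1; cases Q2; cases Q3) auto
    have "a * (g1 + g2) + b = 0" "a * (g1 + g3) + b = 0" using two d g by auto
    moreover have "a * (g2 - g3) = (a * (g1 + g2) + b) - (a * (g1 + g3) + b)" by (simp add: algebra_simps)
    ultimately have "a * (g2 - g3) = 0" by simp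
    then show ?thesis using d g by simp
  qed
  moreover obtain g h where gh: "Aff g \<in> {Q1, Q2, Q3}" "Aff h \<in> {Q1, Q2, Q3}" "g \<noteq> h"
    using d by (cases Q1; cases Q2; cases Q3) auto
  ultimately have "a = 0" "b = 0" using two[OF gh] by auto
  then show ?thesis using z[OF gh(1)] by simp
qed

text \<open>On a line the equation is a binary quadratic form, so three zeros make all its
  coefficients vanish. This gives X0^2 = \<sigma>^2 X1^2, X1^2 = k^2 \<sigma>^2 X0^2 and \<tau> = 0,
  hence k^2 \<sigma>^4 = 1 and finally \<sigma>^2 = k^2 = 1.\<close>

lemma not_three_on_line:
  assumes on: "on_curve 2 2 E (P, Q1)" "on_curve 2 2 E (P, Q2)" "on_curve 2 2 E (P, Q3)"
    and d: "Q1 \<noteq> Q2" "Q2 \<noteq> Q3" "Q1 \<noteq> Q3"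
  shows False
proof -
  define X0 X1 where "X0 = fst (hom_coords P)" and "X1 = snd (hom_coords P)"
  have c: "A1 * k^2 * X0^2 + A3 * X1^2 = 0 \<and> A2 * X0 * X1 = 0 \<and> A1 * X1^2 + A3 * X0^2 = 0"
  proof (rule quadratic_three_zeros[OF _ d])
    fix i assume "i \<in> {Q1, Q2, Q3}"
    then have "on_curve 2 2 E (P, i)" using on by auto
    then have "form X0 X1 (fst (hom_coords i)) (snd (hom_coords i)) = 0"
      by (simp add: on_curve_def local_coeff_00 X0_def X1_def)
    then show "(A1 * k^2 * X0^2 + A3 * X1^2) * (fst (hom_coords i))^2 + A2 * X0 * X1 * fst (hom_coords i) * snd (hom_coords i)
        + (A1 * X1^2 + A3 * X0^2) * (snd (hom_coords i))^2 = 0"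
      by (simp add: form_def algebra_simps)
  qed
  have "A1 * k^2 * X0^2 + A3 * X1^2 = A3 * (X1^2 - k^2 * \<sigma>^2 * X0^2)"
    "A1 * X1^2 + A3 * X0^2 = A3 * (X0^2 - \<sigma>^2 * X1^2)"
    unfolding A(2) by (simp_all add: algebra_simps)
  moreover have "A2 * X0 * X1 = - (2 * A3) * (\<tau> * (X0 * X1))" unfolding A(3) by simp
  ultimately have e: "A3 * (X1^2 - k^2 * \<sigma>^2 * X0^2) = 0" "- (2 * A3) * (\<tau> * (X0 * X1)) = 0" "A3 * (X0^2 - \<sigma>^2 * X1^2) = 0"
    using c by argo+
  have nz: "(X0, X1) \<noteq> (0, 0)" unfolding X0_def X1_def by (rule hom_coords_nonzero)
  have e1: "X1^2 = k^2 * \<sigma>^2 * X0^2" and e2: "X0^2 = \<sigma>^2 * X1^2" using e(1,3) A(1) by simp_all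
  have "X0 \<noteq> 0" using e1 nz by auto
  moreover have "X1 \<noteq> 0" using e2 nz by auto
  ultimately have "\<tau> = 0" using e(2) A(1) by simp
  then have "\<sigma>^2 = 1 \<or> k^2 * \<sigma>^2 = 1" using \<tau> by auto
  moreover have ks: "k^2 * \<sigma>^2 * \<sigma>^2 = 1"
  proof -
    have "X0^2 * (k^2 * \<sigma>^2 * \<sigma>^2) = \<sigma>^2 * (k^2 * \<sigma>^2 * X0^2)" by (simp add: mult_ac)
    also have "\<dots> = X0^2" unfolding e1[symmetric] by (rule e2[symmetric])
    finally show ?thesis using \<open>X0 \<noteq> 0\<close> by simp
  qed
  ultimately have "\<sigma>^2 = 1" by auto
  then show False using ks k by simp
qed

lemma on_curve_commute: "on_curve 2 2 E (P, Q) \<longleftrightarrow> on_curve 2 2 E (Q, P)"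
  unfolding on_curve_def local_coeff_00 by (subst form_commute) simp

lemma no_three_collinear_if_on_curve:
  assumes "\<And>p. p \<in> B \<Longrightarrow> on_curve 2 2 E p"
  shows "no_three_collinear B"
  unfolding no_three_collinear_def
proof (intro ballI impI)
  fix p q r assume pqr: "p \<in> B" "q \<in> B" "r \<in> B" "p \<noteq> q \<and> q \<noteq> r \<and> p \<noteq> r"
  obtain p1 p2 q1 q2 r1 r2 where s: "p = (p1, p2)" "q = (q1, q2)" "r = (r1, r2)" by (cases p; cases q; cases r)
  have on: "on_curve 2 2 E (p1, p2)" "on_curve 2 2 E (q1, q2)" "on_curve 2 2 E (r1, r2)"
    using assms pqr s by auto
  show "\<not> collinear3 p q r"
  proof
    assume "collinear3 p q r"
    then have "(p1 = q1 \<and> q1 = r1) \<or> (p2 = q2 \<and> q2 = r2)" by (simp add: collinear3_def s)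
    then show False
      using not_three_on_line[of p1 p2 q2 r2] not_three_on_line[of p2 p1 q1 r1] on pqr s
        on_curve_commute[of p1 p2] on_curve_commute[of q1 q2] on_curve_commute[of r1 r2] by auto
  qed
qed

lemma multiplicity_one:
  assumes "on_curve 2 2 E p"
  shows "multiplicity_at 2 2 E p = 1"
  unfolding multiplicity_at_def
proof (rule Least_equality)
  show "\<exists>a b. a + b = 1 \<and> local_coeff 2 2 E p a b \<noteq> 0"
    using smooth assms unfolding smooth_curve_def by (metis add.commute add_0)
  fix r assume "\<exists>a b. a + b = r \<and> local_coeff 2 2 E p a b \<noteq> 0"
  then show "1 \<le> r" using assms unfolding on_curve_def by (cases r) auto
qed

lemma ell_A0:
  assumes "inj_on p {1..8}" "\<And>i. i \<in> {1..8} \<Longrightarrow> on_curve 2 2 E (p i)"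
  shows "ell_A0_surface p"
  unfolding ell_A0_surface_def strict_transform_class_def anticanonical_class_def
  using assms smooth multiplicity_one by (intro conjI exI[of _ E]) (auto simp: fun_eq_iff)

text \<open>(f, g) \<mapsto> (-f, -g) and (f, g) \<mapsto> (e/(k f), e/(k g)) translate the elliptic
  parameter by half-periods and therefore have no fixed point on the curve. Algebraically, a fixed
  point of the second kind leads to \<sigma>^2 (e - k)^2 = 0, so k^2 = 1.\<close>

lemma not_two_torsion:
  assumes "t^2 + q^2 - 2 * \<tau> * t * q - \<sigma>^2 * (1 + k^2 * t^2 * q^2) = 0"
  shows "\<not> (t = 0 \<and> q = 0)" "e^2 = 1 \<Longrightarrow> \<not> (k * t * t = e \<and> k * q * q = e)"
proof -
  show "\<not> (t = 0 \<and> q = 0)" using assms \<sigma> by auto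
  assume e: "e^2 = 1"
  show "\<not> (k * t * t = e \<and> k * q * q = e)"
  proof
    assume "k * t * t = e \<and> k * q * q = e"
    then have t: "k * t^2 = e" and q: "k * q^2 = e" by (auto simp: power2_eq_square mult.assoc)
    define d where "d = k * t * q"
    have d2: "d^2 = 1" using t q e unfolding d_def
      by (metis (no_types, lifting) mult.assoc mult.left_commute power2_eq_square)
    have "k * (t^2 + q^2) - 2 * \<tau> * (k * t * q) - \<sigma>^2 * (k + k * (k * t * q)^2) =
      k * (t^2 + q^2 - 2 * \<tau> * t * q - \<sigma>^2 * (1 + k^2 * t^2 * q^2))"
      by (simp add: algebra_simps power2_eq_square)
    then have "k * (t^2 + q^2) - 2 * \<tau> * d - \<sigma>^2 * (k + k * d^2) = 0"
      unfolding assms d_def[symmetric] by simp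
    then have "2 * (e - \<tau> * d - k * \<sigma>^2) = 0" using t q d2 by (simp add: algebra_simps)
    then have "e - \<tau> * d - k * \<sigma>^2 = 0" by (metis mult_eq_0_iff zero_neq_numeral)
    then have td: "\<tau> * d = e - k * \<sigma>^2" by (simp add: algebra_simps)
    have "\<tau>^2 = (\<tau> * d)^2" using d2 by (simp add: power_mult_distrib)
    also have "\<dots> = e^2 - 2 * e * k * \<sigma>^2 + k^2 * \<sigma>^2 * \<sigma>^2" unfolding td by (simp add: algebra_simps power2_eq_square)
    finally have "\<sigma>^2 * (e^2 + k^2 - 2 * e * k) = 0" unfolding \<tau> e by (simp add: algebra_simps)
    moreover have "(e - k)^2 = e^2 + k^2 - 2 * e * k" by (simp add: algebra_simps power2_eq_square)
    ultimately have "(e - k)^2 = 0" using \<sigma> by simp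
    then have "k = e" by simp
    then show False using e k by simp
  qed
qed

end

text \<open>Points of the x-family differ from each other, and from those of the t-family, already
  in the first coordinate. Within the t-family first coordinates may coincide, for instance when t =
  0, and both coordinates are needed.\<close>

lemma eight_points_distinct:
  fixes k x y t q e :: complex
  assumes k: "k \<noteq> 0" and e: "e^2 = 1" and x: "x \<noteq> 0" "1 - k^2 * x^4 \<noteq> 0" and xt: "x^2 \<noteq> t^2" "k^2 * x^2 * t^2 \<noteq> 1"
    and t0: "\<not> (t = 0 \<and> q = 0)" and tors: "\<And>e. e^2 = 1 \<Longrightarrow> \<not> (k * t * t = e \<and> k * q * q = e)"
  defines "R \<equiv> P1_of_ratio"
  shows "distinct [(R x 1, R y 1), (R (- x) 1, R (- y) 1), (R t 1, R q 1), (R (- t) 1, R (- q) 1),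
      (R e (k * x), R e (k * y)), (R (- e) (k * x), R (- e) (k * y)), (R e (k * t), R e (k * q)), (R (- e) (k * t), R (- e) (k * q))]"
proof -
  have e0: "e \<noteq> 0" using e by auto
  have eq: "R a b = R c d \<longleftrightarrow> a * d = b * c" if "a \<noteq> 0 \<or> b \<noteq> 0" "c \<noteq> 0 \<or> d \<noteq> 0" for a b c d
    unfolding R_def by (rule P1_of_ratio_eq_iff) (use that in auto)
  have ne: "k * x * x \<noteq> e" "k * x * x \<noteq> - e"
  proof -
    have "(k * x * x)^2 \<noteq> 1" using x(2) by (simp add: algebra_simps power2_eq_square power4_eq_xxxx)
    then show "k * x * x \<noteq> e" "k * x * x \<noteq> - e" using e by auto
  qed
  have ne2: "k * x * t \<noteq> e" "k * x * t \<noteq> - e"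
  proof -
    have "(k * x * t)^2 \<noteq> 1" using xt(2) by (simp add: algebra_simps power2_eq_square)
    then show "k * x * t \<noteq> e" "k * x * t \<noteq> - e" using e by auto
  qed
  have ne3: "x \<noteq> t" "x \<noteq> - t" using xt(1) by auto
  have ne4: "e * (k * t) \<noteq> - (e * (k * x))" "- (e * (k * t)) \<noteq> e * (k * x)"
  proof -
    have "e * k * (t + x) \<noteq> 0" using e0 k ne3(2) by (auto simp: add_eq_0_iff)
    then show "e * (k * t) \<noteq> - (e * (k * x))" "- (e * (k * t)) \<noteq> e * (k * x)"
      by (auto simp: algebra_simps eq_neg_iff_add_eq_0 neg_eq_iff_add_eq_0)
  qed
  have tt: "\<not> (k * t * t = e \<and> k * q * q = e)" "\<not> (k * t * t = - e \<and> k * q * q = - e)"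
    using tors[of e] tors[of "- e"] e by auto
  have A: "R x 1 \<noteq> R (- x) 1" "R x 1 \<noteq> R e (k * x)" "R x 1 \<noteq> R (- e) (k * x)" "R (- x) 1 \<noteq> R e (k * x)"
     "R (- x) 1 \<noteq> R (- e) (k * x)" "R e (k * x) \<noteq> R (- e) (k * x)"
    using x(1) k e0 ne by (auto simp: eq mult_ac minus_equation_iff[of e] equation_minus_iff)
  have B: "R x 1 \<noteq> R t 1" "R x 1 \<noteq> R (- t) 1" "R x 1 \<noteq> R e (k * t)" "R x 1 \<noteq> R (- e) (k * t)"
     "R (- x) 1 \<noteq> R t 1" "R (- x) 1 \<noteq> R (- t) 1" "R (- x) 1 \<noteq> R e (k * t)" "R (- x) 1 \<noteq> R (- e) (k * t)"
    using e0 ne2 ne3 by (auto simp: eq mult_ac minus_equation_iff[of e] equation_minus_iff)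
  have C: "R t 1 \<noteq> R e (k * x)" "R (- t) 1 \<noteq> R e (k * x)" "R t 1 \<noteq> R (- e) (k * x)" "R (- t) 1 \<noteq> R (- e) (k * x)"
     "R e (k * x) \<noteq> R e (k * t)" "R e (k * x) \<noteq> R (- e) (k * t)" "R (- e) (k * x) \<noteq> R e (k * t)" "R (- e) (k * x) \<noteq> R (- e) (k * t)"
    using e0 k ne2 ne3 ne4 by (auto simp: eq mult_ac minus_equation_iff[of e] equation_minus_iff)
  have D: "\<not> (R t 1 = R (- t) 1 \<and> R q 1 = R (- q) 1)" "\<not> (R e (k * t) = R (- e) (k * t) \<and> R e (k * q) = R (- e) (k * q))"
    using t0 e0 k by (auto simp: eq)
  have F: "\<not> (R t 1 = R e (k * t) \<and> R q 1 = R e (k * q))" "\<not> (R t 1 = R (- e) (k * t) \<and> R q 1 = R (- e) (k * q))"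
     "\<not> (R (- t) 1 = R e (k * t) \<and> R (- q) 1 = R e (k * q))" "\<not> (R (- t) 1 = R (- e) (k * t) \<and> R (- q) 1 = R (- e) (k * q))"
    using tt e0 by (auto simp: eq mult_ac minus_equation_iff[of e] equation_minus_iff)
  show ?thesis using A B C D F by auto
qed

section \<open>The base points of the mapping\<close>

theorem mainTheorem4:
  fixes k \<gamma>e \<gamma>o z0 K K' :: complex
    and sn cn dn :: "complex \<Rightarrow> complex"
    and n :: int
    and z :: "int \<Rightarrow> complex"
    and p :: "nat \<Rightarrow> P1xP1"
    and \<phi> :: "P1xP1 \<Rightarrow> P1xP1 option"
    and P S P' S' A1 A2 A3 :: complex
  assumes modulus: "elliptic_modulus k"
    and jacobi: "jacobi_elliptic k sn cn dn"
    and K: "K = quarter_period k"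
    and K': "K' = quarter_period' k"
    and non_autonomous: "\<gamma>e + \<gamma>o \<noteq> 0"
    and z: "\<And>j. z j = (\<gamma>e + \<gamma>o) * of_int j + z0"
    \<comment> \<open>the elliptic functions occurring in the formulas for the map and the curve are finite\<close>
    and finite_values:
      "\<forall>u \<in> {z (2*n), z (2*n+1), \<gamma>e, \<gamma>o,
             z (2*n) + K, \<gamma>e + K, \<gamma>o + K, z (2*n-1) + K}. \<not> is_pole sn u"
    \<comment> \<open>genericity of the parameters; a zero value of \<open>sn\<close> also covers its poles\<close>
    and generic_e: "generic_half_step k sn cn dn (z (2*n)) \<gamma>e"
    and generic_o: "generic_half_step k sn cn dn (z (2*n+1)) \<gamma>o"
    and generic_eo: "(sn (z (2*n)))\<^sup>2 \<noteq> (sn \<gamma>o)\<^sup>2" "k\<^sup>2 * (sn (z (2*n)))\<^sup>2 * (sn \<gamma>o)\<^sup>2 \<noteq> 1"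
    and generic_period: "sn (\<gamma>e + \<gamma>o) \<noteq> 0"
    and phi: "\<phi> = phi_a k sn cn dn \<gamma>e \<gamma>o (z (2*n)) (z (2*n+1))"
    and p1: "p 1 = (P1_value sn (z (2*n) + K), P1_value sn (\<gamma>e + K))"
    and p2: "p 2 = point_minus (p 1)"
    and p3: "p 3 = (P1_value sn (\<gamma>o + K), P1_value sn (z (2*n-1) + K))"
    and p4: "p 4 = point_minus (p 3)"
    and p5: "p 5 = (P1_value sn (z (2*n) + K + \<i> * K'), P1_value sn (\<gamma>e + K + \<i> * K'))"
    and p6: "p 6 = point_minus (p 5)"
    and p7: "p 7 = (P1_value sn (\<gamma>o + K + \<i> * K'), P1_value sn (z (2*n-1) + K + \<i> * K'))"
    and p8: "p 8 = point_minus (p 7)"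
    and P: "P = sn (\<gamma>e + K) * sn (z (2*n) + K)"
    and S: "S = (sn (\<gamma>e + K))\<^sup>2 + (sn (z (2*n) + K))\<^sup>2"
    and P': "P' = sn (\<gamma>o + K) * sn (z (2*n-1) + K)"
    and S': "S' = (sn (\<gamma>o + K))\<^sup>2 + (sn (z (2*n-1) + K))\<^sup>2"
    and A1: "A1 = P' * S - P * S'"
    and A2: "A2 = (1 + k\<^sup>2 * P\<^sup>2) * S' - (1 + k\<^sup>2 * P'\<^sup>2) * S"
    and A3: "A3 = P * (1 + k\<^sup>2 * P'\<^sup>2) - P' * (1 + k\<^sup>2 * P\<^sup>2)"
  shows "base_points \<phi> = p ` {1..8} \<and> inj_on p {1..8} \<and>
    (\<forall>x \<in> blowup (p ` {1..8}). \<not> lift_base_point \<phi> x) \<and>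
    (\<forall>i \<in> {1..8}. on_curve 2 2 (symmetric_biquadratic k A1 A2 A3) (p i)) \<and>
    no_three_collinear (p ` {1..8}) \<and>
    (no_three_collinear (p ` {1..8}) \<longleftrightarrow>
       elliptic_biquadratic (symmetric_biquadratic k A1 A2 A3)) \<and>
    ell_A0_surface p"
proof -
  interpret jacobi_periods k sn cn dn
    using jacobi modulus by unfold_locales
  define Z \<delta> where "Z = z (2*n)" and "\<delta> = \<gamma>o"
  have zs: "z (2*n+1) = Z + \<gamma>e + \<delta>" "z (2*n-1) = Z - \<gamma>e - \<delta>"
    by (simp_all add: z Z_def \<delta>_def algebra_simps)
  have KK: "K = local.K" "\<i> * K' = pole" by (simp_all add: K K' K_def pole_def)
  define x y t q where "x = sn (Z + local.K)" and "y = sn (\<gamma>e + local.K)" and "t = sn (\<delta> + local.K)"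
    and "q = sn (Z - \<gamma>e - \<delta> + local.K)"
  have reg: "Z \<in> regular_points" "\<gamma>e \<in> regular_points" "\<delta> \<in> regular_points" "Z + \<gamma>e + \<delta> \<in> regular_points"
    and regK: "Z + local.K \<in> regular_points" "\<gamma>e + local.K \<in> regular_points" "\<delta> + local.K \<in> regular_points"
      "Z - \<gamma>e - \<delta> + local.K \<in> regular_points"
    using finite_values unfolding zs Z_def[symmetric] \<delta>_def[symmetric] KK(1) by (simp_all add: regular_points_def)
  have ge: "generic_half_step k sn cn dn Z \<gamma>e" and go: "generic_half_step k sn cn dn (Z + \<gamma>e + \<delta>) \<delta>"
    using generic_e generic_o unfolding zs Z_def[symmetric] \<delta>_def[symmetric] by simp_all
  have geo: "(sn Z)^2 \<noteq> (sn \<delta>)^2" "k^2 * (sn Z)^2 * (sn \<delta>)^2 \<noteq> 1" "sn (\<gamma>e + \<delta>) \<noteq> 0"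
    using generic_eo generic_period by (simp_all add: Z_def \<delta>_def)
  obtain \<sigma> \<tau> h where
    cd: "x * dn Z = cn Z" "y * dn \<gamma>e = cn \<gamma>e" "t * dn \<delta> = cn \<delta>" "h * dn (Z + \<gamma>e + \<delta>) = cn (Z + \<gamma>e + \<delta>)"
    and dn0: "dn \<gamma>e \<noteq> 0" "dn \<delta> \<noteq> 0"
    and eqn: "(1 - k^2 * sn Z ^ 4) * cn \<gamma>e * dn \<gamma>e * (t * (q + h)) =
       (1 - k^2 * (sn Z)^2 * (sn \<gamma>e)^2) * cn Z * dn Z * (t^2 + q * h)
       + ((cn \<gamma>e)^2 - (cn Z)^2) * cn Z * dn Z * (1 + k^2 * t^2 * q * h)"
    and \<tau>: "\<tau>^2 = (1 - \<sigma>^2) * (1 - k^2 * \<sigma>^2)" and \<sigma>: "\<sigma> \<noteq> 0"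
    and xy: "x^2 + y^2 - 2 * \<tau> * x * y - \<sigma>^2 * (1 + k^2 * x^2 * y^2) = 0"
    and tq: "t^2 + q^2 - 2 * \<tau> * t * q - \<sigma>^2 * (1 + k^2 * t^2 * q^2) = 0"
    and sep: "x * y \<noteq> t * q" "k^2 * (x * y) * (t * q) \<noteq> 1"
    and x0: "x \<noteq> 0" "1 - k^2 * x^4 \<noteq> 0" and xt: "x^2 \<noteq> t^2" "k^2 * x^2 * t^2 \<noteq> 1"
    using configuration[OF reg regK ge go geo] unfolding x_def y_def t_def q_def by metis
  have k: "k \<noteq> 0" "k^2 \<noteq> 1" using k_nonzero by auto
  have step: "step_map k ((1 - k^2 * sn u ^ 4) * cn \<gamma> * dn \<gamma>) (((cn \<gamma>)^2 - (cn u)^2) * cn u * dn u)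
      ((1 - k^2 * (sn \<gamma>)^2 * (sn u)^2) * cn u * dn u) a b"
    if g: "generic_half_step k sn cn dn u \<gamma>" and r: "u \<in> regular_points" "\<gamma> \<in> regular_points"
      and ab: "a * dn u = cn u" "b * dn \<gamma> = cn \<gamma>" for u \<gamma> a b
  proof
    note g' = g[unfolded generic_half_step_def]
    note ci = cd_identities[OF squares[OF r(1)] squares[OF r(2)] ab]
    show "k \<noteq> 0" by (rule k)
    show "((cn \<gamma>)^2 - (cn u)^2) * cn u * dn u \<noteq> 0" "(1 - k^2 * (sn \<gamma>)^2 * (sn u)^2) * cn u * dn u \<noteq> 0"
      using g' by (auto simp: mult_ac)
    show "a \<noteq> 0" using g' ab by auto
    have "(1 - k^2) * (1 - k^2 * sn u ^ 4) \<noteq> 0" using g' k by auto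
    then show "1 - k^2 * a ^ 4 \<noteq> 0" using ci(1) by auto
  qed (fact cd_identities[OF squares[OF r(1)] squares[OF r(2)] ab])+
  \<comment> \<open>The base point of the second half-step enters as (h, t): its first argument is
    u_{2n+1}, to which h = cd z_{2n+1} belongs, and its second is u_{2n}, to which t = cd \<gamma>o
    belongs.\<close>
  interpret map: two_step_map k
    "(1 - k^2 * sn Z ^ 4) * cn \<gamma>e * dn \<gamma>e" "((cn \<gamma>e)^2 - (cn Z)^2) * cn Z * dn Z"
    "(1 - k^2 * (sn \<gamma>e)^2 * (sn Z)^2) * cn Z * dn Z" x y
    "(1 - k^2 * sn (Z + \<gamma>e + \<delta>) ^ 4) * cn \<delta> * dn \<delta>"
    "((cn \<delta>)^2 - (cn (Z + \<gamma>e + \<delta>))^2) * cn (Z + \<gamma>e + \<delta>) * dn (Z + \<gamma>e + \<delta>)"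
    "(1 - k^2 * (sn \<delta>)^2 * (sn (Z + \<gamma>e + \<delta>))^2) * cn (Z + \<gamma>e + \<delta>) * dn (Z + \<gamma>e + \<delta>)" h t q
  proof (intro two_step_map.intro two_step_map_axioms.intro)
    show "step_num ((1 - k^2 * sn Z ^ 4) * cn \<gamma>e * dn \<gamma>e) (((cn \<gamma>e)^2 - (cn Z)^2) * cn Z * dn Z)
        ((1 - k^2 * (sn \<gamma>e)^2 * (sn Z)^2) * cn Z * dn Z) t 1 q 1 =
      h * step_den (k^2) ((1 - k^2 * sn Z ^ 4) * cn \<gamma>e * dn \<gamma>e) (((cn \<gamma>e)^2 - (cn Z)^2) * cn Z * dn Z)
        ((1 - k^2 * (sn \<gamma>e)^2 * (sn Z)^2) * cn Z * dn Z) t 1 q 1"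
    proof -
      define \<alpha> \<beta> \<epsilon> where "\<alpha> = (1 - k^2 * sn Z ^ 4) * cn \<gamma>e * dn \<gamma>e" and "\<beta> = ((cn \<gamma>e)^2 - (cn Z)^2) * cn Z * dn Z"
        and "\<epsilon> = (1 - k^2 * (sn \<gamma>e)^2 * (sn Z)^2) * cn Z * dn Z"
      have "\<epsilon> = (1 - k^2 * (sn Z)^2 * (sn \<gamma>e)^2) * cn Z * dn Z" by (simp add: \<epsilon>_def mult_ac)
      \<comment> \<open>The second-order equation, solved for h, is the transport condition.\<close>
      then have "\<alpha> * (t * (q + h)) = \<epsilon> * (t^2 + q * h) + \<beta> * (1 + k^2 * t^2 * q * h)"
        using eqn by (simp add: \<alpha>_def \<beta>_def)
      then show ?thesis unfolding \<alpha>_def[symmetric] \<beta>_def[symmetric] \<epsilon>_def[symmetric]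
        by (simp add: step_num_def step_den_def algebra_simps)
    qed
  qed (use step[OF ge reg(1,2) cd(1,2)] step[OF go reg(4,3) cd(4,3)] xt in auto)
  have phi': "\<phi> = map.\<Phi>"
    unfolding phi phi_a_def map.\<Phi>_def map.H1_def map.H2_def two_step_def half_step_eq_P1_step zs Z_def[symmetric] \<delta>_def[symmetric]
    by simp
  obtain \<epsilon> where eps: "\<epsilon>^2 = 1" and shift: "\<And>v. v \<in> regular_points \<Longrightarrow> P1_value sn (v + pole) = P1_of_ratio \<epsilon> (k * sn v)"
    using shift_pole by blast
  have aff: "P1_value sn v = P1_of_ratio (sn v) 1" if "v \<in> regular_points" for v
    using that by (simp add: P1_value_def P1_of_ratio_def regular_points_def)
  have minus: "P1_minus (P1_of_ratio a b) = P1_of_ratio (- a) b" for a b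
    by (simp add: P1_of_ratio_def)
  have ps: "p 1 = (P1_of_ratio x 1, P1_of_ratio y 1)" "p 2 = (P1_of_ratio (- x) 1, P1_of_ratio (- y) 1)"
    "p 3 = (P1_of_ratio t 1, P1_of_ratio q 1)" "p 4 = (P1_of_ratio (- t) 1, P1_of_ratio (- q) 1)"
    "p 5 = (P1_of_ratio \<epsilon> (k * x), P1_of_ratio \<epsilon> (k * y))" "p 6 = (P1_of_ratio (- \<epsilon>) (k * x), P1_of_ratio (- \<epsilon>) (k * y))"
    "p 7 = (P1_of_ratio \<epsilon> (k * t), P1_of_ratio \<epsilon> (k * q))" "p 8 = (P1_of_ratio (- \<epsilon>) (k * t), P1_of_ratio (- \<epsilon>) (k * q))"
    unfolding p2 p4 p6 p8 p1 p3 p5 p7 point_minus_def zs Z_def[symmetric] \<delta>_def[symmetric] KK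
    by (simp_all add: aff regK shift minus x_def y_def t_def q_def)
  have eight: "{1..8} = set [1, 2, 3, 4, 5, 6, 7, 8 :: nat]" by auto
  have image: "p ` {1..8} = map.base_set"
  proof -
    define F where "F = (\<lambda>e. {(P1_of_ratio (e * x) 1, P1_of_ratio (e * y) 1), (P1_of_ratio e (k * x), P1_of_ratio e (k * y)),
      (P1_of_ratio (e * t) 1, P1_of_ratio (e * q) 1), (P1_of_ratio e (k * t), P1_of_ratio e (k * q))})"
    have base: "map.base_set = F 1 \<union> F (- 1)" by (simp only: map.base_set_def F_def UN_insert UN_empty Un_empty_right)
    have im: "p ` {1..8} = {p 1, p 2, p 3, p 4, p 5, p 6, p 7, p 8}" unfolding eight by simp
    \<comment> \<open>Reversing \<epsilon> only exchanges p 5 with p 6 and p 7 with p 8, so both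
      signs give the same set.\<close>
    consider "\<epsilon> = 1" | "\<epsilon> = - 1" using eps by (auto simp: power2_eq_1_iff)
    then show ?thesis
    proof cases
      case 1
      have "F 1 = {p 1, p 5, p 3, p 7}" "F (- 1) = {p 2, p 6, p 4, p 8}" unfolding F_def ps 1 by simp_all
      then show ?thesis unfolding base im by blast
    next
      case 2
      have "F 1 = {p 1, p 6, p 3, p 8}" "F (- 1) = {p 2, p 5, p 4, p 7}" unfolding F_def ps 2 by simp_all
      then show ?thesis unfolding base im by blast
    qed
  qed
  have PS: "P = y * x" "S = y^2 + x^2" "P' = t * q" "S' = t^2 + q^2"
    unfolding P S P' S' zs Z_def[symmetric] \<delta>_def[symmetric] KK x_def y_def t_def q_def by simp_all
  \<comment> \<open>Up to sign, (A1, A2, A3) is the cross product of (1 + k^2 P^2, P, S) and (1 +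
    k^2 P'^2, P', S'). Both vectors are orthogonal to (\<sigma>^2, 2 \<tau>, -1), whence the
    proportions required by the locale.\<close>
  have S2: "S = 2 * \<tau> * P + \<sigma>^2 * (1 + k^2 * P^2)" "S' = 2 * \<tau> * P' + \<sigma>^2 * (1 + k^2 * P'^2)"
    using xy tq unfolding PS by (simp_all add: power_mult_distrib algebra_simps)
  interpret curve: jacobi_biquadratic k \<sigma> \<tau> A1 A2 A3
  proof
    \<comment> \<open>The two factors are those kept away from 0 by
      \<open>products_separated\<close>.\<close>
    have "A3 = (P - P') * (1 - k^2 * P * P')" unfolding A3 by (simp add: algebra_simps power2_eq_square)
    moreover have "P - P' \<noteq> 0" "1 - k^2 * P * P' \<noteq> 0" using sep unfolding PS by (auto simp: mult_ac)
    ultimately show "A3 \<noteq> 0" by simp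
    show "A1 = - (\<sigma>^2 * A3)" unfolding A1 A3 S2 by (simp add: algebra_simps)
    show "A2 = - (2 * \<tau> * A3)" unfolding A2 A3 S2 by (simp add: algebra_simps)
  qed (fact k \<sigma> \<tau>)+
  have on: "on_curve 2 2 (symmetric_biquadratic k A1 A2 A3) (p i)" if "i \<in> {1..8}" for i
  proof -
    have "(- \<epsilon>)^2 = 1" using eps by simp
    note c = curve.on_curve_points
    have "\<forall>i\<in>set [1, 2, 3, 4, 5, 6, 7, 8 :: nat]. on_curve 2 2 (symmetric_biquadratic k A1 A2 A3) (p i)"
      using c(1)[OF xy, of 1] c(1)[OF xy, of "-1"] c(1)[OF tq, of 1] c(1)[OF tq, of "-1"]
        c(2)[OF xy eps] c(2)[OF xy \<open>(- \<epsilon>)^2 = 1\<close>] c(2)[OF tq eps] c(2)[OF tq \<open>(- \<epsilon>)^2 = 1\<close>]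
      by (simp add: ps del: One_nat_def)
    then show ?thesis using that unfolding eight by blast
  qed
  have "distinct (map p [1, 2, 3, 4, 5, 6, 7, 8])"
    using eight_points_distinct[OF k(1) eps x0 xt curve.not_two_torsion[OF tq]] unfolding list.map ps .
  then have inj: "inj_on p {1..8}" unfolding eight distinct_map by blast
  \<comment> \<open>The equivalence with ellipticity holds because, under the hypotheses, both of
    its sides have been established.\<close>
  have "no_three_collinear (p ` {1..8})" using on by (intro curve.no_three_collinear_if_on_curve) blast
  then show ?thesis
    using image map.base_points_Phi map.no_lift_base_point inj on curve.smooth curve.ell_A0[OF inj on]
    unfolding phi' by metis
qed

end
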